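(* Let $(W,S)$ be a Coxeter system with $W$ finite, with a realization in a real vector space $V$ and closed Weyl chamber $\overline C$. Then there exists one and only one (up to isomorphism of each $B(\lambda)$) closed family $(B(\lambda))_{\lambda\in\overline C}$ of highest weight normal continuous crystals, where $B(\lambda)$ has highest weight $\lambda$.
   Context: **Realization.** $W$ is generated by the finite set of involutions $S$ with relations $(ss')^{m(s,s')}=1$, $m(s,s')$ the order of $ss'$. A realization is a real vector space $V$ with dual $V^\vee$, an action of $W$ on $V$, and pairs $(\alpha_s,\alpha_s^\vee)\in V\times V^\vee$, $s\in S$, with $s(x)=x-\alpha_s^\vee(x)\alpha_s$ (so $\alpha_s^\vee(\alpha_s)=2$). As is standard, for $s\ne s'$: $\alpha_s^\vee(\alpha_{s'})=\alpha_{s'}^\vee(\alpha_s)=0$ if $m(s,s')=2$, otherwise both are negative with product $4\cos^2(\pi/m(s,s'))$. $\Sigma=\{\alpha_s\}$; for $\alpha=\alpha_s$ write $\alpha^\vee=\alpha_s^\vee$. $\overline C=\{v\in V:\alpha_s^\vee(v)\ge0\ \forall s\in S\}$. **Continuous crystal.** A set $B$ with maps $wt:B\to V$, $\varepsilon_\alpha,\varphi_\alpha:B\to\mathbb R\cup\{-\infty\}$ and $e_\alpha^r:B\cup\{\mathbf 0\}\to B\cup\{\mathbf 0\}$ ($\alpha\in\Sigma$, $r\in\mathbb R$; $\mathbf 0$ a ghost element not in $B$) such that for all $\alpha\in\Sigma,b\in B$: (C1) $\varphi_\alpha(b)=\varepsilon_\alpha(b)+\alpha^\vee(wt(b))$;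 (C2) if $e_\alpha^r(b)\ne\mathbf 0$ then $\varepsilon_\alpha(e_\alpha^rb)=\varepsilon_\alpha(b)-r$, $\varphi_\alpha(e_\alpha^rb)=\varphi_\alpha(b)+r$, $wt(e_\alpha^rb)=wt(b)+r\alpha$; (C3) $e_\alpha^r(\mathbf 0)=\mathbf 0$, $e_\alpha^0(b)=b$, and if $e_\alpha^r(b)\neq\mathbf 0$ then $e_\alpha^{s+r}(b)=e_\alpha^s(e_\alpha^r(b))$ for all $s\in\mathbb R$; (C4) if $\varphi_\alpha(b)=-\infty$ then $e_\alpha^r(b)=\mathbf 0$ for all $r\ne0$. For $r\ge0$ put $f_\alpha^r=e_\alpha^{-r}$. **Normal.** $B$ is normal if for all $b\in B$, $\alpha\in\Sigma$: $\varepsilon_\alpha(b)=\max\{r\ge0:e_\alpha^r(b)\ne\mathbf 0\}$ and $\varphi_\alpha(b)=\max\{r\ge0:e_\alpha^{-r}(b)\neq\mathbf 0\}$. **Morphisms.** A morphism $B_1\to B_2$ is a map $\psi:B_1\cup\{\mathbf 0\}\to B_2\cup\{\mathbf 0\}$ with $\psi(\mathbf 0)=\mathbf 0$, preserving $wt,\varepsilon_\alpha,\varphi_\alpha$ on $B_1$, and with $e_\alpha^r(\psi(b))=\psi(e_\alpha^r(b))$ whenever $e_\alpha^r(b)\in B_1$. An isomorphism is a morphism having a two-sided inverse morphism. **Tensor product** (of normal crystals). $B_1\otimes B_2$ is the set $B_1\times B_2$ with elements $b_1\otimes b_2$. With $\sigma=\varphi_\alpha(b_1)-\varepsilon_\alpha(b_2)$,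 $\sigma^+=\max(0,\sigma)$, $\sigma^-=\max(0,-\sigma)$: $wt(b_1\otimes b_2)=wt(b_1)+wt(b_2)$, $\varepsilon_\alpha(b_1\otimes b_2)=\varepsilon_\alpha(b_1)+\sigma^-$, $\varphi_\alpha(b_1\otimes b_2)=\varphi_\alpha(b_2)+\sigma^+$, $e_\alpha^r(b_1\otimes b_2)=e_\alpha^{\max(r,-\sigma)-\sigma^-}b_1\otimes e_\alpha^{\min(r,-\sigma)+\sigma^+}b_2$, where $b_1\otimes\mathbf 0=\mathbf 0\otimes b_2=\mathbf 0$. **Highest weight.** Let $\mathcal F$ be the semigroup of all finite compositions $f_{\alpha_1}^{r_1}\cdots f_{\alpha_k}^{r_k}$, $\alpha_i\in\Sigma$, $r_i\ge0$, and $\mathcal F(b)=\{f(b):f\in\mathcal F,\ f(b)\ne\mathbf 0\}$. A crystal $B(\lambda)$ is of highest weight $\lambda\in V$ if there is $b_\lambda\in B(\lambda)$ (then unique) with $wt(b_\lambda)=\lambda$, $e_\alpha^r(b_\lambda)=\mathbf 0$ for all $r>0,\alpha\in\Sigma$, and $B(\lambda)=\mathcal F(b_\lambda)$. **Closed family.** $(B(\lambda))_{\lambda\in\overline C}$ is closed if for all $\lambda,\mu\in\overline C$ the subset $\mathcal F(b_\lambda\otimes b_\mu)$ of $B(\lambda)\otimes B(\mu)$ is a crystal (with the restricted structure) isomorphic to $B(\lambda+\mu)$. *)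

theory Defs
  imports Complex_Main "HOL-Library.Extended_Real" "HOL-Algebra.Group_Action"
    "HOL-Algebra.Multiplicative_Group"
begin

section \<open>Coxeter systems and their realizations\<close>

text \<open>
  Equality of words modulo the relations \<open>(s t)^m(s,t) = 1\<close>, where \<open>m(s,t)\<close> is the order of
  \<open>s t\<close> in \<open>W\<close>. Since \<open>m(s,s) = 1\<close>, the relations \<open>s s = 1\<close> are included, so positive words
  suffice. If \<open>s t\<close> has infinite order then \<^const>\<open>group.ord\<close> returns \<open>0\<close> and the relator
  is the empty word.
\<close>

inductive coxeter_eq :: "('w, 'x) monoid_scheme \<Rightarrow> 'w set \<Rightarrow> 'w list \<Rightarrow> 'w list \<Rightarrow> bool"
  for W :: "('w, 'x) monoid_scheme" and S :: "'w set" where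
  relator: "s \<in> S \<Longrightarrow> t \<in> S \<Longrightarrow>
      coxeter_eq W S (u @ concat (replicate (group.ord W (s \<otimes>\<^bsub>W\<^esub> t)) [s, t]) @ v) (u @ v)"
| refl: "coxeter_eq W S u u"
| sym: "coxeter_eq W S u v \<Longrightarrow> coxeter_eq W S v u"
| trans: "coxeter_eq W S u v \<Longrightarrow> coxeter_eq W S v w \<Longrightarrow> coxeter_eq W S u w"

text \<open>
  The last condition says that the relations above present \<open>W\<close>: a word in \<open>S\<close> that is trivial
  in \<open>W\<close> is trivial modulo the relations.
\<close>

definition coxeter_system :: "('w, 'x) monoid_scheme \<Rightarrow> 'w set \<Rightarrow> bool" where
  "coxeter_system W S \<longleftrightarrow>
     group W \<and> finite S \<and> S \<subseteq> carrier W \<and>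
     (\<forall>s\<in>S. s \<noteq> \<one>\<^bsub>W\<^esub> \<and> s \<otimes>\<^bsub>W\<^esub> s = \<one>\<^bsub>W\<^esub>) \<and>
     generate W S = carrier W \<and>
     (\<forall>w\<in>lists S. foldr (\<lambda>s x. s \<otimes>\<^bsub>W\<^esub> x) w \<one>\<^bsub>W\<^esub> = \<one>\<^bsub>W\<^esub> \<longrightarrow> coxeter_eq W S w [])"

text \<open>
  The vector space is the whole type \<open>'v\<close>; the coroots are elements of its algebraic dual.
  The pairs \<open>(\<alpha>\<^sub>s, \<alpha>\<^sub>s\<^sup>\<or>)\<close> are \<open>(simple_root s, coroot s)\<close>.
\<close>

definition realization ::
  "('w, 'x) monoid_scheme \<Rightarrow> 'w set \<Rightarrow> ('w \<Rightarrow> 'v::real_vector \<Rightarrow> 'v) \<Rightarrow> ('w \<Rightarrow> 'v) \<Rightarrow>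
   ('w \<Rightarrow> 'v \<Rightarrow> real) \<Rightarrow> bool" where
  "realization W S act simple_root coroot \<longleftrightarrow>
     group_action W UNIV act \<and> (\<forall>g\<in>carrier W. linear (act g)) \<and>
     (\<forall>s\<in>S. linear (coroot s)) \<and>
     (\<forall>s\<in>S. coroot s (simple_root s) = 2) \<and>
     (\<forall>s\<in>S. \<forall>x. act s x = x - coroot s x *\<^sub>R simple_root s) \<and>
     (\<forall>s\<in>S. \<forall>t\<in>S. s \<noteq> t \<longrightarrow>
        (if group.ord W (s \<otimes>\<^bsub>W\<^esub> t) = 2
         then coroot s (simple_root t) = 0 \<and> coroot t (simple_root s) = 0
         else coroot s (simple_root t) < 0 \<and> coroot t (simple_root s) < 0 \<and>
              coroot s (simple_root t) * coroot t (simple_root s) =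
                4 * (cos (pi / real (group.ord W (s \<otimes>\<^bsub>W\<^esub> t))))\<^sup>2))"

definition closed_chamber :: "'w set \<Rightarrow> ('w \<Rightarrow> 'v \<Rightarrow> real) \<Rightarrow> 'v set" where
  "closed_chamber S coroot = {v. \<forall>s\<in>S. coroot s v \<ge> 0}"

section \<open>Continuous crystals\<close>

text \<open>
  The ghost element is \<^const>\<open>None\<close>, so the operators act on \<open>'b option\<close>. The structure maps are
  indexed by the generators \<open>s\<close> instead of the simple roots \<open>\<alpha>\<^sub>s\<close>; in a realization the simple
  roots of different generators are different.
\<close>

record ('b, 's, 'v) crystal = "'b partial_object" +
  wt :: "'b \<Rightarrow> 'v"
  eps :: "'s \<Rightarrow> 'b \<Rightarrow> ereal"
  phi :: "'s \<Rightarrow> 'b \<Rightarrow> ereal"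
  op_e :: "'s \<Rightarrow> real \<Rightarrow> 'b option \<Rightarrow> 'b option"

definition ghosted :: "('b, 'z) partial_object_scheme \<Rightarrow> 'b option set" where
  "ghosted B = insert None (Some ` carrier B)"

definition is_crystal ::
  "'s set \<Rightarrow> ('s \<Rightarrow> 'v) \<Rightarrow> ('s \<Rightarrow> 'v \<Rightarrow> real) \<Rightarrow> ('b, 's, 'v::real_vector) crystal \<Rightarrow> bool" where
  "is_crystal S simple_root coroot B \<longleftrightarrow>
     (\<forall>s\<in>S. \<forall>r. op_e B s r \<in> ghosted B \<rightarrow> ghosted B) \<and>
     (\<forall>s\<in>S. \<forall>b\<in>carrier B. eps B s b \<noteq> \<infinity> \<and> phi B s b \<noteq> \<infinity>) \<and>
     (\<forall>s\<in>S. \<forall>b\<in>carrier B. phi B s b = eps B s b + ereal (coroot s (wt B b))) \<and>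
     (\<forall>s\<in>S. \<forall>r. \<forall>b\<in>carrier B. \<forall>c. op_e B s r (Some b) = Some c \<longrightarrow>
        eps B s c = eps B s b - ereal r \<and> phi B s c = phi B s b + ereal r \<and>
        wt B c = wt B b + r *\<^sub>R simple_root s) \<and>
     (\<forall>s\<in>S. \<forall>r. op_e B s r None = None) \<and>
     (\<forall>s\<in>S. \<forall>b\<in>carrier B. op_e B s 0 (Some b) = Some b) \<and>
     (\<forall>s\<in>S. \<forall>r. \<forall>b\<in>carrier B. op_e B s r (Some b) \<noteq> None \<longrightarrow>
        (\<forall>q. op_e B s (q + r) (Some b) = op_e B s q (op_e B s r (Some b)))) \<and>
     (\<forall>s\<in>S. \<forall>b\<in>carrier B. phi B s b = -\<infinity> \<longrightarrow> (\<forall>r. r \<noteq> 0 \<longrightarrow> op_e B s r (Some b) = None))"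

definition op_f :: "('b, 's, 'v) crystal \<Rightarrow> 's \<Rightarrow> real \<Rightarrow> 'b option \<Rightarrow> 'b option" where
  "op_f B s r = op_e B s (- r)"

definition is_maximum :: "real set \<Rightarrow> ereal \<Rightarrow> bool" where
  "is_maximum X m \<longleftrightarrow> (\<exists>x\<in>X. m = ereal x \<and> (\<forall>y\<in>X. y \<le> x))"

definition normal_crystal :: "'s set \<Rightarrow> ('b, 's, 'v) crystal \<Rightarrow> bool" where
  "normal_crystal S B \<longleftrightarrow>
     (\<forall>s\<in>S. \<forall>b\<in>carrier B.
        is_maximum {r. r \<ge> 0 \<and> op_e B s r (Some b) \<noteq> None} (eps B s b) \<and>
        is_maximum {r. r \<ge> 0 \<and> op_e B s (- r) (Some b) \<noteq> None} (phi B s b))"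

text \<open>
  The maps \<^const>\<open>wt\<close>, \<^const>\<open>eps\<close>, \<^const>\<open>phi\<close> have no value at the ghost element, so they are
  compared only where \<open>\<psi>\<close> does not take an element to the ghost. An isomorphism never does that.
\<close>

definition crystal_morphism ::
  "'s set \<Rightarrow> ('b, 's, 'v) crystal \<Rightarrow> ('c, 's, 'v) crystal \<Rightarrow> ('b option \<Rightarrow> 'c option) \<Rightarrow> bool" where
  "crystal_morphism S B1 B2 \<psi> \<longleftrightarrow>
     \<psi> \<in> ghosted B1 \<rightarrow> ghosted B2 \<and> \<psi> None = None \<and>
     (\<forall>b\<in>carrier B1. \<forall>c. \<psi> (Some b) = Some c \<longrightarrow>
        wt B2 c = wt B1 b \<and> (\<forall>s\<in>S. eps B2 s c = eps B1 s b \<and> phi B2 s c = phi B1 s b)) \<and>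
     (\<forall>s\<in>S. \<forall>r. \<forall>b\<in>carrier B1. op_e B1 s r (Some b) \<in> Some ` carrier B1 \<longrightarrow>
        op_e B2 s r (\<psi> (Some b)) = \<psi> (op_e B1 s r (Some b)))"

definition crystal_iso ::
  "'s set \<Rightarrow> ('b, 's, 'v) crystal \<Rightarrow> ('c, 's, 'v) crystal \<Rightarrow> bool" where
  "crystal_iso S B1 B2 \<longleftrightarrow>
     (\<exists>\<psi> \<chi>. crystal_morphism S B1 B2 \<psi> \<and> crystal_morphism S B2 B1 \<chi> \<and>
        (\<forall>x\<in>ghosted B1. \<chi> (\<psi> x) = x) \<and> (\<forall>y\<in>ghosted B2. \<psi> (\<chi> y) = y))"

text \<open>
  Used for normal crystals only, where \<^const>\<open>eps\<close> and \<^const>\<open>phi\<close> are finite, so that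
  \<^const>\<open>real_of_ereal\<close> loses nothing.
\<close>

definition tensor_sigma ::
  "('b, 's, 'v) crystal \<Rightarrow> ('c, 's, 'v) crystal \<Rightarrow> 's \<Rightarrow> 'b \<Rightarrow> 'c \<Rightarrow> real" where
  "tensor_sigma B1 B2 s b1 b2 = real_of_ereal (phi B1 s b1) - real_of_ereal (eps B2 s b2)"

fun tensor_opt :: "'b option \<Rightarrow> 'c option \<Rightarrow> ('b \<times> 'c) option" where
  "tensor_opt (Some b1) (Some b2) = Some (b1, b2)"
| "tensor_opt _ _ = None"

definition tensor_e ::
  "('b, 's, 'v) crystal \<Rightarrow> ('c, 's, 'v) crystal \<Rightarrow> 's \<Rightarrow> real \<Rightarrow> 'b \<times> 'c \<Rightarrow> ('b \<times> 'c) option" where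
  "tensor_e B1 B2 s r = (\<lambda>(b1, b2). let \<sigma> = tensor_sigma B1 B2 s b1 b2 in
     tensor_opt (op_e B1 s (max r (- \<sigma>) - max 0 (- \<sigma>)) (Some b1))
                (op_e B2 s (min r (- \<sigma>) + max 0 \<sigma>) (Some b2)))"

definition tensor ::
  "('b, 's, 'v::real_vector) crystal \<Rightarrow> ('c, 's, 'v) crystal \<Rightarrow> ('b \<times> 'c, 's, 'v) crystal" where
  "tensor B1 B2 =
     \<lparr> carrier = carrier B1 \<times> carrier B2,
       wt = (\<lambda>(b1, b2). wt B1 b1 + wt B2 b2),
       eps = (\<lambda>s (b1, b2). eps B1 s b1 + ereal (max 0 (- tensor_sigma B1 B2 s b1 b2))),
       phi = (\<lambda>s (b1, b2). phi B2 s b2 + ereal (max 0 (tensor_sigma B1 B2 s b1 b2))),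
       op_e = (\<lambda>s r x. Option.bind x (tensor_e B1 B2 s r)) \<rparr>"

text \<open>
  The empty composition is included. It matters only when \<open>S\<close> is empty, since otherwise
  \<open>f\<^sub>\<alpha>\<^sup>0\<close> is already the identity.
\<close>

definition f_orbit :: "'s set \<Rightarrow> ('b, 's, 'v) crystal \<Rightarrow> 'b \<Rightarrow> 'b set" where
  "f_orbit S B b =
     {c. \<exists>w\<in>lists (S \<times> {0..}). foldr (\<lambda>(s, r). op_f B s r) w (Some b) = Some c}"

definition highest_weight_element ::
  "'s set \<Rightarrow> ('b, 's, 'v) crystal \<Rightarrow> 'v \<Rightarrow> 'b \<Rightarrow> bool" where
  "highest_weight_element S B \<mu> b \<longleftrightarrow>
     b \<in> carrier B \<and> wt B b = \<mu> \<and>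
     (\<forall>s\<in>S. \<forall>r>0. op_e B s r (Some b) = None) \<and>
     carrier B = f_orbit S B b"

definition of_highest_weight :: "'s set \<Rightarrow> ('b, 's, 'v) crystal \<Rightarrow> 'v \<Rightarrow> bool" where
  "of_highest_weight S B \<mu> \<longleftrightarrow> (\<exists>b. highest_weight_element S B \<mu> b)"

definition highest_weight_normal_family ::
  "'s set \<Rightarrow> ('s \<Rightarrow> 'v) \<Rightarrow> ('s \<Rightarrow> 'v \<Rightarrow> real) \<Rightarrow>
   ('v \<Rightarrow> ('b, 's, 'v::real_vector) crystal) \<Rightarrow> bool" where
  "highest_weight_normal_family S simple_root coroot B \<longleftrightarrow>
     (\<forall>\<mu>\<in>closed_chamber S coroot.
        is_crystal S simple_root coroot (B \<mu>) \<and> normal_crystal S (B \<mu>) \<and> of_highest_weight S (B \<mu>) \<mu>)"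

text \<open>
  Restricting the structure to a subset only changes the carrier; \<^const>\<open>is_crystal\<close> then demands
  that the subset, with the ghost element, is stable under all operators.
  The highest weight elements \<open>b\<close> and \<open>c\<close> are unique when they exist.

  All crystals of a family share one element type \<open>'b\<close>; only the members indexed by the
  closed chamber matter. The type of paths \<open>real \<Rightarrow> 'v\<close> is large enough for every highest
  weight crystal, since such a crystal is the image of the finite words in \<open>S \<times> {0..}\<close>.
\<close>

definition closed_family ::
  "'s set \<Rightarrow> ('s \<Rightarrow> 'v) \<Rightarrow> ('s \<Rightarrow> 'v \<Rightarrow> real) \<Rightarrow>
   ('v \<Rightarrow> ('b, 's, 'v::real_vector) crystal) \<Rightarrow> bool" where
  "closed_family S simple_root coroot B \<longleftrightarrow>
     (\<forall>\<mu>\<in>closed_chamber S coroot. \<forall>\<nu>\<in>closed_chamber S coroot. \<forall>b c.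
        highest_weight_element S (B \<mu>) \<mu> b \<longrightarrow> highest_weight_element S (B \<nu>) \<nu> c \<longrightarrow>
        (let T = tensor (B \<mu>) (B \<nu>); R = T\<lparr>carrier := f_orbit S T (b, c)\<rparr>
         in is_crystal S simple_root coroot R \<and> crystal_iso S R (B (\<mu> + \<nu>))))"

end

(* Existence: the crystals of paths under Pitman transforms. The Pitman transforms attached to
   the simple roots satisfy the braid relations, also for the string parameters, because the
   dihedral ones fold from type A, where the relation is the tropical Pluecker relation. Hence
   the path obtained by going up the strings along a reduced word of the longest element does not
   change under crystal operators, and the strings on the way together with the weight determine
   all other strings. So crystals generated by dominant paths with the same endpoint are
   isomorphic, and concatenation of paths realizes the tensor product.

   Uniqueness: in a closed family, B(\<lambda>) embeds into B(x\<lambda>) \<otimes> B((1 - x)\<lambda>) for all x in [0, 1]. An element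
   thus has a trace in x, the weights of its left factors. Splitting B(y\<lambda>) further into
   B(x\<lambda>) \<otimes> B((y - x)\<lambda>), where all strings of B((y - x)\<lambda>) have length O(y - x), gives a recursion
   by which the trace determines \<epsilon> and \<phi> of the factors, and with them the trace of every image
   under a crystal operator. So the same words of operators vanish in any two closed families. *)
theory Submission
  imports Defs "HOL-Analysis.Analysis"
begin

text \<open>Three obstacles shape the proof. First, a realization fixes only the numbers
  \<open>coroot s (root t)\<close>: neither independence of the roots nor a topology is given.
  Independence is derived from finiteness of \<open>W\<close> by averaging
  (\<open>cartan_inj\<close>), and continuity of a path is asked only of its pairings with coroots.
  Second, isomorphisms are hard to define directly, so pointed crystals are compared through words
  of operators with exponents of both signs. Sending an element to what the same word reaches is
  well defined because the top weight occurs only once, again by independence of the roots. Third,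
  normality fixes only the ends of a string, so an abstract string might have gaps. Closedness fills
  them: the parameter \<open>\<sigma>\<close> of the tensor rule is continuous in the splitting
  point \<open>x\<close> and takes every value needed. The linear bound on string lengths comes from
  summing the \<open>W\<close>-images of a weight: all coroots vanish on the sum, so its depth
  solves a Cartan system that is linear in the highest weight. Increments of this size enter the
  recursion under a maximum, where errors do not accumulate, so refining the partition removes
  them.\<close>

section \<open>Reduced words\<close>

primrec alt :: "'i \<Rightarrow> 'i \<Rightarrow> nat \<Rightarrow> 'i list" where
  "alt a b 0 = []"
| "alt a b (Suc n) = a # alt b a n"

lemma length_alt [simp]: "length (alt a b n) = n"
  by (induction n arbitrary: a b) auto

lemma set_alt: "set (alt a b n) \<subseteq> {a, b}"
proof (induction n arbitrary: a b)
  case (Suc n)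
  from Suc[of b a] show ?case by auto
qed auto

lemma take_alt: "k \<le> n \<Longrightarrow> take k (alt a b n) = alt a b k"
proof (induction n arbitrary: a b k)
  case (Suc n)
  then show ?case by (cases k) auto
qed auto

text \<open>The exchange argument is needed twice, for permutations and for \<open>W\<close>, so it
  is done over an abstract set of signed roots. \<open>Q\<close> stands for equality of the group
  elements spelled by two words. The geometric inputs are \<open>act_pos\<close> (only the simple
  root changes sign) and \<open>conj_rt\<close> (simple roots mapped to each other have conjugate
  reflections).\<close>

locale root_words =
  fixes I :: "'i set" and Q :: "'i list \<Rightarrow> 'i list \<Rightarrow> bool"
    and \<Phi> :: "'r set" and refl_act :: "'i \<Rightarrow> 'r \<Rightarrow> 'r" and neg :: "'r \<Rightarrow> 'r" and pos :: "'r \<Rightarrow> bool"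
    and rt :: "'i \<Rightarrow> 'r"
  assumes Q_refl: "Q u u"
    and Q_sym: "Q u v \<Longrightarrow> Q v u"
    and Q_trans [trans]: "Q u v \<Longrightarrow> Q v w \<Longrightarrow> Q u w"
    and Q_cong: "set a \<subseteq> I \<Longrightarrow> set b \<subseteq> I \<Longrightarrow> set u \<subseteq> I \<Longrightarrow> set v \<subseteq> I \<Longrightarrow> Q u v \<Longrightarrow> Q (a @ u @ b) (a @ v @ b)"
    and Q_inv: "i \<in> I \<Longrightarrow> Q [i, i] []"
    and act_Q: "set u \<subseteq> I \<Longrightarrow> set v \<subseteq> I \<Longrightarrow> Q u v \<Longrightarrow> x \<in> \<Phi> \<Longrightarrow> foldr refl_act u x = foldr refl_act v x"
    and act_closed: "i \<in> I \<Longrightarrow> x \<in> \<Phi> \<Longrightarrow> refl_act i x \<in> \<Phi>"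
    and rt_closed: "i \<in> I \<Longrightarrow> rt i \<in> \<Phi>"
    and pos_rt: "i \<in> I \<Longrightarrow> pos (rt i)"
    and neg_closed: "x \<in> \<Phi> \<Longrightarrow> neg x \<in> \<Phi>"
    and act_neg: "i \<in> I \<Longrightarrow> x \<in> \<Phi> \<Longrightarrow> refl_act i (neg x) = neg (refl_act i x)"
    and pos_neg: "x \<in> \<Phi> \<Longrightarrow> pos (neg x) \<longleftrightarrow> \<not> pos x"
    and act_rt: "i \<in> I \<Longrightarrow> refl_act i (rt i) = neg (rt i)"
    and act_pos: "i \<in> I \<Longrightarrow> x \<in> \<Phi> \<Longrightarrow> pos x \<Longrightarrow> \<not> pos (refl_act i x) \<Longrightarrow> x = rt i"
    and conj_rt: "set u \<subseteq> I \<Longrightarrow> i \<in> I \<Longrightarrow> j \<in> I \<Longrightarrow> foldr refl_act u (rt i) = rt j \<Longrightarrow> Q (u @ [i]) (j # u)"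
begin

definition red :: "'i list \<Rightarrow> bool" where
  "red u \<longleftrightarrow> set u \<subseteq> I \<and> (\<forall>v. set v \<subseteq> I \<longrightarrow> Q u v \<longrightarrow> length u \<le> length v)"

lemma redI: "set u \<subseteq> I \<Longrightarrow> (\<And>v. set v \<subseteq> I \<Longrightarrow> Q u v \<Longrightarrow> length u \<le> length v) \<Longrightarrow> red u"
  by (auto simp: red_def)

lemma red_lists: "red u \<Longrightarrow> set u \<subseteq> I"
  by (auto simp: red_def)

lemma red_le: "red u \<Longrightarrow> set v \<subseteq> I \<Longrightarrow> Q u v \<Longrightarrow> length u \<le> length v"
  by (auto simp: red_def)

lemma Q_left: "set a \<subseteq> I \<Longrightarrow> set u \<subseteq> I \<Longrightarrow> set v \<subseteq> I \<Longrightarrow> Q u v \<Longrightarrow> Q (a @ u) (a @ v)"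
  using Q_cong[of a "[]" u v] by simp

lemma Q_right: "set b \<subseteq> I \<Longrightarrow> set u \<subseteq> I \<Longrightarrow> set v \<subseteq> I \<Longrightarrow> Q u v \<Longrightarrow> Q (u @ b) (v @ b)"
  using Q_cong[of "[]" b u v] by simp

lemma Q_Cons: "a \<in> I \<Longrightarrow> set u \<subseteq> I \<Longrightarrow> set v \<subseteq> I \<Longrightarrow> Q u v \<Longrightarrow> Q (a # u) (a # v)"
  using Q_left[of "[a]" u v] by simp

lemma Q_cancel2: "i \<in> I \<Longrightarrow> set u \<subseteq> I \<Longrightarrow> Q (i # i # u) u"
  using Q_right[of u "[i, i]" "[]"] Q_inv[of i] by simp

lemma Q_append_rev: "set u \<subseteq> I \<Longrightarrow> Q (u @ rev u) []"
proof (induction u rule: rev_induct)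
  case (snoc i u)
  have "Q (u @ [i, i] @ rev u) (u @ [] @ rev u)"
    using snoc by - (rule Q_cong[OF _ _ _ _ Q_inv], auto)
  also have "Q (u @ [] @ rev u) []" using snoc by auto
  finally show ?case by simp
qed (simp add: Q_refl)

lemma Q_rev_append: "set u \<subseteq> I \<Longrightarrow> Q (rev u @ u) []"
  using Q_append_rev[of "rev u"] by auto

lemma Q_cancel: assumes "a \<in> I" "set u \<subseteq> I" "set v \<subseteq> I" "Q (a # u) (a # v)" shows "Q u v"
proof -
  have "Q u (a # a # u)" using assms Q_cancel2 Q_sym by blast
  also have "Q (a # a # u) (a # a # v)" using assms by - (rule Q_Cons, auto)
  also have "Q (a # a # v) v" using assms Q_cancel2 by blast
  finally show ?thesis .
qed

lemma Q_rev: assumes "set u \<subseteq> I" "set v \<subseteq> I" "Q u v" shows "Q (rev u) (rev v)"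
proof -
  have "Q (rev u) (rev u @ v @ rev v)"
    using Q_left[of "rev u" "[]" "v @ rev v"] assms(1,2) Q_sym[OF Q_append_rev[OF assms(2)]] by auto
  also have "Q (rev u @ v @ rev v) (rev u @ u @ rev v)"
    using assms(1,2) Q_cong[of "rev u" "rev v" v u] Q_sym[OF assms(3)] by auto
  also have "Q (rev u @ u @ rev v) (rev v)"
    using Q_right[of "rev v" "rev u @ u" "[]"] assms Q_rev_append[of u] by auto
  finally show ?thesis .
qed

lemma foldr_act_closed: "set u \<subseteq> I \<Longrightarrow> x \<in> \<Phi> \<Longrightarrow> foldr refl_act u x \<in> \<Phi>"
  by (induction u) (auto intro: act_closed)

lemma foldr_act_neg: "set u \<subseteq> I \<Longrightarrow> x \<in> \<Phi> \<Longrightarrow> foldr refl_act u (neg x) = neg (foldr refl_act u x)"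
  by (induction u) (auto simp: act_neg foldr_act_closed)

text \<open>If the inverse of \<open>u\<close> makes the \<open>i\<close>-th root negative, then some letter \<open>j\<close> of \<open>u\<close> is where
  the sign changes; just before, the root must be the \<open>j\<close>-th simple one.\<close>

lemma neg_exchange:
  assumes u: "set u \<subseteq> I" and i: "i \<in> I" and neg: "\<not> pos (foldr refl_act (rev u) (rt i))"
  shows "\<exists>k<length u. Q (i # u) (take k u @ drop (Suc k) u)"
proof -
  define f where "f k = foldr refl_act (rev (take k u)) (rt i)" for k
  have f0: "pos (f 0)" using pos_rt[OF i] by (simp add: f_def)
  have fl: "\<not> pos (f (length u))" using neg by (simp add: f_def)
  obtain k where k: "k < length u" "pos (f k)" "\<not> pos (f (Suc k))"
  proof -
    define m where "m = (LEAST m. \<not> pos (f m))"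
    have m: "\<not> pos (f m)" unfolding m_def by (rule LeastI[where P = "\<lambda>m. \<not> pos (f m)", OF fl])
    have "m \<le> length u" unfolding m_def using fl by (rule Least_le)
    moreover have "m \<noteq> 0" using m f0 by metis
    moreover have "pos (f (m - 1))"
      using not_less_Least[of "m - 1" "\<lambda>m. \<not> pos (f m)"] \<open>m \<noteq> 0\<close> unfolding m_def[symmetric] by auto
    ultimately show ?thesis using that[of "m - 1"] m by auto
  qed
  define t where "t = take k u"
  define d where "d = drop (Suc k) u"
  define j where "j = u ! k"
  have ue: "u = t @ j # d" unfolding t_def d_def j_def by (rule id_take_nth_drop[OF k(1)])
  have j: "j \<in> I" and t: "set t \<subseteq> I" and d: "set d \<subseteq> I" using u ue by auto
  have tk: "take (Suc k) u = t @ [j]" unfolding t_def j_def by (rule take_Suc_conv_app_nth[OF k(1)])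
  have fS: "f (Suc k) = refl_act j (f k)" by (simp add: f_def tk) (simp add: t_def)
  have "f k \<in> \<Phi>" unfolding f_def using t i by (intro foldr_act_closed rt_closed) (auto simp: t_def)
  then have "f k = rt j" using act_pos[OF j] k fS by auto
  then have "Q (rev t @ [i]) (j # rev t)"
    using conj_rt[of "rev t" i j] t i j by (auto simp: f_def t_def)
  \<comment> \<open>As group elements, \<open>i # t\<close> equals \<open>t @ [j]\<close>, so
    \<open>i # u\<close> becomes t j j d and then t d. Facts 1 to 4 insert and remove the padding
    that brings this out of the conjugation relation.\<close>
  then have 1: "Q (t @ (rev t @ [i]) @ t @ [j] @ d) (t @ (j # rev t) @ t @ [j] @ d)"
    using t i j d by - (rule Q_cong, auto)
  have 2: "Q ([] @ (t @ rev t) @ ([i] @ u)) ([] @ [] @ ([i] @ u))"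
    using t i u by - (rule Q_cong[OF _ _ _ _ Q_append_rev], auto)
  have 3: "Q ((t @ [j]) @ (rev t @ t) @ ([j] @ d)) ((t @ [j]) @ [] @ ([j] @ d))"
    using t j d by - (rule Q_cong[OF _ _ _ _ Q_rev_append], auto)
  have 4: "Q (t @ [j, j] @ d) (t @ [] @ d)"
    using t j d by - (rule Q_cong[OF _ _ _ _ Q_inv], auto)
  have "Q (i # u) (t @ d)"
    using 1 2 3 4 by (simp add: ue) (metis Q_sym Q_trans)
  then show ?thesis using k(1) by (auto simp: t_def d_def)
qed

text \<open>If the root stayed positive under the inverse of \<open>v\<close>, it would turn
  negative under the inverse of \<open>w\<close>, which contains the extra reflection
  \<open>a\<close>. Exchange in \<open>a # w\<close> would then spell \<open>v\<close> with fewer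
  letters than \<open>w\<close>.\<close>

lemma neg_if_shorter:
  assumes v: "red v" and a: "a \<in> I" and w: "set w \<subseteq> I" and Qw: "Q (a # v) w"
    and len: "length w < length v"
  shows "\<not> pos (foldr refl_act (rev v) (rt a))"
proof
  assume p: "pos (foldr refl_act (rev v) (rt a))"
  have vl: "set v \<subseteq> I" using v by (rule red_lists)
  have "Q (rev w) (rev (a # v))" using a w vl by (intro Q_rev Q_sym[OF Qw]) auto
  then have "foldr refl_act (rev w) (rt a) = foldr refl_act (rev (a # v)) (rt a)"
    using a vl w by (intro act_Q) (auto intro: rt_closed)
  also have "\<dots> = neg (foldr refl_act (rev v) (rt a))"
    using a vl by (simp add: act_rt foldr_act_neg rt_closed)
  finally have "\<not> pos (foldr refl_act (rev w) (rt a))"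
    using p pos_neg foldr_act_closed[of "rev v" "rt a"] rt_closed[OF a] vl by auto
  from neg_exchange[OF w a this] obtain k where k: "k < length w"
    and q: "Q (a # w) (take k w @ drop (Suc k) w)" by auto
  have "Q v (a # a # v)" using a vl Q_cancel2 Q_sym by blast
  also have "Q (a # a # v) (a # w)" using a vl w Qw by - (rule Q_Cons, auto)
  also note q
  finally have "length v \<le> length (take k w @ drop (Suc k) w)"
    using w by (intro red_le[OF v]) (auto dest: in_set_takeD in_set_dropD)
  then show False using k len by simp
qed

text \<open>Cancelling \<open>a\<close> shows that \<open>u1\<close>, which is shorter than
  \<open>v\<close>, spells \<open>a # v\<close>; so the root of \<open>a\<close> turns negative and
  \<open>neg_exchange\<close> deletes a letter of \<open>v\<close>.\<close>

lemma exchange: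
  assumes u: "red (a # u1)" and v: "red v" and q: "Q (a # u1) v"
  shows "\<exists>k<length v. Q v (a # take k v @ drop (Suc k) v)"
proof -
  have a: "a \<in> I" and u1: "set u1 \<subseteq> I" and vl: "set v \<subseteq> I" using red_lists[OF u] red_lists[OF v] by auto
  have "length v \<ge> length (a # u1)" using red_le[OF u vl q] .
  moreover have "Q (a # v) u1"
  proof -
    have "Q (a # v) (a # a # u1)" using a u1 vl Q_sym[OF q] by - (rule Q_Cons, auto)
    also have "Q (a # a # u1) u1" using a u1 by (rule Q_cancel2)
    finally show ?thesis .
  qed
  ultimately have "\<not> pos (foldr refl_act (rev v) (rt a))"
    using neg_if_shorter[OF v a u1] by auto
  from neg_exchange[OF vl a this] obtain k where k: "k < length v"
    "Q (a # v) (take k v @ drop (Suc k) v)" by auto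
  have "Q v (a # a # v)" using a vl Q_cancel2 Q_sym by blast
  also have "Q (a # a # v) (a # take k v @ drop (Suc k) v)"
    using a vl k by - (rule Q_Cons, (auto dest: in_set_takeD in_set_dropD))
  finally show ?thesis using k by auto
qed

lemma red_same: "red u \<Longrightarrow> set v \<subseteq> I \<Longrightarrow> Q u v \<Longrightarrow> length v \<le> length u \<Longrightarrow> red v"
  unfolding red_def using Q_trans by (meson order_trans)

lemma red_length_eq: "red u \<Longrightarrow> red v \<Longrightarrow> Q u v \<Longrightarrow> length u = length v"
  by (meson Q_sym le_antisym red_le red_lists)

lemma red_append: assumes "red (u @ v)" shows "red u" "red v"
proof -
  have l: "set u \<subseteq> I" "set v \<subseteq> I" using red_lists[OF assms] by auto
  show "red u"
  proof (rule redI[OF l(1)])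
    fix w assume "set w \<subseteq> I" "Q u w"
    then have "length (u @ v) \<le> length (w @ v)"
      using red_le[OF assms, of "w @ v"] Q_right[of v u w] l by simp
    then show "length u \<le> length w" by simp
  qed
  show "red v"
  proof (rule redI[OF l(2)])
    fix w assume "set w \<subseteq> I" "Q v w"
    then have "length (u @ v) \<le> length (u @ w)"
      using red_le[OF assms, of "u @ w"] Q_left[of u v w] l by simp
    then show "length v \<le> length w" by simp
  qed
qed

lemma red_Cons: "red (a # u) \<Longrightarrow> red u"
  using red_append(2)[of "[a]" u] by simp

lemma Q_cancel_right: assumes "b \<in> I" "set u \<subseteq> I" "set v \<subseteq> I" "Q (u @ [b]) (v @ [b])" shows "Q u v"
proof -
  have "Q (rev (u @ [b])) (rev (v @ [b]))" using assms by (intro Q_rev) auto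
  then have "Q (rev u) (rev v)" using assms Q_cancel[of b "rev u" "rev v"] by auto
  then show ?thesis using Q_rev[of "rev u" "rev v"] assms by auto
qed

text \<open>Induction on the length. If the first letters \<open>s\<close> and \<open>t\<close>
  differ, exchange moves the missing one to the front. Unless the deleted letter is the last one,
  induction joins \<open>u\<close> and \<open>v\<close>; if it is the last one every time, the words
  turn into alternating words in \<open>s\<close> and \<open>t\<close>, where \<open>R_braid\<close>
  applies. \<open>R\<close> is kept abstract because it will be \<open>weq\<close>.\<close>

theorem matsumoto:
  assumes R_refl: "\<And>u. R u u" and R_sym: "\<And>u v. R u v \<Longrightarrow> R v u"
    and R_trans: "\<And>u v w. R u v \<Longrightarrow> R v w \<Longrightarrow> R u w"
    and R_left: "\<And>a u v. a \<in> I \<Longrightarrow> set u \<subseteq> I \<Longrightarrow> set v \<subseteq> I \<Longrightarrow> R u v \<Longrightarrow> R (a # u) (a # v)"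
    and R_right: "\<And>a u v. a \<in> I \<Longrightarrow> set u \<subseteq> I \<Longrightarrow> set v \<subseteq> I \<Longrightarrow> R u v \<Longrightarrow> R (u @ [a]) (v @ [a])"
    and R_braid: "\<And>i j k. i \<in> I \<Longrightarrow> j \<in> I \<Longrightarrow> i \<noteq> j \<Longrightarrow> red (alt i j k) \<Longrightarrow> red (alt j i k) \<Longrightarrow>
        Q (alt i j k) (alt j i k) \<Longrightarrow> R (alt i j k) (alt j i k)"
  shows "red u \<Longrightarrow> red v \<Longrightarrow> Q u v \<Longrightarrow> R u v"
proof (induction "length u" arbitrary: u v)
  case 0
  then have "v = []" using red_length_eq[of u v] by auto
  then show ?case using 0 R_refl by auto
next
  case (Suc n)
  have IH_first: "R (a # x) (a # y)" if "red (a # x)" "red (a # y)" "Q (a # x) (a # y)" "length x = n" for a x y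
  proof -
    have l: "a \<in> I" "set x \<subseteq> I" "set y \<subseteq> I" using red_lists[OF that(1)] red_lists[OF that(2)] by auto
    have "R x y" using that l by (intro Suc.hyps(1)) (auto intro: red_Cons Q_cancel)
    then show ?thesis using l R_left by blast
  qed
  have IH_last: "R (x @ [b]) (y @ [b])" if "red (x @ [b])" "red (y @ [b])" "Q (x @ [b]) (y @ [b])" "length x = n" for b x y
  proof -
    have l: "b \<in> I" "set x \<subseteq> I" "set y \<subseteq> I" using red_lists[OF that(1)] red_lists[OF that(2)] by auto
    have "R x y" using that(4) l red_append(1)[OF that(1)] red_append(1)[OF that(2)] Q_cancel_right[OF l that(3)]
      by (intro Suc.hyps(1)) auto
    then show ?thesis using l R_right by blast
  qed
  obtain s u1 where us: "u = s # u1" using Suc by (cases u) auto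
  have lv: "length v = Suc n" using Suc red_length_eq[of u v] by auto
  obtain t v1 where vt: "v = t # v1" using lv by (cases v) auto
  have sI: "s \<in> I" and tI: "t \<in> I" using red_lists[OF Suc.prems(1)] red_lists[OF Suc.prems(2)] us vt by auto
  show ?case
  proof (cases "s = t")
    case True
    then show ?thesis using IH_first[of s u1 v1] Suc.prems Suc.hyps(2) unfolding us vt by simp
  next
    case False
    \<comment> \<open>The words \<open>u\<close> and \<open>v\<close> indexed by their first
      letters, so that consecutive rounds of exchange are symmetric.\<close>
    define W where "W a = (if a = s then u else v)" for a
    have Ws: "W s = u" and Wt: "W t = v" using False by (auto simp: W_def)
    have step: "R u v \<or> (R x' (W b) \<and> red x' \<and> Q u x' \<and> x' = b # butlast x)"
      if ab: "{a, b} = {s, t}" and x: "red x" "Q u x" "R x (W a)" and x': "x' = b # butlast x" for a b x x'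
    proof -
      have bI: "b \<in> I" using ab sI tI by auto
      have lx: "length x = Suc n" using red_length_eq[OF Suc.prems(1) x(1,2)] Suc.hyps(2) by simp
      have Wb: "\<exists>z. W b = b # z" "red (W b)" "Q u (W b)"
        using ab False Suc.prems us vt by (auto simp: W_def doubleton_eq_iff Q_refl)
      then obtain z where z: "W b = b # z" by auto
      have Qbx: "Q (b # z) x" using Wb z x Q_sym Q_trans by metis
      from exchange[OF Wb(2)[unfolded z] x(1) Qbx] obtain k where k: "k < length x"
        "Q x (b # take k x @ drop (Suc k) x)" by auto
      define y where "y = b # take k x @ drop (Suc k) x"
      have yl: "set y \<subseteq> I" using red_lists[OF x(1)] bI by (auto simp: y_def dest: in_set_takeD in_set_dropD)
      have ly: "length y = Suc n" using k lx by (simp add: y_def)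
      have Qxy: "Q x y" using k by (simp add: y_def)
      have ry: "red y" using red_same[OF x(1) yl Qxy] ly lx by simp
      have Qby: "Q (W b) y" using Qbx Qxy z Q_trans by metis
      have "R (W b) y"
        unfolding z y_def
      proof (rule IH_first)
        show "red (b # z)" using Wb z by simp
        show "red (b # take k x @ drop (Suc k) x)" using ry by (simp add: y_def)
        show "Q (b # z) (b # take k x @ drop (Suc k) x)" using Qby z by (simp add: y_def)
        show "length z = n" using red_length_eq[OF Suc.prems(1) Wb(2,3)] Suc.hyps(2) z by simp
      qed
      then have Rby: "R y (W b)" by (rule R_sym)
      show ?thesis
      proof (cases "k = n")
        case True
        then have "y = x'" using lx x' by (simp add: y_def butlast_conv_take)
        then show ?thesis using Rby ry Qxy x Q_trans x' by blast
      next
        case False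
        \<comment> \<open>The new word shares its last letter with \<open>x\<close> and its first
          letter with \<open>W b\<close>, so two uses of the induction hypothesis link
          \<open>W a\<close> to \<open>W b\<close>.\<close>
        then have kn: "k < n" using k lx by simp
        obtain x0 c where xc: "x = x0 @ [c]" using lx by (cases x rule: rev_cases) auto
        define y0 where "y0 = b # take k x0 @ drop (Suc k) x0"
        have yc: "y = y0 @ [c]" using kn lx xc by (simp add: y_def y0_def)
        have "R x y" unfolding xc yc
          using x(1) ry Qxy lx unfolding xc yc by (intro IH_last) auto
        then have "R (W a) (W b)" using Rby x(3) R_sym R_trans by blast
        then have "R u v" using ab Ws Wt R_sym by (auto simp: doubleton_eq_iff)
        then show ?thesis ..
      qed
    qed
    \<comment> \<open>Each round prolongs the alternating prefix by one letter, until the whole word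
      alternates.\<close>
    have inv: "R u v \<or> (\<exists>a b x. {a, b} = {s, t} \<and> red x \<and> Q u x \<and> R x (W a) \<and> take (Suc j) x = alt a b (Suc j))"
      if "j \<le> n" for j
      using that
    proof (induction j)
      case 0
      have "take 1 u = alt s t 1" using us by simp
      then show ?case using Suc.prems(1) R_refl Ws Q_refl
        by (intro disjI2 exI[of _ s] exI[of _ t] exI[of _ u]) auto
    next
      case (Suc j)
      then consider "R u v" | a b x where "{a, b} = {s, t}" "red x" "Q u x" "R x (W a)" "take (Suc j) x = alt a b (Suc j)"
        by auto
      then show ?case
      proof cases
        case 2
        have lx: "length x = Suc n" using red_length_eq[OF \<open>red u\<close> 2(2,3)] \<open>Suc n = length u\<close> by simp
        have "take (Suc (Suc j)) (b # butlast x) = b # take (Suc j) x"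
          using Suc.prems lx by (simp add: butlast_conv_take min_def)
        also have "\<dots> = alt b a (Suc (Suc j))" using 2 by simp
        finally have tk: "take (Suc (Suc j)) (b # butlast x) = alt b a (Suc (Suc j))" .
        from step[OF 2(1-4) HOL.refl] have "R u v \<or> (R (b # butlast x) (W b) \<and> red (b # butlast x) \<and> Q u (b # butlast x))"
          by blast
        then show ?thesis
        proof
          assume "R (b # butlast x) (W b) \<and> red (b # butlast x) \<and> Q u (b # butlast x)"
          moreover have "{b, a} = {s, t}" using 2(1) by auto
          ultimately show ?thesis using tk by blast
        qed blast
      qed blast
    qed
    from inv[of n] consider "R u v" | a b x where "{a, b} = {s, t}" "red x" "Q u x" "R x (W a)" "take (Suc n) x = alt a b (Suc n)"
        by auto
    then show ?thesis
    proof cases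
      case 2
      have lx: "length x = Suc n" using red_length_eq[OF \<open>red u\<close> 2(2,3)] \<open>Suc n = length u\<close> by simp
      then have x: "x = alt a b (Suc n)" using 2(5) by simp
      have "butlast x = alt a b n" unfolding x using take_alt[of n "Suc n" a b]
        by (simp add: butlast_conv_take del: alt.simps)
      then have x': "b # butlast x = alt b a (Suc n)" by simp
      from step[OF 2(1-4) HOL.refl] have "R u v \<or> (R (alt b a (Suc n)) (W b) \<and> red (alt b a (Suc n)) \<and> Q u (alt b a (Suc n)))"
        unfolding x' by blast
      then show ?thesis
      proof
        assume h: "R (alt b a (Suc n)) (W b) \<and> red (alt b a (Suc n)) \<and> Q u (alt b a (Suc n))"
        have "a \<in> I" "b \<in> I" "a \<noteq> b" using 2(1) sI tI False by (auto simp: doubleton_eq_iff)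
        then have "R (alt a b (Suc n)) (alt b a (Suc n))"
          using h 2(2,3) unfolding x by (intro R_braid) (metis Q_sym Q_trans)+
        then have "R (W a) (W b)" using h 2(4) x R_sym R_trans by metis
        then show "R u v" using 2(1) Ws Wt R_sym by (auto simp: doubleton_eq_iff)
      qed
    qed
  qed
qed

text \<open>A further letter \<open>i\<close> can make only one more root negative, the one that
  \<open>u\<close> maps to \<open>rt i\<close>. For permutations this bounds the length of a word
  from below by the number of inversions.\<close>

lemma card_inversions_le:
  assumes "set u \<subseteq> I"
  shows "finite {x \<in> \<Phi>. pos x \<and> \<not> pos (foldr refl_act u x)} \<and>
    card {x \<in> \<Phi>. pos x \<and> \<not> pos (foldr refl_act u x)} \<le> length u"
  using assms
proof (induction u)
  case Nil
  have "{x \<in> \<Phi>. pos x \<and> \<not> pos (foldr refl_act [] x)} = {}" by auto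
  then show ?case by (metis card.empty finite.emptyI zero_le)
next
  case (Cons i u)
  let ?N = "{x \<in> \<Phi>. pos x \<and> \<not> pos (foldr refl_act u x)}"
  have i: "i \<in> I" and u: "set u \<subseteq> I" using Cons.prems by auto
  have "x = foldr refl_act (rev u) (rt i)" if "x \<in> \<Phi>" "pos (foldr refl_act u x)" "\<not> pos (refl_act i (foldr refl_act u x))" for x
  proof -
    have "foldr refl_act u x = rt i" using that i u by (intro act_pos foldr_act_closed) auto
    then have "foldr refl_act (rev u) (rt i) = foldr refl_act (rev u @ u) x" by simp
    also have "\<dots> = foldr refl_act [] x" using u that Q_rev_append[OF u] by (intro act_Q) auto
    finally show ?thesis by simp
  qed
  then have sub: "{x \<in> \<Phi>. pos x \<and> \<not> pos (foldr refl_act (i # u) x)} \<subseteq> insert (foldr refl_act (rev u) (rt i)) ?N"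
    by auto
  have fin: "finite ?N" "card ?N \<le> length u" using Cons.IH[OF u] by auto
  have "card {x \<in> \<Phi>. pos x \<and> \<not> pos (foldr refl_act (i # u) x)} \<le> card (insert (foldr refl_act (rev u) (rt i)) ?N)"
    using sub fin by (intro card_mono) auto
  also have "\<dots> \<le> Suc (card ?N)" using fin by (simp add: card_insert_if)
  finally have "card {x \<in> \<Phi>. pos x \<and> \<not> pos (foldr refl_act (i # u) x)} \<le> length (i # u)" using fin by simp
  moreover have "finite {x \<in> \<Phi>. pos x \<and> \<not> pos (foldr refl_act (i # u) x)}"
    by (rule finite_subset[OF sub]) (use fin in simp)
  ultimately show ?case by blast
qed

text \<open>The root of \<open>i\<close> must turn negative under the inverse of \<open>u\<close>,
  and then exchange applies: if it stayed positive, \<open>i # u\<close> would be reduced.\<close>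

lemma longest_first:
  assumes u: "red u" and i: "i \<in> I" and max: "\<not> red (i # u)"
  shows "\<exists>v. red (i # v) \<and> Q u (i # v)"
proof -
  have ul: "set u \<subseteq> I" using u by (rule red_lists)
  have "\<not> pos (foldr refl_act (rev u) (rt i))"
  proof
    assume p: "pos (foldr refl_act (rev u) (rt i))"
    have "red (i # u)"
    proof (rule redI)
      show "set (i # u) \<subseteq> I" using i ul by auto
      fix v assume v: "set v \<subseteq> I" "Q (i # u) v"
      have "length u \<le> length v"
        using neg_if_shorter[OF u i v(1,2)] p by force
      \<comment> \<open>A word for \<open>i # u\<close> of the same length as \<open>u\<close> would
        make the root of \<open>i\<close> negative, and exchange in it would shorten
        \<open>u\<close>.\<close>
      moreover have "length v \<noteq> length u"
      proof
        assume l: "length v = length u"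
        have "Q (rev v) (rev (i # u))" using v i ul by (intro Q_rev Q_sym[OF v(2)]) auto
        then have "foldr refl_act (rev v) (rt i) = foldr refl_act (rev (i # u)) (rt i)"
          using i ul v by (intro act_Q) (auto intro: rt_closed)
        also have "\<dots> = neg (foldr refl_act (rev u) (rt i))"
          using i ul by (simp add: act_rt foldr_act_neg rt_closed)
        finally have "\<not> pos (foldr refl_act (rev v) (rt i))"
          using p pos_neg foldr_act_closed[of "rev u" "rt i"] rt_closed[OF i] ul by auto
        from neg_exchange[OF v(1) i this] obtain k where k: "k < length v"
          and q: "Q (i # v) (take k v @ drop (Suc k) v)" by auto
        have "Q u (i # i # u)" using i ul Q_cancel2 Q_sym by blast
        also have "Q (i # i # u) (i # v)" using i ul v by - (rule Q_Cons, auto)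
        also note q
        finally have "length u \<le> length (take k v @ drop (Suc k) v)"
          using v by (intro red_le[OF u]) (auto dest: in_set_takeD in_set_dropD)
        then show False using k l by simp
      qed
      ultimately show "length (i # u) \<le> length v" by simp
    qed
    then show False using max by blast
  qed
  from neg_exchange[OF ul i this] obtain k where k: "k < length u"
    and q: "Q (i # u) (take k u @ drop (Suc k) u)" by auto
  define w where "w = take k u @ drop (Suc k) u"
  have wl: "set w \<subseteq> I" using ul by (auto simp: w_def dest: in_set_takeD in_set_dropD)
  have "Q u (i # i # u)" using i ul Q_cancel2 Q_sym by blast
  also have "Q (i # i # u) (i # w)" using i ul wl q by - (rule Q_Cons, (auto simp: w_def))
  finally have qq: "Q u (i # w)" .
  have "red (i # w)" using k wl i by (intro red_same[OF u _ qq]) (auto simp: w_def)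
  then show ?thesis using qq by blast
qed

end

section \<open>Running suprema of real paths and the braid relation of type A2\<close>

section \<open>Pitman transforms\<close>

text \<open>Paths live on [0, 1] but are extended by constants to all real times. Suprema over
  \<open>{..t}\<close> are then never empty, and time can be shifted and reversed without leaving
  the domain.\<close>

definition cpath :: "(real \<Rightarrow> real) \<Rightarrow> bool" where
  "cpath g \<longleftrightarrow> continuous_on UNIV g \<and> (\<forall>t\<le>0. g t = 0) \<and> (\<forall>t\<ge>1. g t = g 1)"

text \<open>Minus the running infimum, so that \<open>\<lambda>t. g t + 2 * run g t\<close> is the
  one-dimensional Pitman transform.\<close>

definition run :: "(real \<Rightarrow> real) \<Rightarrow> real \<Rightarrow> real" where
  "run g t = (SUP s\<in>{..t}. - g s)"

lemma cpath_0 [simp]: "cpath g \<Longrightarrow> t \<le> 0 \<Longrightarrow> g t = 0"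
  and cpath_1: "cpath g \<Longrightarrow> t \<ge> 1 \<Longrightarrow> g t = g 1"
  and cpath_cont: "cpath g \<Longrightarrow> continuous_on A g"
  unfolding cpath_def by (blast intro: continuous_on_subset)+

lemma cpath_add: "cpath f \<Longrightarrow> cpath g \<Longrightarrow> cpath (\<lambda>t. f t + g t)"
  and cpath_diff: "cpath f \<Longrightarrow> cpath g \<Longrightarrow> cpath (\<lambda>t. f t - g t)"
  and cpath_mult: "cpath f \<Longrightarrow> cpath (\<lambda>t. c * f t)"
  unfolding cpath_def by (intro conjI continuous_intros; metis add_0 diff_0_right mult_zero_right)+

lemma cpath_bounded:
  assumes "cpath g" shows "\<exists>K. \<forall>t. \<bar>g t\<bar> \<le> K"
proof -
  have "bounded (g ` {0..1})"
    by (intro compact_imp_bounded compact_continuous_image cpath_cont assms) auto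
  then obtain K where K: "\<And>t. t \<in> {0..1} \<Longrightarrow> \<bar>g t\<bar> \<le> K"
    unfolding bounded_iff by (metis image_eqI real_norm_def)
  have "\<bar>g t\<bar> \<le> K" for t
  proof -
    consider "t \<le> 0" | "t \<in> {0..1}" | "t \<ge> 1" by fastforce
    then show ?thesis
      using K[of 0] K[of 1] K[of t] cpath_0[OF assms, of t] cpath_0[OF assms, of 0] cpath_1[OF assms, of t]
      by cases auto
  qed
  then show ?thesis by blast
qed

context
  fixes g assumes g: "cpath g"
begin

lemma run_bdd: "bdd_above ((\<lambda>s. - g s) ` {..t})"
proof -
  obtain K where "\<And>t. \<bar>g t\<bar> \<le> K" using cpath_bounded[OF g] by auto
  then have "- g s \<le> K" for s by (metis abs_le_D2)
  then show ?thesis by (auto intro!: bdd_aboveI)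
qed

lemma run_ge: "s \<le> t \<Longrightarrow> - g s \<le> run g t"
  unfolding run_def by (rule cSUP_upper[OF _ run_bdd]) auto

lemma run_le: "(\<And>s. s \<le> t \<Longrightarrow> - g s \<le> c) \<Longrightarrow> run g t \<le> c"
  unfolding run_def by (rule cSUP_least) auto

lemma run_attained: "\<exists>s\<le>t. run g t = - g s"
proof (cases "t \<le> 0")
  case True
  then have "run g t \<le> - g t" using g by (intro run_le) auto
  then show ?thesis using run_ge[of t t] by force
next
  case False
  then obtain s where s: "s \<in> {0..t}" "\<And>u. u \<in> {0..t} \<Longrightarrow> g s \<le> g u"
    using continuous_attains_inf[of "{0..t}" g] cpath_cont[OF g] by auto
  have "g s \<le> g u" if "u \<le> t" for u
  proof (cases "u \<ge> 0")
    case True then show ?thesis using s that by auto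
  next
    case neg: False
    have "g s \<le> g 0" using s(2)[of 0] False by auto
    then show ?thesis using g neg by auto
  qed
  then have "run g t \<le> - g s" by (intro run_le) auto
  then show ?thesis using run_ge[of s t] s(1) by force
qed

lemma run_mono: "s \<le> t \<Longrightarrow> run g s \<le> run g t"
  by (rule run_le) (auto intro: run_ge)

lemma run_nonneg: "0 \<le> run g t"
  using run_ge[of "min t 0" t] g by auto

lemma run_0: "t \<le> 0 \<Longrightarrow> run g t = 0"
  using run_attained[of t] g by auto

lemma run_1: assumes "t \<ge> 1" shows "run g t = run g 1"
proof (rule antisym)
  show "run g t \<le> run g 1"
  proof (rule run_le)
    fix s assume "s \<le> t"
    show "- g s \<le> run g 1"
      using run_ge[of s 1] run_ge[of 1 1] cpath_1[OF g, of s] by (cases "s \<le> 1") auto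
  qed
qed (use assms run_mono in auto)

lemma run_continuous: "continuous_on UNIV (run g)"
proof (rule iffD2[OF continuous_on_eq_continuous_at[OF open_UNIV]], rule ballI)
  fix t :: real
  show "isCont (run g) t"
    unfolding continuous_at_eps_delta
  proof (intro allI impI)
    fix e :: real assume e: "e > 0"
    have "isCont g t" using cpath_cont[OF g, of UNIV] by (simp add: continuous_on_eq_continuous_at)
    then obtain d where d: "d > 0" "\<And>s. \<bar>s - t\<bar> < d \<Longrightarrow> \<bar>g s - g t\<bar> < e / 3"
      using e unfolding continuous_at_eps_delta dist_real_def by (metis divide_pos_pos zero_less_numeral)
    have "\<bar>run g s - run g t\<bar> < e" if s: "\<bar>s - t\<bar> < d" for s
    proof (cases "s \<le> t")
      case True
      have "run g t \<le> run g s + 2 * e / 3"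
      proof (rule run_le)
        fix u assume u: "u \<le> t"
        show "- g u \<le> run g s + 2 * e / 3"
        proof (cases "u \<le> s")
          case True then show ?thesis using run_ge[of u s] e by simp
        next
          case False
          then have "\<bar>g u - g t\<bar> < e / 3" "\<bar>g s - g t\<bar> < e / 3" using d(2) u s True by auto
          then show ?thesis using run_ge[of s s] by linarith
        qed
      qed
      then show ?thesis using run_mono[OF True] e by linarith
    next
      case False
      have "run g s \<le> run g t + e / 3"
      proof (rule run_le)
        fix u assume u: "u \<le> s"
        show "- g u \<le> run g t + e / 3"
        proof (cases "u \<le> t")
          case True then show ?thesis using run_ge[of u t] e by simp
        next
          case f: False
          then have "\<bar>g u - g t\<bar> < e / 3" using d(2) u s False by auto
          then show ?thesis using run_ge[of t t] by linarith
        qed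
      qed
      then show ?thesis using run_mono[of t s] False e by linarith
    qed
    then show "\<exists>d>0. \<forall>s. dist s t < d \<longrightarrow> dist (run g s) (run g t) < e"
      using d(1) by (auto simp: dist_real_def)
  qed
qed

lemma cpath_run: "cpath (run g)"
  unfolding cpath_def using run_continuous run_0 run_1 by blast

end

lemma run_scale:
  assumes g: "cpath g" and c: "c \<ge> 0" shows "run (\<lambda>t. c * g t) t = c * run g t"
proof (rule antisym)
  have cg: "cpath (\<lambda>t. c * g t)" using g by (rule cpath_mult)
  show "run (\<lambda>t. c * g t) t \<le> c * run g t"
  proof (rule run_le[OF cg])
    fix s assume "s \<le> t"
    then show "- (c * g s) \<le> c * run g t" using mult_left_mono[OF run_ge[OF g, of s t] c] by simp
  qed
  obtain s where "s \<le> t" "run g t = - g s" using run_attained[OF g] by blast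
  then show "c * run g t \<le> run (\<lambda>t. c * g t) t" using run_ge[OF cg, of s t] by simp
qed

text \<open>The tropical Pluecker relation: two independent suprema over \<open>s, u\<close> split according to
  which of \<open>s, u\<close> comes first.\<close>

lemma run_add_run:
  assumes a: "cpath a" and b: "cpath b"
  shows "run a t + run b t = max (run (\<lambda>s. a s - run b s) t) (run (\<lambda>s. b s - run a s) t)"
proof (rule antisym)
  have ab: "cpath (\<lambda>s. a s - run b s)" and ba: "cpath (\<lambda>s. b s - run a s)"
    using a b by (auto intro!: cpath_diff cpath_run)
  obtain s where s: "s \<le> t" "run a t = - a s" using run_attained[OF a] by blast
  obtain u where u: "u \<le> t" "run b t = - b u" using run_attained[OF b] by blast
  show "run a t + run b t \<le> max (run (\<lambda>s. a s - run b s) t) (run (\<lambda>s. b s - run a s) t)"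
  proof (cases "u \<le> s")
    case True
    then show ?thesis using run_ge[OF ab s(1)] run_ge[OF b, of u s] s u by simp
  next
    case False
    then show ?thesis using run_ge[OF ba u(1)] run_ge[OF a, of s u] s u by simp
  qed
  have "run (\<lambda>s. a s - run b s) t \<le> run a t + run b t"
  proof (rule run_le[OF ab])
    fix s assume s: "s \<le> t"
    show "- (a s - run b s) \<le> run a t + run b t" using run_ge[OF a s] run_mono[OF b s] by simp
  qed
  moreover have "run (\<lambda>s. b s - run a s) t \<le> run a t + run b t"
  proof (rule run_le[OF ba])
    fix s assume s: "s \<le> t"
    show "- (b s - run a s) \<le> run a t + run b t" using run_ge[OF b s] run_mono[OF a s] by simp
  qed
  ultimately show "max (run (\<lambda>s. a s - run b s) t) (run (\<lambda>s. b s - run a s) t) \<le> run a t + run b t"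
    by simp
qed

text \<open>The third string along a braid word of type A2: the running supremum of the twice
  transformed path is \<open>D\<close>, the difference of \<open>A2\<close> and \<open>A1\<close>.
  One inequality is pointwise from \<open>run_add_run\<close>, once \<open>D\<close> is known to be
  nondecreasing; the other is attained at the first time at which \<open>D\<close> reaches its
  present value.\<close>

lemma run_braid:
  assumes a: "cpath a" and b: "cpath b"
  shows "run a t + run (\<lambda>s. a s + 2 * run a s - run (\<lambda>s. b s - run a s) s) t = run (\<lambda>s. a s - run b s) t"
proof -
  define A1 B1 A2 B2 where "A1 = run a" and "B1 = run b" and "A2 = run (\<lambda>s. a s - run b s)"
    and "B2 = run (\<lambda>s. b s - run a s)"
  define D where "D s = A2 s - A1 s" for s
  have cA1: "cpath A1" and cB1: "cpath B1" using a b by (auto simp: A1_def B1_def intro: cpath_run)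
  have ab: "cpath (\<lambda>s. a s - B1 s)" and ba: "cpath (\<lambda>s. b s - A1 s)"
    using a b cA1 cB1 by (auto intro!: cpath_diff)
  have A2: "A2 = run (\<lambda>s. a s - B1 s)" and B2: "B2 = run (\<lambda>s. b s - A1 s)"
    by (auto simp: A2_def B2_def A1_def B1_def)
  have cA2: "cpath A2" and cB2: "cpath B2" using ab ba by (auto simp: A2 B2 intro: cpath_run)
  have cD: "cpath D" unfolding D_def using cA1 cA2 by (rule cpath_diff[rotated])
  have cX: "cpath (\<lambda>s. a s + 2 * A1 s - B2 s)"
    using a cA1 cB2 by (intro cpath_diff cpath_add cpath_mult)
  have max: "A1 s + B1 s = max (A2 s) (B2 s)" for s
    unfolding A1_def B1_def A2_def B2_def by (rule run_add_run[OF a b])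
  \<comment> \<open>Either \<open>A1\<close> has not grown since \<open>s\<close>, or it is attained
    at a later \<open>u\<close>; then \<open>D t\<close> is at least \<open>B1 s\<close>, which
    bounds \<open>D s\<close> by the Pluecker relation.\<close>
  have mono: "D s \<le> D t" if st: "s \<le> t" for s t
  proof -
    obtain u where u: "u \<le> t" "A1 t = - a u" using run_attained[OF a, of t] by (auto simp: A1_def)
    show ?thesis
    proof (cases "u \<le> s")
      case True
      then have "A1 t \<le> A1 s" using run_ge[OF a True] u by (simp add: A1_def)
      moreover have "A2 s \<le> A2 t" unfolding A2 by (rule run_mono[OF ab st])
      ultimately show ?thesis by (simp add: D_def)
    next
      case False
      have "- (a u - B1 u) \<le> A2 t" unfolding A2 by (rule run_ge[OF ab u(1)])
      moreover have "B1 s \<le> B1 u" unfolding B1_def using False by (intro run_mono[OF b]) auto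
      ultimately show ?thesis using max[of s] u by (simp add: D_def)
    qed
  qed
  have "run (\<lambda>s. a s + 2 * A1 s - B2 s) t = D t"
  proof (rule antisym)
    show "run (\<lambda>s. a s + 2 * A1 s - B2 s) t \<le> D t"
    proof (rule run_le[OF cX])
      fix s assume "s \<le> t"
      have "- (a s - B1 s) \<le> A2 s" unfolding A2 by (rule run_ge[OF ab]) simp
      then show "- (a s + 2 * A1 s - B2 s) \<le> D t"
        using max[of s] mono[OF \<open>s \<le> t\<close>] by (simp add: D_def)
    qed
    show "D t \<le> run (\<lambda>s. a s + 2 * A1 s - B2 s) t"
    proof (cases "D t \<le> 0")
      case True
      then show ?thesis using run_nonneg[OF cX] by (rule order_trans)
    next
      case False
      then have t0: "t > 0" using cpath_0[OF cD, of t] by force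
      have "compact {s \<in> {0..t}. D s = D t}"
      proof -
        have "closed {s. s \<in> {0..t} \<and> D s = D t}"
          using cpath_cont[OF cD] by (intro continuous_closed_preimage_constant) auto
        with compact_Icc have "compact ({0..t} \<inter> {s. s \<in> {0..t} \<and> D s = D t})"
          by (rule compact_Int_closed)
        moreover have "{0..t} \<inter> {s. s \<in> {0..t} \<and> D s = D t} = {s \<in> {0..t}. D s = D t}" by auto
        ultimately show ?thesis by simp
      qed
      \<comment> \<open>The first time at which \<open>D\<close> takes its value at
        \<open>t\<close>. Since \<open>D\<close> is strictly smaller before, the supremum
        \<open>A2 s\<close> can only be attained at \<open>s\<close> itself.\<close>
      then obtain s where s: "s \<in> {0..t}" "D s = D t" "\<And>u. u \<in> {0..t} \<Longrightarrow> D u = D t \<Longrightarrow> s \<le> u"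
      proof -
        have "{s \<in> {0..t}. D s = D t} \<noteq> {}" using t0 by auto
        from compact_attains_inf[OF \<open>compact {s \<in> {0..t}. D s = D t}\<close> this]
        obtain s where "s \<in> {s \<in> {0..t}. D s = D t}" "\<forall>u\<in>{s \<in> {0..t}. D s = D t}. s \<le> u" by blast
        then show ?thesis by (intro that[of s]) auto
      qed
      have less: "D u < D s" if "u < s" for u
      proof (cases "u \<ge> 0")
        case True
        then show ?thesis using s(1,2) s(3)[of u] mono[of u s] that by force
      next
        case neg: False
        then show ?thesis using False s(2) cpath_0[OF cD, of u] by auto
      qed
      have i: "A2 s = - (a s - B1 s)"
      proof -
        obtain u where u: "u \<le> s" "A2 s = - (a u - B1 u)" using run_attained[OF ab, of s] by (auto simp: A2)
        show ?thesis
        proof (cases "u = s")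
          case False
          have "A2 s \<le> A2 u" unfolding A2 using u(2) run_ge[OF ab, of u u] by (simp add: A2)
          moreover have "A1 u \<le> A1 s" unfolding A1_def by (rule run_mono[OF a u(1)])
          ultimately show ?thesis using less[of u] u False by (simp add: D_def)
        qed (use u in simp)
      qed
      \<comment> \<open>If \<open>B2\<close> were smaller, the maximum would be \<open>A2\<close> on
        a neighbourhood, that is, \<open>D = B1\<close> there. As \<open>D\<close> is strictly
        smaller before \<open>s\<close>, the supremum \<open>B1 s\<close> is attained at
        \<open>s\<close> itself, and this forces the missing bound on \<open>B2 s\<close>.\<close>
      have ii: "B2 s = A1 s + B1 s"
      proof (rule ccontr)
        assume ne: "B2 s \<noteq> A1 s + B1 s"
        define h where "h u = A1 u + B1 u - B2 u" for u
        have hs: "h s > 0" using ne max[of s] by (simp add: h_def)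
        have "cpath h" unfolding h_def using cA1 cB1 cB2 by (intro cpath_add cpath_diff)
        then have "isCont h s" using cpath_cont[of h UNIV] by (simp add: continuous_on_eq_continuous_at)
        then obtain d where d: "d > 0" "\<And>u. \<bar>u - s\<bar> < d \<Longrightarrow> \<bar>h u - h s\<bar> < h s"
          using hs unfolding continuous_at_eps_delta dist_real_def by metis
        have DB: "D u = B1 u" if "\<bar>u - s\<bar> < d" for u
          using d(2)[OF that] max[of u] by (auto simp: h_def D_def)
        obtain u where u: "u \<le> s" "B1 s = - b u" using run_attained[OF b, of s] by (auto simp: B1_def)
        show False
        proof (cases "u = s")
          case True
          have "- (b s - A1 s) \<le> B2 s" unfolding B2 by (rule run_ge[OF ba]) simp
          then show False using hs u True by (simp add: h_def)
        next
          case False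
          define v where "v = max u (s - d / 2)"
          have v: "u \<le> v" "v < s" "\<bar>v - s\<bar> < d" using False u d(1) by (auto simp: v_def max_def)
          have "B1 s \<le> B1 v" using run_ge[OF b v(1)] u by (simp add: B1_def)
          then show False using less[OF v(2)] DB[OF v(3)] DB[of s] d(1) by simp
        qed
      qed
      have "- (a s + 2 * A1 s - B2 s) = D s" using i ii by (simp add: D_def)
      then show ?thesis using run_ge[OF cX, of s t] s by simp
    qed
  qed
  then show ?thesis by (simp add: D_def A1_def A2_def B2_def)
qed

section \<open>Words of Pitman transforms\<close>

definition pitman :: "('i \<Rightarrow> 'i \<Rightarrow> real) \<Rightarrow> 'i \<Rightarrow> ('i \<Rightarrow> real \<Rightarrow> real) \<Rightarrow> 'i \<Rightarrow> real \<Rightarrow> real" where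
  "pitman A i z = (\<lambda>j t. z j t + A j i * run (z i) t)"

primrec strings :: "('i \<Rightarrow> 'i \<Rightarrow> real) \<Rightarrow> 'i list \<Rightarrow> ('i \<Rightarrow> real \<Rightarrow> real) \<Rightarrow> real list" where
  "strings A [] z = []"
| "strings A (i # u) z = run (z i) 1 # strings A u (pitman A i z)"

text \<open>The multiple of each root that the word adds to a path, as a function of time. The path
  in the vector space is recovered from these, whereas the coordinates \<open>z\<close> only see its
  pairings with coroots.\<close>

primrec gains :: "('i \<Rightarrow> 'i \<Rightarrow> real) \<Rightarrow> 'i list \<Rightarrow> ('i \<Rightarrow> real \<Rightarrow> real) \<Rightarrow> 'i \<Rightarrow> real \<Rightarrow> real" where
  "gains A [] z = (\<lambda>j t. 0)"
| "gains A (i # u) z = (\<lambda>j t. (if j = i then run (z i) t else 0) + gains A u (pitman A i z) j t)"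

definition cpaths :: "'i set \<Rightarrow> ('i \<Rightarrow> real \<Rightarrow> real) set" where
  "cpaths I = {z. \<forall>i\<in>I. cpath (z i)}"

text \<open>The second condition says that the strings along the two words are functions of each other.\<close>

definition weq :: "('i \<Rightarrow> 'i \<Rightarrow> real) \<Rightarrow> 'i set \<Rightarrow> 'i list \<Rightarrow> 'i list \<Rightarrow> bool" where
  "weq A I u v \<longleftrightarrow> (\<forall>z\<in>cpaths I. gains A u z = gains A v z) \<and>
     (\<forall>z\<in>cpaths I. \<forall>z'\<in>cpaths I. strings A u z = strings A u z' \<longleftrightarrow> strings A v z = strings A v z')"

lemma pitman_cpaths: "z \<in> cpaths I \<Longrightarrow> i \<in> I \<Longrightarrow> pitman A i z \<in> cpaths I"
  by (auto simp: cpaths_def pitman_def intro!: cpath_add cpath_mult cpath_run)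

lemma length_strings [simp]: "length (strings A u z) = length u"
  by (induction u arbitrary: z) auto

lemma strings_append: "strings A (u @ v) z = strings A u z @ strings A v (fold (pitman A) u z)"
  by (induction u arbitrary: z) auto

lemma gains_append: "gains A (u @ v) z = (\<lambda>j t. gains A u z j t + gains A v (fold (pitman A) u z) j t)"
  by (induction u arbitrary: z) (auto simp: add.assoc)

lemma gains_notin: "j \<notin> set u \<Longrightarrow> gains A u z j t = 0"
  by (induction u arbitrary: z) auto

lemma fold_pitman_gains:
  assumes "finite I" "set u \<subseteq> I"
  shows "fold (pitman A) u z j t = z j t + (\<Sum>i\<in>I. A j i * gains A u z i t)"
  using assms(2)
proof (induction u arbitrary: z)
  case (Cons i u)
  have "(\<Sum>k\<in>I. A j k * gains A (i # u) z k t) =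
      (\<Sum>k\<in>I. if k = i then A j i * run (z i) t else 0) + (\<Sum>k\<in>I. A j k * gains A u (pitman A i z) k t)"
    unfolding sum.distrib[symmetric] by (intro sum.cong) (auto simp: algebra_simps)
  also have "(\<Sum>k\<in>I. if k = i then A j i * run (z i) t else 0) = A j i * run (z i) t"
    using assms(1) Cons.prems by simp
  finally show ?case using Cons by (simp add: pitman_def)
qed simp

lemma weq_refl: "weq A I u u"
  and weq_sym: "weq A I u v \<Longrightarrow> weq A I v u"
  and weq_trans: "weq A I u v \<Longrightarrow> weq A I v w \<Longrightarrow> weq A I u w"
  unfolding weq_def by auto

lemma weq_fold:
  assumes "weq A I u v" "finite I" "set u \<subseteq> I" "set v \<subseteq> I" "z \<in> cpaths I"
  shows "fold (pitman A) u z = fold (pitman A) v z"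
  using assms by (auto simp: fun_eq_iff fold_pitman_gains[of I] weq_def)

lemma weq_Cons:
  assumes "weq A I u v" "i \<in> I" shows "weq A I (i # u) (i # v)"
  using assms pitman_cpaths[of _ I i A] unfolding weq_def by simp

lemma weq_append:
  assumes w: "weq A I u v" and fin: "finite I" "set u \<subseteq> I" "set v \<subseteq> I" and b: "set b \<subseteq> I"
  shows "weq A I (u @ b) (v @ b)"
  unfolding weq_def
proof (intro conjI ballI)
  fix z assume z: "z \<in> cpaths I"
  show "gains A (u @ b) z = gains A (v @ b) z"
    using w z weq_fold[OF w fin z] by (simp add: gains_append weq_def)
  fix z' assume z': "z' \<in> cpaths I"
  show "strings A (u @ b) z = strings A (u @ b) z' \<longleftrightarrow> strings A (v @ b) z = strings A (v @ b) z'"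
    using w z z' weq_fold[OF w fin z] weq_fold[OF w fin z'] by (simp add: strings_append weq_def)
qed

lemma weq_commute:
  assumes "i \<in> I" "j \<in> I" "A i j = 0" "A j i = 0"
  shows "weq A I [i, j] [j, i]"
proof -
  have 1: "pitman A i z j = z j" "pitman A j z i = z i" for z
    using assms by (auto simp: pitman_def)
  show ?thesis by (cases "i = j") (auto simp: weq_def 1 fun_eq_iff)
qed

lemma weq_braid:
  assumes I: "i \<in> I" "j \<in> I" and ij: "i \<noteq> j" "A i j = -1" "A j i = -1" "A i i = 2" "A j j = 2"
  shows "weq A I [i, j, i] [j, i, j]"
proof -
  have str: "strings A [k, l, k] z = [run (z k) 1, run (\<lambda>s. z l s - run (z k) s) 1,
        run (\<lambda>s. z k s - run (z l) s) 1 - run (z k) 1]"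
    and con: "gains A [k, l, k] z = (\<lambda>m t. if m = k then run (\<lambda>s. z k s - run (z l) s) t
        else if m = l then run (\<lambda>s. z l s - run (z k) s) t else 0)"
    if kl: "{k, l} = {i, j}" and z: "z \<in> cpaths I" for k l z
  proof -
    have k: "A k k = 2" "A k l = -1" "A l k = -1" "k \<noteq> l" and I': "k \<in> I" "l \<in> I"
      using kl ij I by (auto simp: doubleton_eq_iff)
    have p1: "pitman A k z l = (\<lambda>s. z l s - run (z k) s)" "pitman A k z k = (\<lambda>s. z k s + 2 * run (z k) s)"
      using k by (auto simp: pitman_def)
    have p2: "pitman A l (pitman A k z) k = (\<lambda>s. z k s + 2 * run (z k) s - run (\<lambda>s. z l s - run (z k) s) s)"
      using k by (auto simp: pitman_def[of A l] p1)
    have "cpath (z k)" "cpath (z l)" using z I' by (auto simp: cpaths_def)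
    note br = run_braid[OF this]
    show "strings A [k, l, k] z = [run (z k) 1, run (\<lambda>s. z l s - run (z k) s) 1,
        run (\<lambda>s. z k s - run (z l) s) 1 - run (z k) 1]"
      using br[of 1] by (simp add: p1 p2)
    show "gains A [k, l, k] z = (\<lambda>m t. if m = k then run (\<lambda>s. z k s - run (z l) s) t
        else if m = l then run (\<lambda>s. z l s - run (z k) s) t else 0)"
      using br k by (auto simp: p1 p2 fun_eq_iff)
  qed
  \<comment> \<open>The three strings of one word yield one plain supremum and both mixed suprema;
    the Pluecker relation then yields the other plain supremum, hence the strings of the other
    word.\<close>
  have pl: "run (z i) 1 + run (z j) 1 = max (run (\<lambda>s. z i s - run (z j) s) 1) (run (\<lambda>s. z j s - run (z i) s) 1)"
    if "z \<in> cpaths I" for z using that I by (intro run_add_run) (auto simp: cpaths_def)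
  show ?thesis
    unfolding weq_def
  proof (intro conjI ballI)
    fix z assume z: "z \<in> cpaths I"
    show "gains A [i, j, i] z = gains A [j, i, j] z"
      unfolding con[OF HOL.refl z] con[OF insert_commute z] using ij by (auto simp: fun_eq_iff)
    fix z' assume z': "z' \<in> cpaths I"
    show "strings A [i, j, i] z = strings A [i, j, i] z' \<longleftrightarrow> strings A [j, i, j] z = strings A [j, i, j] z'"
      unfolding str[OF HOL.refl z] str[OF insert_commute z] str[OF HOL.refl z'] str[OF insert_commute z']
      using pl[OF z] pl[OF z'] by auto
  qed
qed

definition adj :: "nat \<Rightarrow> nat \<Rightarrow> nat" where
  "adj i x = (if x = i then Suc i else if x = Suc i then i else x)"

lemma adj_adj [simp]: "adj i (adj i x) = x"
  by (auto simp: adj_def)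

lemma foldr_adj_inj: "foldr adj u x = foldr adj u y \<longleftrightarrow> x = y"
  by (induction u) (auto, metis adj_adj)

lemma foldr_adj_pair:
  "foldr (\<lambda>i. map_prod (adj i) (adj i)) u (p, q) = (foldr adj u p, foldr adj u q)"
  by (induction u) auto

definition same_perm :: "nat list \<Rightarrow> nat list \<Rightarrow> bool" where
  "same_perm u v \<longleftrightarrow> foldr adj u = foldr adj v"

text \<open>The pair \<open>(p, q)\<close> is the root e_p - e_q of type A, positive if
  \<open>p < q\<close>. The letters \<open>{1..<m}\<close> generate the permutations of
  \<open>{1..m}\<close>.\<close>

interpretation sym: root_words "{1..<m}" same_perm "{(p, q). p \<noteq> q}"
  "\<lambda>i. map_prod (adj i) (adj i)" prod.swap "\<lambda>(p, q). p < q" "\<lambda>i. (i, Suc i)" for m :: nat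
proof
  fix u :: "nat list" and i j :: nat
  assume h: "foldr (\<lambda>i. map_prod (adj i) (adj i)) u (i, Suc i) = (j, Suc j)"
  then have h1: "foldr adj u i = j" "foldr adj u (Suc i) = Suc j" by (auto simp: foldr_adj_pair)
  have "foldr adj u (adj i x) = adj j (foldr adj u x)" for x
  proof -
    consider "x = i" | "x = Suc i" | "x \<noteq> i" "x \<noteq> Suc i" by blast
    then show ?thesis
    proof cases
      case 3
      then have "foldr adj u x \<noteq> j" "foldr adj u x \<noteq> Suc j"
        using foldr_adj_inj[of u x i] foldr_adj_inj[of u x "Suc i"] h1 by auto
      then show ?thesis using 3 by (simp add: adj_def)
    qed (use h1 in \<open>auto simp: adj_def\<close>)
  qed
  then show "same_perm (u @ [i]) (j # u)" by (auto simp: same_perm_def fun_eq_iff)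
next
  fix u v :: "nat list" and x :: "nat \<times> nat"
  assume "same_perm u v"
  then show "foldr (\<lambda>i. map_prod (adj i) (adj i)) u x = foldr (\<lambda>i. map_prod (adj i) (adj i)) v x"
    by (cases x) (simp add: foldr_adj_pair same_perm_def)
qed (auto simp: same_perm_def fun_eq_iff adj_def split: if_splits)

lemma (in root_words) red_alt_le:
  assumes "red (alt i j n)" "k \<le> n" shows "red (alt i j k)"
proof -
  have "alt i j n = alt i j k @ drop k (alt i j n)"
    using append_take_drop_id[of k "alt i j n"] take_alt[OF assms(2), of i j] by simp
  then show ?thesis using assms(1) red_append(1) by metis
qed

definition cartanA :: "nat \<Rightarrow> nat \<Rightarrow> real" where
  "cartanA i j = (if i = j then 2 else if i = Suc j \<or> j = Suc i then -1 else 0)"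

text \<open>By Matsumoto's theorem only reduced alternating words of equal permutations matter. A
  shorter spelling of a longer alternating word bounds \<open>k\<close>, which leaves length 0 and
  the braid length, 2 or 3.\<close>

lemma weq_same_perm:
  assumes "sym.red m u" "sym.red m v" "same_perm u v"
  shows "weq cartanA {1..<m} u v"
proof (rule sym.matsumoto[of "weq cartanA {1..<m}", OF weq_refl weq_sym weq_trans _ _ _ assms])
  fix i j k assume ij: "i \<in> {1..<m}" "j \<in> {1..<m}" "i \<noteq> j"
    and red: "sym.red m (alt i j k)" "sym.red m (alt j i k)" and q: "same_perm (alt i j k) (alt j i k)"
  have no: "k < l" if "same_perm (alt i j l) v" "set v \<subseteq> {1..<m}" "length v < l" for v l
  proof (rule ccontr)
    assume "\<not> k < l"
    then have "sym.red m (alt i j l)" by (intro sym.red_alt_le[OF red(1)]) auto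
    from sym.red_le[OF this that(2,1)] that(3) show False by simp
  qed
  have k1: "k \<noteq> 1"
  proof
    assume "k = 1"
    then have "adj i i = adj j i" using q by (simp add: same_perm_def)
    then show False using ij(3) by (auto simp: adj_def split: if_splits)
  qed
  show "weq cartanA {1..<m} (alt i j k) (alt j i k)"
  proof (cases "i = Suc j \<or> j = Suc i")
    case True
    have "k < 4" using True ij by (intro no[where v = "[j, i]"])
        (auto simp: same_perm_def numeral_eq_Suc fun_eq_iff adj_def)
    moreover have "k \<noteq> 2"
    proof
      assume "k = 2"
      then have "adj i (adj j x) = adj j (adj i x)" for x
        using q by (simp add: same_perm_def numeral_eq_Suc fun_eq_iff)
      from this[of i] show False using True by (auto simp: adj_def split: if_splits)
    qed
    ultimately have "k = 0 \<or> k = 3" using k1 by auto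
    moreover have "weq cartanA {1..<m} [i, j, i] [j, i, j]"
      using ij True by (intro weq_braid) (auto simp: cartanA_def)
    ultimately show ?thesis by (auto simp: numeral_eq_Suc weq_refl)
  next
    case False
    have "k < 3" using False ij by (intro no[where v = "[j]"])
        (auto simp: same_perm_def numeral_eq_Suc fun_eq_iff adj_def)
    then have "k = 0 \<or> k = 2" using k1 by auto
    moreover have "weq cartanA {1..<m} [i, j] [j, i]"
      using ij False by (intro weq_commute) (auto simp: cartanA_def)
    ultimately show ?thesis by (auto simp: numeral_eq_Suc weq_refl)
  qed
qed (auto intro: weq_Cons weq_append)

section \<open>The two bipartite words of the longest permutation\<close>

text \<open>The letters of one parity commute pairwise. Rows of alternating parity form a brick
  wall; under folding, one row becomes one dihedral generator.\<close>

definition brick_row :: "nat \<Rightarrow> nat \<Rightarrow> nat list" where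
  "brick_row m c = filter (\<lambda>i. even (i + c)) [1..<m]"

primrec brick_rows :: "nat \<Rightarrow> nat \<Rightarrow> nat \<Rightarrow> nat list" where
  "brick_rows m c 0 = []"
| "brick_rows m c (Suc k) = brick_row m c @ brick_rows m (Suc c) k"

lemma set_row: "set (brick_row m c) = {i. 1 \<le> i \<and> i < m \<and> even (i + c)}"
  by (auto simp: brick_row_def)

lemma set_rows: "set (brick_rows m c k) \<subseteq> {1..<m}"
  by (induction k arbitrary: c) (auto simp: set_row)

lemma foldr_adj_row:
  assumes "distinct l" "\<forall>i\<in>set l. Suc i \<notin> set l"
  shows "foldr adj l x = (if x \<in> set l then Suc x else if x \<ge> 1 \<and> x - 1 \<in> set l then x - 1 else x)"
  using assms
proof (induction l)
  case (Cons i l)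
  then have IH: "foldr adj l x = (if x \<in> set l then Suc x else if x \<ge> 1 \<and> x - 1 \<in> set l then x - 1 else x)"
    and i: "i \<notin> set l" "Suc i \<notin> set l" "\<And>j. j \<in> set l \<Longrightarrow> Suc j \<noteq> i" by auto
  show ?case
    unfolding foldr_Cons comp_apply IH
    using i Cons.prems i(3)[of 0] by (cases x) (auto simp: adj_def intro: gr0I)
qed simp

text \<open>The strand starting at the integer \<open>j\<close> moves by one in each row; \<open>bounce\<close> folds the line
  back into \<open>1..m\<close>.\<close>

definition bounce :: "nat \<Rightarrow> int \<Rightarrow> nat" where
  "bounce m j = (if j \<le> 0 then nat (1 - j) else if j \<le> int m then nat j else nat (2 * int m + 1 - j))"

lemma row_bounce:
  assumes "- int m < j" "j < 2 * int m" "even (j + int c)" "m \<ge> 1"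
  shows "foldr adj (brick_row m c) (bounce m j) = bounce m (j + 1)"
proof -
  have r: "foldr adj (brick_row m c) x =
      (if 1 \<le> x \<and> x < m \<and> even (x + c) then Suc x else if 2 \<le> x \<and> x \<le> m \<and> odd (x + c) then x - 1 else x)" for x
    by (subst foldr_adj_row) (auto simp: set_row brick_row_def)
  consider "j < 0" | "j = 0" | "0 < j" "j < int m" | "j = int m" | "int m < j" by linarith
  then show ?thesis
  proof cases
    case 1
    then obtain x where x: "j = 1 - int x" "x \<ge> 2" by (intro that[of "nat (1 - j)"]) auto
    then have "odd (x + c)" using assms(3) by auto
    then show ?thesis unfolding r using x assms by (auto simp: bounce_def)
  next
    case 2
    then show ?thesis unfolding r using assms by (auto simp: bounce_def)
  next
    case 3
    then obtain x where x: "j = int x" "x \<ge> 1" "x < m" by (intro that[of "nat j"]) auto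
    then have "even (x + c)" using assms(3) by simp
    then show ?thesis unfolding r using x assms by (auto simp: bounce_def)
  next
    case 4
    then show ?thesis unfolding r using assms by (auto simp: bounce_def)
  next
    case 5
    then obtain x where x: "j = 2 * int m + 1 - int x" "x \<ge> 2" "x \<le> m"
      using assms by (intro that[of "nat (2 * int m + 1 - j)"]) auto
    then have "odd (x + c)" using assms(3) by auto
    then show ?thesis unfolding r using x assms by (auto simp: bounce_def)
  qed
qed

text \<open>The last row, of parity \<open>c + k - 1\<close>, acts first under \<open>foldr\<close>,
  hence the oddness condition with \<open>c + k\<close>. Each row then moves the unfolded position
  by one.\<close>

lemma rows_bounce:
  assumes "- int m < j" "j \<le> int m" "odd (j + int (c + k))" "m \<ge> 1" "k \<le> m"
  shows "foldr adj (brick_rows m c k) (bounce m j) = bounce m (j + int k)"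
  using assms(3,5)
proof (induction k arbitrary: c)
  case (Suc k)
  have "foldr adj (brick_rows m (Suc c) k) (bounce m j) = bounce m (j + int k)"
    using Suc.prems by (intro Suc.IH) auto
  moreover have "foldr adj (brick_row m c) (bounce m (j + int k)) = bounce m (j + int k + 1)"
    using Suc.prems assms by (intro row_bounce) (auto simp: even_add)
  ultimately show ?case by (simp add: ac_simps)
qed simp

text \<open>The integers \<open>x\<close> and \<open>1 - x\<close> fold to the same strand and have
  opposite parity, so one of them moves to the right in every row. After \<open>m\<close> rows both
  fold to \<open>m + 1 - x\<close>.\<close>

lemma rows_reverse:
  assumes x: "1 \<le> x" "x \<le> m" shows "foldr adj (brick_rows m c m) x = m + 1 - x"
proof (cases "odd (x + c + m)")
  case True
  have "foldr adj (brick_rows m c m) (bounce m (int x)) = bounce m (int x + int m)"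
    using True x by (intro rows_bounce) (auto simp: even_add)
  then show ?thesis using x by (auto simp: bounce_def)
next
  case False
  have "foldr adj (brick_rows m c m) (bounce m (1 - int x)) = bounce m (1 - int x + int m)"
    using False x by (intro rows_bounce) (auto simp: even_add)
  then show ?thesis using x by (auto simp: bounce_def)
qed

lemma foldr_adj_outside:
  assumes "set u \<subseteq> {1..<m}" "x \<notin> {1..m}" shows "foldr adj u x = x"
  using assms by (induction u) (auto simp: adj_def)

lemma same_perm_rows: "same_perm (brick_rows m c m) (brick_rows m d m)"
  unfolding same_perm_def
proof
  fix x show "foldr adj (brick_rows m c m) x = foldr adj (brick_rows m d m) x"
    using rows_reverse[of x m] foldr_adj_outside[OF set_rows, of x m] by (cases "x \<in> {1..m}") auto
qed

lemma length_rows: "length (brick_rows m c k) + length (brick_rows m (Suc c) k) = k * (m - 1)"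
proof -
  have "length (brick_row m c) + length (brick_row m (Suc c)) = m - 1" for c
    using sum_length_filter_compl[of "\<lambda>i. even (i + c)" "[1..<m]"] by (simp add: brick_row_def)
  then have "length (brick_row m c) + length (brick_row m (Suc c)) = m - 1" for c .
  then show ?thesis
  proof (induction k arbitrary: c)
    case (Suc k)
    have "length (brick_rows m (Suc c) k) + length (brick_rows m (Suc (Suc c)) k) = k * (m - 1)" by (rule Suc.IH) (rule Suc.prems)
    then show ?case using Suc.prems[of c] by simp
  qed simp
qed

text \<open>Reversal inverts all m(m - 1)/2 pairs, so each of the two words has at least that many
  letters. Together they have exactly m(m - 1), so both are as short as possible.\<close>

lemma red_rows: "sym.red m (brick_rows m 0 m)" "sym.red m (brick_rows m 1 m)"
proof -
  define P where "P = (SIGMA q:{1..m}. {1..<q})"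
  have "(\<Sum>q=1..m. q - 1) * 2 = m * (m - 1)" by (induction m) (auto simp: algebra_simps)
  then have cP: "2 * card P = m * (m - 1)" by (simp add: P_def)
  have ge: "card P \<le> length v" if v: "same_perm (brick_rows m c m) v" "set v \<subseteq> {1..<m}" for c v
  proof -
    let ?N = "{x \<in> {(p, q). p \<noteq> q}. (case x of (p, q) \<Rightarrow> p < q) \<and>
      \<not> (case foldr (\<lambda>i. map_prod (adj i) (adj i)) v x of (p, q) \<Rightarrow> p < q)}"
    have "prod.swap ` P \<subseteq> ?N"
    proof (rule image_subsetI)
      fix x assume x: "x \<in> P"
      obtain q p where xqp: "x = (q, p)" by (cases x)
      with x have pq: "1 \<le> p" "p < q" "q \<le> m" by (auto simp: P_def)
      then have "foldr adj v p = m + 1 - p" "foldr adj v q = m + 1 - q"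
        using rows_reverse[of _ m c] v(1) by (auto simp: same_perm_def)
      then show "prod.swap x \<in> ?N" using pq by (auto simp: foldr_adj_pair xqp)
    qed
    then have "card (prod.swap ` P) \<le> card ?N"
      using sym.card_inversions_le[OF v(2)] by (intro card_mono) auto
    also have "\<dots> \<le> length v" using sym.card_inversions_le[OF v(2)] by auto
    finally show ?thesis by (simp add: card_image)
  qed
  have "length (brick_rows m 0 m) + length (brick_rows m 1 m) = 2 * card P" using length_rows[of m 0 m] cP by simp
  moreover have "card P \<le> length (brick_rows m 0 m)" "card P \<le> length (brick_rows m 1 m)"
    using ge[OF sym.Q_refl set_rows] by blast+
  ultimately have "length (brick_rows m 0 m) = card P" "length (brick_rows m 1 m) = card P"
    by linarith+
  note len = this
  have "sym.red m (brick_rows m c m)" if "c = 0 \<or> c = 1" for c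
  proof (rule sym.redI[OF set_rows])
    fix v assume "set v \<subseteq> {1..<m}" "same_perm (brick_rows m c m) v"
    then have "card P \<le> length v" by (rule ge[rotated])
    then show "length (brick_rows m c m) \<le> length v"
      using that len by auto
  qed
  then show "sym.red m (brick_rows m 0 m)" "sym.red m (brick_rows m 1 m)" by auto
qed

lemma weq_rows: "weq cartanA {1..<m} (brick_rows m 1 m) (brick_rows m 0 m)"
  by (intro weq_same_perm red_rows same_perm_rows)

section \<open>Dihedral braid relations from type A, folded along the parity of the nodes\<close>

section \<open>Folding\<close>

text \<open>No letter of the list changes the coordinate of another, so all of them see the original
  coordinates and act at once.\<close>

lemma pitman_commuting:
  assumes "distinct l" "\<And>i j. i \<in> set l \<Longrightarrow> j \<in> set l \<Longrightarrow> i \<noteq> j \<Longrightarrow> A i j = 0"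
  shows "strings A l z = map (\<lambda>i. run (z i) 1) l" (is ?s)
    and "fold (pitman A) l z = (\<lambda>j t. z j t + (\<Sum>i\<in>set l. A j i * run (z i) t))" (is ?f)
    and "gains A l z = (\<lambda>j t. if j \<in> set l then run (z j) t else 0)" (is ?c)
proof -
  have "?s \<and> ?f \<and> ?c" using assms
  proof (induction l arbitrary: z)
    case (Cons k l)
    have same: "pitman A k z i = z i" if "i \<in> set l" for i
    proof -
      have "i \<noteq> k" using that Cons.prems(1) by auto
      then show ?thesis using that Cons.prems(2)[of i k] by (simp add: pitman_def)
    qed
    have IH: "strings A l (pitman A k z) = map (\<lambda>i. run (pitman A k z i) 1) l"
      "fold (pitman A) l (pitman A k z) = (\<lambda>j t. pitman A k z j t + (\<Sum>i\<in>set l. A j i * run (pitman A k z i) t))"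
      "gains A l (pitman A k z) = (\<lambda>j t. if j \<in> set l then run (pitman A k z j) t else 0)"
      using Cons.IH[of "pitman A k z"] Cons.prems by auto
    have sum: "(\<Sum>i\<in>set l. A j i * run (pitman A k z i) t) = (\<Sum>i\<in>set l. A j i * run (z i) t)" for j t
      by (intro sum.cong) (auto simp: same)
    show ?case
    proof (intro conjI)
      show "strings A (k # l) z = map (\<lambda>i. run (z i) 1) (k # l)" by (simp add: IH same)
      show "fold (pitman A) (k # l) z = (\<lambda>j t. z j t + (\<Sum>i\<in>set (k # l). A j i * run (z i) t))"
        using Cons.prems(1) by (simp add: IH sum) (simp add: pitman_def add.assoc)
      show "gains A (k # l) z = (\<lambda>j t. if j \<in> set (k # l) then run (z j) t else 0)"
        using Cons.prems(1) by (auto simp: IH same fun_eq_iff)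
    qed
  qed simp
  then show ?s ?f ?c by auto
qed

text \<open>The dihedral Pitman transforms of order \<open>m\<close> sit inside those of type \<open>A\<^sub>m\<^sub>-\<^sub>1\<close>: the weights
  \<open>sin (i pi / m)\<close> form the Perron-Frobenius eigenvector of the path with \<open>m - 1\<close> nodes, and the two
  dihedral generators are the products over the odd and over the even nodes.\<close>

lemma weq_dihedral:
  fixes A :: "'i \<Rightarrow> 'i \<Rightarrow> real"
  assumes m: "m \<ge> 3" and ab: "a \<noteq> b" "a \<in> I" "b \<in> I" and diag: "A a a = 2" "A b b = 2"
    and neg: "A a b < 0" "A b a < 0" and prod: "A a b * A b a = 4 * (cos (pi / real m))\<^sup>2"
  shows "weq A I (alt a b m) (alt b a m)"
proof -
  define \<theta> where "\<theta> = pi / real m"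
  have th: "0 < \<theta>" "real m * \<theta> = pi" using m by (auto simp: \<theta>_def)
  have "\<theta> \<le> pi / 3" unfolding \<theta>_def using m by (intro divide_left_mono) auto
  then have cos: "cos \<theta> > 0" using th(1) pi_gt_zero by (intro cos_gt_zero) linarith+
  define lt where "lt c = (if odd c then a else b)" for c :: nat
  \<comment> \<open>The sine is the Perron-Frobenius weight. The factors \<open>- A b a\<close> and
    \<open>2 * cos \<theta>\<close> absorb the asymmetry of \<open>A\<close>, so that
    \<open>c_rec\<close> holds for any two entries with the prescribed product.\<close>
  define c where "c i = sin (real i * \<theta>) * (if odd i then - A b a else 2 * cos \<theta>)" for i :: nat
  have cpos: "c i > 0" if "i \<in> {1..<m}" for i
  proof -
    have "0 < real i * \<theta>" "real i * \<theta> < pi" using that th by (auto simp flip: th(2))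
    then have "sin (real i * \<theta>) > 0" by (rule sin_gt_zero)
    then show ?thesis using neg cos by (auto simp: c_def)
  qed
  \<comment> \<open>The missing neighbours of the two end nodes carry weight zero, so the recursion
    covers the boundary as well.\<close>
  have c0: "c 0 = 0" "c m = 0" by (auto simp: c_def th)
  have c_rec: "c (i - 1) + c (Suc i) = - A (lt i) (lt (Suc i)) * c i" if i1: "i \<ge> 1" for i
  proof -
    obtain k where k: "i = Suc k" using i1 by (cases i) auto
    have s: "sin (real k * \<theta>) + sin (real (Suc (Suc k)) * \<theta>) = 2 * cos \<theta> * sin (real (Suc k) * \<theta>)"
    proof -
      have "sin (real k * \<theta>) = sin (real (Suc k) * \<theta> - \<theta>)" "sin (real (Suc (Suc k)) * \<theta>) = sin (real (Suc k) * \<theta> + \<theta>)"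
        by (auto simp: algebra_simps)
      then show ?thesis by (simp add: sin_diff sin_add)
    qed
    have p: "A a b * A b a = 4 * (cos \<theta> * cos \<theta>)" using prod by (simp add: \<theta>_def power2_eq_square)
    have "c k + c (Suc (Suc k)) = (sin (real k * \<theta>) + sin (real (Suc (Suc k)) * \<theta>)) * (if odd k then - A b a else 2 * cos \<theta>)"
      by (simp add: c_def algebra_simps)
    also have "\<dots> = - A (lt (Suc k)) (lt k) * c (Suc k)"
      unfolding s using p by (simp add: c_def lt_def algebra_simps)
    finally show ?thesis by (simp add: k lt_def)
  qed
  define folded where "folded zh z \<longleftrightarrow> (\<forall>i\<in>{1..<m}. zh i = (\<lambda>t. c i * z (lt i) t))"
    for zh :: "nat \<Rightarrow> real \<Rightarrow> real" and z :: "'i \<Rightarrow> real \<Rightarrow> real"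
  have lt_in: "lt k \<in> {a, b}" for k by (auto simp: lt_def)
  have nonadj: "cartanA i j = 0" if "i \<in> set (brick_row m k)" "j \<in> set (brick_row m k)" "i \<noteq> j" for i j k
    using that by (auto simp: cartanA_def set_row)
  have drow: "distinct (brick_row m k)" for k by (simp add: brick_row_def)
  have run_folded: "run (zh i) t = c i * run (z (lt i)) t"
    if "folded zh z" "z \<in> cpaths {a, b}" "i \<in> {1..<m}" for zh z i t
  proof -
    have "cpath (z (lt i))" using that lt_in[of i] by (auto simp: cpaths_def)
    then show ?thesis using that cpos[of i] by (simp add: folded_def run_scale less_imp_le)
  qed
  have lt_par: "lt i = lt k" if "even (i + k)" for i k using that by (auto simp: lt_def)
  have str1: "strings cartanA (brick_row m k) zh = map (\<lambda>i. c i * run (z (lt k)) 1) (brick_row m k)"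
    and con1: "gains cartanA (brick_row m k) zh j = (\<lambda>t. if lt j = lt k then c j * run (z (lt k)) t else 0)"
    and fold1: "folded (fold (pitman cartanA) (brick_row m k) zh) (pitman A (lt k) z)"
    if f: "folded zh z" and z: "z \<in> cpaths {a, b}" and j: "j \<in> {1..<m}" for zh z k j
  proof -
    have pc: "strings cartanA (brick_row m k) zh = map (\<lambda>i. run (zh i) 1) (brick_row m k)"
      "fold (pitman cartanA) (brick_row m k) zh = (\<lambda>j t. zh j t + (\<Sum>i\<in>set (brick_row m k). cartanA j i * run (zh i) t))"
      "gains cartanA (brick_row m k) zh = (\<lambda>j t. if j \<in> set (brick_row m k) then run (zh j) t else 0)"
      by (rule pitman_commuting[OF drow]; use nonadj in blast)+
    have rf: "run (zh i) t = c i * run (z (lt k)) t" if "i \<in> set (brick_row m k)" for i t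
      using run_folded[OF f z, of i t] that lt_par[of i k] by (auto simp: set_row)
    show "strings cartanA (brick_row m k) zh = map (\<lambda>i. c i * run (z (lt k)) 1) (brick_row m k)"
      by (simp add: pc rf)
    have par: "lt i = lt k \<longleftrightarrow> even (i + k)" for i using ab by (auto simp: lt_def)
    show "gains cartanA (brick_row m k) zh j = (\<lambda>t. if lt j = lt k then c j * run (z (lt k)) t else 0)"
      using j rf by (auto simp: pc fun_eq_iff par set_row)
    show "folded (fold (pitman cartanA) (brick_row m k) zh) (pitman A (lt k) z)"
      unfolding folded_def
    proof (intro ballI ext)
      fix i t assume i: "i \<in> {1..<m}"
      have "(\<Sum>l\<in>set (brick_row m k). cartanA i l * run (zh l) t) = (\<Sum>l\<in>set (brick_row m k). cartanA i l * c l) * run (z (lt k)) t"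
        unfolding sum_distrib_right by (intro sum.cong) (auto simp: rf)
      also have "(\<Sum>l\<in>set (brick_row m k). cartanA i l * c l) = c i * A (lt i) (lt k)"
      proof (cases "even (i + k)")
        case True
        have "(\<Sum>l\<in>set (brick_row m k). cartanA i l * c l) = (\<Sum>l\<in>set (brick_row m k). if l = i then 2 * c i else 0)"
          using nonadj[of i k] i True by (intro sum.cong HOL.refl) (auto simp: cartanA_def set_row)
        also have "\<dots> = 2 * c i" using i True by (simp add: set_row)
        also have "\<dots> = c i * A (lt i) (lt k)" using diag lt_par[OF True] by (auto simp: lt_def)
        finally show ?thesis .
      next
        case False
        \<comment> \<open>The neighbours of \<open>i\<close> belong to the row, except for
          \<open>0\<close> and \<open>m\<close>, where \<open>c\<close> vanishes.\<close>
        have "(\<Sum>l\<in>set (brick_row m k). cartanA i l * c l) = (\<Sum>l\<in>set (brick_row m k) \<union> {i - 1, Suc i}. cartanA i l * c l)"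
        proof (intro sum.mono_neutral_left ballI)
          fix l assume l: "l \<in> set (brick_row m k) \<union> {i - 1, Suc i} - set (brick_row m k)"
          then have "l = 0 \<or> l = m" using i False by (auto simp: set_row)
          then show "cartanA i l * c l = 0" using c0 by auto
        qed auto
        also have "\<dots> = (\<Sum>l\<in>{i - 1, Suc i}. cartanA i l * c l)"
        proof (intro sum.mono_neutral_right ballI)
          fix l assume l: "l \<in> set (brick_row m k) \<union> {i - 1, Suc i} - {i - 1, Suc i}"
          then have "cartanA i l = 0" using i False by (auto simp: set_row cartanA_def)
          then show "cartanA i l * c l = 0" by simp
        qed auto
        also have "\<dots> = - (c (i - 1) + c (Suc i))"
        proof -
          have "i - 1 \<noteq> i" "i - 1 \<noteq> Suc i" "i = Suc (i - 1)" using i by auto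
          then show ?thesis by (simp add: cartanA_def)
        qed
        also have "\<dots> = c i * A (lt i) (lt (Suc i))" using c_rec[of i] i by simp
        also have "lt (Suc i) = lt k" using False by (intro lt_par) auto
        finally show ?thesis .
      qed
      finally show "fold (pitman cartanA) (brick_row m k) zh i t = c i * pitman A (lt k) z (lt i) t"
        using f i by (simp add: pc folded_def pitman_def algebra_simps)
    qed
  qed
  \<comment> \<open>Spreads each string of the dihedral word over the nodes of its row with weights
    \<open>c\<close>. It is injective on lists of equal length, so equality of strings transfers in
    both directions.\<close>
  define ex where "ex = rec_list (\<lambda>k. []) (\<lambda>x xs r k. map (\<lambda>i. c i * x) (brick_row m k) @ r (Suc k))"
  have ex_simps: "ex [] k = []" "ex (x # xs) k = map (\<lambda>i. c i * x) (brick_row m k) @ ex xs (Suc k)" for x xs k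
    by (auto simp: ex_def)
  have alt_lt: "alt (lt k) (lt (Suc k)) (Suc n) = lt k # alt (lt (Suc k)) (lt (Suc (Suc k))) n" for k n
    by (simp add: lt_def)
  have lt1: "lt 1 = a" "lt 0 = b" "lt (Suc 0) = a" "lt (Suc (Suc 0)) = b" by (auto simp: lt_def)
  have rowsf: "strings cartanA (brick_rows m k n) zh = ex (strings A (alt (lt k) (lt (Suc k)) n) z) k \<and>
      (\<forall>j\<in>{1..<m}. gains cartanA (brick_rows m k n) zh j = (\<lambda>t. c j * gains A (alt (lt k) (lt (Suc k)) n) z (lt j) t))"
    if "folded zh z" "z \<in> cpaths {a, b}" for zh z k n
    using that
  proof (induction n arbitrary: zh z k)
    case 0 then show ?case by (simp add: ex_simps)
  next
    case (Suc n)
    have j1: "1 \<in> {1..<m}" using m by auto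
    have f: "folded (fold (pitman cartanA) (brick_row m k) zh) (pitman A (lt k) z)" by (rule fold1[OF Suc.prems j1])
    have z: "pitman A (lt k) z \<in> cpaths {a, b}" using Suc.prems lt_in by (intro pitman_cpaths) auto
    show ?case
      using Suc.IH[OF f z, of "Suc k"] str1[OF Suc.prems j1, of k] con1[OF Suc.prems, of _ k]
      unfolding alt_lt by (auto simp: strings_append gains_append ex_simps fun_eq_iff algebra_simps)
  qed
  \<comment> \<open>A node of each parity exists, 1 or 2, because \<open>m\<close> is at least 3; an
    empty row would lose a string.\<close>
  have row_ne: "\<exists>i\<in>set (brick_row m k). True" for k
    using m by (cases "even k") (auto simp: set_row intro: exI[of _ 1] exI[of _ 2])
  have ex_inj: "xs = ys" if "length xs = length ys" "ex xs k = ex ys k" for xs ys k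
    using that
  proof (induction xs ys arbitrary: k rule: list_induct2)
    case (Cons x xs y ys)
    then have eq: "map (\<lambda>i. c i * x) (brick_row m k) = map (\<lambda>i. c i * y) (brick_row m k)" "ex xs (Suc k) = ex ys (Suc k)"
      by (auto simp: ex_simps)
    obtain i where i: "i \<in> set (brick_row m k)" using row_ne by blast
    then have "c i * x = c i * y" using eq(1) by auto
    moreover have "c i > 0" using i cpos by (auto simp: set_row)
    ultimately show ?case using Cons.IH eq(2) by auto
  qed simp
  define lift where "lift z = (\<lambda>i t. c i * z (lt i) t)" for z :: "'i \<Rightarrow> real \<Rightarrow> real"
  have fl: "folded (lift z) z" for z by (auto simp: folded_def lift_def)
  have sub: "cpaths I \<subseteq> cpaths {a, b}" using ab by (auto simp: cpaths_def)
  have lc: "lift z \<in> cpaths {1..<m}" if "z \<in> cpaths {a, b}" for z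
    unfolding cpaths_def lift_def
  proof (clarsimp intro!: cpath_mult)
    fix i show "cpath (z (lt i))" using that lt_in[of i] by (auto simp: cpaths_def)
  qed
  note W = weq_rows[of m, unfolded weq_def]
  show ?thesis
    unfolding weq_def
  proof (intro conjI ballI)
    fix z assume "z \<in> cpaths I"
    then have z: "z \<in> cpaths {a, b}" using sub by auto
    have "gains cartanA (brick_rows m 1 m) (lift z) = gains cartanA (brick_rows m 0 m) (lift z)"
      using W lc[OF z] by blast
    note gg = this
    have eq: "gains A (alt a b m) z (lt j) t = gains A (alt b a m) z (lt j) t" if j: "j \<in> {1..<m}" for j t
    proof -
      have "gains cartanA (brick_rows m 1 m) (lift z) j = (\<lambda>t. c j * gains A (alt a b m) z (lt j) t)"
        using rowsf[OF fl z, of 1 m] j unfolding lt1 One_nat_def by blast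
      moreover have "gains cartanA (brick_rows m 0 m) (lift z) j = (\<lambda>t. c j * gains A (alt b a m) z (lt j) t)"
        using rowsf[OF fl z, of 0 m] j unfolding lt1 by blast
      ultimately have "c j * gains A (alt a b m) z (lt j) t = c j * gains A (alt b a m) z (lt j) t"
        using gg by (metis (no_types))
      then show ?thesis using cpos[OF j] by simp
    qed
    have ea: "gains A (alt a b m) z a t = gains A (alt b a m) z a t" for t
      using eq[of 1 t] m unfolding lt1 by simp
    have eb: "gains A (alt a b m) z b t = gains A (alt b a m) z b t" for t
      using eq[of 2 t] m by (simp add: lt_def)
    show "gains A (alt a b m) z = gains A (alt b a m) z"
    proof (intro ext)
      fix j t
      show "gains A (alt a b m) z j t = gains A (alt b a m) z j t"
      proof (cases "j = a \<or> j = b")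
        case False
        then show ?thesis using set_alt[of a b m] set_alt[of b a m]
          by (subst (1 2) gains_notin) auto
      qed (use ea eb in auto)
    qed
    fix z' assume "z' \<in> cpaths I"
    then have z': "z' \<in> cpaths {a, b}" using sub by auto
    have "strings A (alt (lt k) (lt (Suc k)) m) z = strings A (alt (lt k) (lt (Suc k)) m) z' \<longleftrightarrow>
        strings cartanA (brick_rows m k m) (lift z) = strings cartanA (brick_rows m k m) (lift z')" for k
      using rowsf[OF fl z, of k m] rowsf[OF fl z', of k m] ex_inj by (metis length_strings)
    from this[of 1] this[of 0] W lc[OF z] lc[OF z']
    show "strings A (alt a b m) z = strings A (alt a b m) z' \<longleftrightarrow> strings A (alt b a m) z = strings A (alt b a m) z'"
      by (simp add: lt1)
  qed
qed

section \<open>The finite Coxeter group: signed reflections, braid words and a longest word\<close>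

section \<open>Finite Coxeter groups\<close>

locale coxeter = group W for W :: "('w, 'x) monoid_scheme" (structure) +
  fixes S :: "'w set"
  assumes cox: "coxeter_system W S" and finite_carrier: "finite (carrier W)"
begin

lemma S_carrier: "s \<in> S \<Longrightarrow> s \<in> carrier W" and S_square: "s \<in> S \<Longrightarrow> s \<otimes> s = \<one>"
  and finite_S: "finite S"
  using cox by (auto simp: coxeter_system_def)

lemma S_inv: "s \<in> S \<Longrightarrow> inv s = s"
  using S_square S_carrier inv_equality by metis

lemma S_cancel: "s \<in> S \<Longrightarrow> x \<in> carrier W \<Longrightarrow> s \<otimes> (s \<otimes> x) = x"
  using S_square S_carrier by (simp flip: m_assoc)

lemma S_cancel_right: "s \<in> S \<Longrightarrow> x \<in> carrier W \<Longrightarrow> x \<otimes> s \<otimes> s = x"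
  using S_square S_carrier by (simp add: m_assoc)

definition val :: "'w list \<Rightarrow> 'w" where
  "val w = foldr (\<lambda>s x. s \<otimes> x) w \<one>"

lemma val_simps [simp]: "val [] = \<one>" "val (s # w) = s \<otimes> val w"
  by (auto simp: val_def)

lemma val_closed: "set w \<subseteq> S \<Longrightarrow> val w \<in> carrier W"
  by (induction w) (auto intro: S_carrier)

lemma val_append: "set u \<subseteq> S \<Longrightarrow> set v \<subseteq> S \<Longrightarrow> val (u @ v) = val u \<otimes> val v"
  by (induction u) (auto simp: val_closed S_carrier m_assoc)

lemma val_rev: "set u \<subseteq> S \<Longrightarrow> val (rev u) = inv (val u)"
  by (induction u) (auto simp: val_append val_closed S_carrier S_inv inv_mult_group)

lemma val_surj: assumes "g \<in> carrier W" shows "\<exists>w. set w \<subseteq> S \<and> val w = g"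
proof -
  have "g \<in> generate W S" using assms cox by (simp add: coxeter_system_def)
  then show ?thesis
  proof induction
    case one then show ?case by (intro exI[of _ "[]"]) auto
  next
    case (incl h) then show ?case using S_carrier by (intro exI[of _ "[h]"]) auto
  next
    case (inv h) then show ?case using S_carrier S_inv by (intro exI[of _ "[h]"]) auto
  next
    case (eng h1 h2)
    then obtain u v where "set u \<subseteq> S" "val u = h1" "set v \<subseteq> S" "val v = h2" by auto
    then show ?case by (intro exI[of _ "u @ v"]) (auto simp: val_append)
  qed
qed

text \<open>The universal property of the presentation in terms of words: involutions on
  \<open>D\<close> that respect the relators act through \<open>W\<close>. It serves for the signed
  group elements and for the free space on \<open>S\<close>, where an action of \<open>W\<close>
  still has to be produced.\<close>

lemma foldr_cong_val:
  assumes D: "\<And>s x. s \<in> S \<Longrightarrow> x \<in> D \<Longrightarrow> F s x \<in> D"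
    and inv: "\<And>s x. s \<in> S \<Longrightarrow> x \<in> D \<Longrightarrow> F s (F s x) = x"
    and rel: "\<And>s t x. s \<in> S \<Longrightarrow> t \<in> S \<Longrightarrow> x \<in> D \<Longrightarrow> foldr F (concat (replicate (ord (s \<otimes> t)) [s, t])) x = x"
    and uv: "set u \<subseteq> S" "set v \<subseteq> S" "val u = val v" and x: "x \<in> D"
  shows "foldr F u x = foldr F v x"
proof -
  have D': "foldr F w x \<in> D" if "set w \<subseteq> S" "x \<in> D" for w x
    using that by (induction w) (auto intro: D)
  have eq: "(set u \<subseteq> S \<longleftrightarrow> set v \<subseteq> S) \<and> (set u \<subseteq> S \<longrightarrow> (\<forall>x\<in>D. foldr F u x = foldr F v x))"
    if "coxeter_eq W S u v" for u v
    using that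
  proof induction
    case (relator s t u v)
    have "set (concat (replicate (ord (s \<otimes> t)) [s, t])) \<subseteq> S" using relator by auto
    then show ?case using rel[OF relator] D' by auto
  qed auto
  have inv': "foldr F (rev w) (foldr F w x) = x" if "set w \<subseteq> S" "x \<in> D" for w x
    using that by (induction w) (auto simp: inv D')
  have "val (u @ rev v) = \<one>" using uv by (simp add: val_append val_rev val_closed)
  moreover have "u @ rev v \<in> lists S" using uv by auto
  ultimately have "coxeter_eq W S (u @ rev v) []"
    using cox unfolding coxeter_system_def val_def by blast
  from eq[OF this] have "foldr F (u @ rev v) (foldr F v x) = foldr F v x"
    using uv D'[OF uv(2) x] by simp
  then show ?thesis using inv'[OF uv(2) x] by simp
qed

section \<open>Reflections and signs\<close>

text \<open>Signed group elements play the role of the root system: the element \<open>(t, True)\<close> is the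
  positive root of the reflection \<open>t\<close>.\<close>

definition root_act :: "'w \<Rightarrow> 'w \<times> bool \<Rightarrow> 'w \<times> bool" where
  "root_act s = (\<lambda>(t, b). (s \<otimes> t \<otimes> s, b \<noteq> (t = s)))"

lemma conj_eq_iff: "s \<in> S \<Longrightarrow> t \<in> carrier W \<Longrightarrow> s \<otimes> t \<otimes> s = s \<longleftrightarrow> t = s"
  using S_carrier S_square S_cancel S_cancel_right by (metis m_assoc m_closed)

lemma root_act_involution: "s \<in> S \<Longrightarrow> x \<in> carrier W \<times> UNIV \<Longrightarrow> root_act s (root_act s x) = x"
proof -
  assume s: "s \<in> S" and "x \<in> carrier W \<times> (UNIV :: bool set)"
  then obtain t b where x: "x = (t, b)" "t \<in> carrier W" by auto
  have "s \<otimes> (s \<otimes> t \<otimes> s) \<otimes> s = t" using s x(2) S_carrier by (simp add: m_assoc S_cancel S_square)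
  then show ?thesis using conj_eq_iff[OF s x(2)] x(1) by (auto simp: root_act_def)
qed

lemma root_act_closed: "s \<in> S \<Longrightarrow> x \<in> carrier W \<times> UNIV \<Longrightarrow> root_act s x \<in> carrier W \<times> UNIV"
  using S_carrier by (auto simp: root_act_def)

lemma fst_foldr_root_act:
  "set u \<subseteq> S \<Longrightarrow> t \<in> carrier W \<Longrightarrow> fst (foldr root_act u (t, b)) = val u \<otimes> t \<otimes> inv (val u)"
proof (induction u)
  case (Cons s u)
  obtain q c where qc: "foldr root_act u (t, b) = (q, c)" by fastforce
  have "q = val u \<otimes> t \<otimes> inv (val u)" using Cons qc by auto
  then have "s \<otimes> q \<otimes> s = (s \<otimes> val u) \<otimes> t \<otimes> inv (s \<otimes> val u)"
    using Cons.prems by (simp add: m_assoc val_closed S_carrier inv_mult_group S_inv)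
  then show ?case unfolding foldr_Cons comp_apply qc by (simp add: root_act_def)
qed simp

text \<open>The sign flips when the running conjugate of \<open>r\<close> meets \<open>t\<close>,
  and then when it meets \<open>s\<close>. Pulled back through the first \<open>k\<close> pairs,
  these events read r = (t s)^j t with j = 2k and j = 2k + 1, so a single sum counts all
  flips.\<close>

lemma root_act_power:
  assumes s: "s \<in> S" and t: "t \<in> S" and r: "r \<in> carrier W"
  shows "foldr root_act (concat (replicate k [s, t])) (r, b) =
    ((s \<otimes> t) [^] k \<otimes> r \<otimes> (t \<otimes> s) [^] k,
     b \<noteq> odd (\<Sum>j<2 * k. if r = (t \<otimes> s) [^] j \<otimes> t then 1 else 0 :: nat))"
proof (induction k)
  case 0
  then show ?case using r by simp
next
  case (Suc k)
  define c d where "c = s \<otimes> t" and "d = t \<otimes> s"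
  have sc: "s \<in> carrier W" and tc: "t \<in> carrier W" and cc: "c \<in> carrier W" and dc: "d \<in> carrier W"
    using s t S_carrier by (auto simp: c_def d_def)
  have cd: "c \<otimes> d = \<one>"
    using s t sc tc by (simp add: c_def d_def m_assoc S_cancel S_square)
  then have dinv: "d = inv c" using cc dc by (metis inv_equality inv_inv)
  have powinv: "d [^] k = inv (c [^] k)" for k :: nat using cc by (simp add: dinv nat_pow_inv)
  have tcd: "t \<otimes> c [^] k = d [^] k \<otimes> t" for k :: nat
  proof (induction k)
    case (Suc k)
    have "t \<otimes> c [^] Suc k = (t \<otimes> c [^] k) \<otimes> c" using tc cc by (simp add: m_assoc)
    also have "\<dots> = d [^] k \<otimes> (t \<otimes> c)" using Suc tc cc dc by (simp add: m_assoc)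
    also have "t \<otimes> c = d \<otimes> t" using sc tc by (simp add: c_def d_def m_assoc)
    finally show ?case using tc dc by (simp add: m_assoc)
  qed (use tc in simp)
  define rk where "rk = c [^] k \<otimes> r \<otimes> d [^] k"
  have rkc: "rk \<in> carrier W" using cc dc r by (simp add: rk_def)
  have move: "rk = x \<longleftrightarrow> r = d [^] k \<otimes> x \<otimes> c [^] k" if "x \<in> carrier W" for x
  proof -
    have "rk = x \<longleftrightarrow> c [^] k \<otimes> r = x \<otimes> c [^] k"
      unfolding rk_def powinv using that cc r by (metis inv_solve_right m_closed nat_pow_closed inv_closed)
    also have "\<dots> \<longleftrightarrow> r = d [^] k \<otimes> x \<otimes> c [^] k"
      unfolding powinv using that cc r by (metis inv_solve_left m_assoc m_closed nat_pow_closed inv_closed)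
    finally show ?thesis .
  qed
  have 1: "rk = t \<longleftrightarrow> r = d [^] (2 * k) \<otimes> t"
    unfolding move[OF tc] using tc dc cc by (simp add: m_assoc tcd) (simp flip: m_assoc add: nat_pow_mult mult_2)
  have 2: "t \<otimes> rk \<otimes> t = s \<longleftrightarrow> r = d [^] Suc (2 * k) \<otimes> t"
  proof -
    have "t \<otimes> rk \<otimes> t = s \<longleftrightarrow> rk = t \<otimes> s \<otimes> t"
      using t rkc sc tc by (metis S_cancel S_cancel_right m_assoc m_closed)
    also have "\<dots> \<longleftrightarrow> rk = d \<otimes> t" by (simp add: d_def)
    also have "\<dots> \<longleftrightarrow> r = d [^] k \<otimes> (d \<otimes> t) \<otimes> c [^] k" using dc tc by (intro move) auto
    also have "d [^] k \<otimes> (d \<otimes> t) \<otimes> c [^] k = d [^] k \<otimes> d \<otimes> (d [^] k \<otimes> t)"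
      using dc tc cc by (simp add: m_assoc tcd)
    also have "\<dots> = (d [^] Suc k \<otimes> d [^] k) \<otimes> t" using dc tc by (simp add: m_assoc)
    also have "\<dots> = d [^] (Suc k + k) \<otimes> t" using dc by (simp only: nat_pow_mult)
    also have "Suc k + k = Suc (2 * k)" by simp
    finally show ?thesis .
  qed
  have "foldr root_act (concat (replicate (Suc k) [s, t])) (r, b) =
      root_act s (root_act t (rk, b \<noteq> odd (\<Sum>j<2 * k. if r = d [^] j \<otimes> t then 1 else 0 :: nat)))"
    using Suc by (simp add: rk_def c_def d_def)
  also have "\<dots> = (s \<otimes> (t \<otimes> rk \<otimes> t) \<otimes> s,
      b \<noteq> odd (\<Sum>j<2 * Suc k. if r = d [^] j \<otimes> t then 1 else 0 :: nat))"
    using 1 2 by (auto simp: root_act_def)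
  also have "s \<otimes> (t \<otimes> rk \<otimes> t) \<otimes> s = c [^] Suc k \<otimes> r \<otimes> d [^] Suc k"
  proof -
    have "c [^] Suc k = c \<otimes> c [^] k" using cc by (rule nat_pow_Suc2)
    moreover have "s \<otimes> (t \<otimes> rk \<otimes> t) \<otimes> s = c \<otimes> rk \<otimes> d" using sc tc rkc by (simp add: c_def d_def m_assoc)
    ultimately show ?thesis using cc dc r by (simp add: rk_def m_assoc)
  qed
  finally show ?case by (simp only: c_def d_def)
qed

text \<open>Conjugation by the m-th power is trivial. The number of flips is even because the
  condition on \<open>j\<close> has period \<open>m\<close> while \<open>j\<close> runs through
  \<open>2 * m\<close> values.\<close>

lemma root_act_relator:
  assumes s: "s \<in> S" and t: "t \<in> S" and x: "x \<in> carrier W \<times> UNIV"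
  shows "foldr root_act (concat (replicate (ord (s \<otimes> t)) [s, t])) x = x"
proof -
  obtain r b where rb: "x = (r, b)" "r \<in> carrier W" using x by auto
  define m where "m = ord (s \<otimes> t)"
  have sc: "s \<in> carrier W" and tc: "t \<in> carrier W" using s t S_carrier by auto
  have c1: "(s \<otimes> t) [^] m = \<one>" unfolding m_def using sc tc by (intro pow_ord_eq_1) auto
  have "t \<otimes> s = inv (s \<otimes> t)" using s t sc tc by (simp add: inv_mult_group S_inv)
  then have d1: "(t \<otimes> s) [^] m = \<one>" using c1 sc tc by (simp add: nat_pow_inv)
  define g where "g j = (if r = (t \<otimes> s) [^] j \<otimes> t then 1 else 0 :: nat)" for j :: nat
  have g: "g (m + j) = g j" for j
    using d1 sc tc by (simp add: g_def flip: nat_pow_mult)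
  have "(\<Sum>j<m + n. g j) = (\<Sum>j<m. g j) + (\<Sum>j<n. g (m + j))" for n by (induction n) auto
  from this[of m] have "even (\<Sum>j<2 * m. g j)" by (simp add: g mult_2)
  then show ?thesis
    using root_act_power[OF s t rb(2), of m b] rb c1 d1 by (simp add: m_def[symmetric] g_def)
qed

text \<open>All signed group elements serve as roots, so closure is immediate;
  \<open>act_pos\<close> holds since \<open>s\<close> changes the sign of no element but
  \<open>s\<close> itself.\<close>

sublocale root_words S "\<lambda>u v. val u = val v" "carrier W \<times> UNIV" root_act "\<lambda>(t, b). (t, \<not> b)" snd "\<lambda>s. (s, True)"
proof
  fix u v x assume "set u \<subseteq> S" "set v \<subseteq> S" "val u = val v" "x \<in> carrier W \<times> (UNIV :: bool set)"
  then show "foldr root_act u x = foldr root_act v x"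
    by (intro foldr_cong_val[where D = "carrier W \<times> UNIV"] root_act_closed root_act_involution root_act_relator)
next
  fix u i j assume h: "set u \<subseteq> S" "i \<in> S" "j \<in> S" "foldr root_act u (i, True) = (j, True)"
  then have "val u \<otimes> i \<otimes> inv (val u) = j" using fst_foldr_root_act[of u i True] S_carrier by auto
  then have "val u \<otimes> i = j \<otimes> val u"
    using h val_closed S_carrier by (metis inv_solve_right m_closed)
  then show "val (u @ [i]) = val (j # u)" using h S_carrier by (simp add: val_append)
qed (auto simp: val_append root_act_def S_square S_carrier S_cancel_right split: if_splits)

text \<open>The quotient of the two alternating words of length \<open>k\<close> is the k-th power
  of i j, by an induction that swaps the roles of the two letters.\<close>

lemma val_alt_eq_iff:
  assumes i: "i \<in> S" and j: "j \<in> S"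
  shows "val (alt i j k) = val (alt j i k) \<longleftrightarrow> ord (i \<otimes> j) dvd k"
proof -
  have ic: "i \<in> carrier W" and jc: "j \<in> carrier W" using i j S_carrier by auto
  have alt: "val (alt a b k) \<in> carrier W" if "a \<in> S" "b \<in> S" for a b k
    using that set_alt[of a b k] by (intro val_closed) auto
  have "val (alt a b k) \<otimes> inv (val (alt b a k)) = (a \<otimes> b) [^] k" if ab: "a \<in> S" "b \<in> S" for a b
  proof (induction k)
    case (Suc k)
    have ac: "a \<in> carrier W" and bc: "b \<in> carrier W" using ab S_carrier by auto
    define x y where "x = val (alt a b k)" and "y = val (alt b a k)"
    have xy: "x \<in> carrier W" "y \<in> carrier W" using alt[OF ab] alt[OF ab(2,1)] by (auto simp: x_def y_def)
    have "a \<otimes> y \<otimes> inv (b \<otimes> x) = a \<otimes> inv (x \<otimes> inv y) \<otimes> b"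
    proof -
      have "inv (b \<otimes> x) = inv x \<otimes> b" using bc xy S_inv[OF ab(2)] by (simp add: inv_mult_group)
      moreover have "inv (x \<otimes> inv y) = y \<otimes> inv x" using xy by (simp add: inv_mult_group)
      ultimately show ?thesis using ac bc xy by (simp add: m_assoc)
    qed
    also have "x \<otimes> inv y = (a \<otimes> b) [^] k" using Suc by (simp add: x_def y_def)
    also have "inv ((a \<otimes> b) [^] k) = (b \<otimes> a) [^] k"
      using ab ac bc by (simp flip: nat_pow_inv add: inv_mult_group S_inv)
    also have "a \<otimes> (b \<otimes> a) [^] k = (a \<otimes> b) [^] k \<otimes> a"
    proof (induction k)
      case (Suc n)
      have "a \<otimes> (b \<otimes> a) [^] Suc n = (a \<otimes> (b \<otimes> a) [^] n) \<otimes> (b \<otimes> a)" using ac bc by (simp add: m_assoc)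
      then show ?case using ac bc Suc by (simp add: m_assoc)
    qed (use ac in simp)
    also have "(a \<otimes> b) [^] k \<otimes> a \<otimes> b = (a \<otimes> b) [^] Suc k" using ac bc by (simp add: m_assoc)
    finally show ?case by (simp add: x_def y_def)
  qed simp
  from this[OF i j] have "val (alt i j k) = val (alt j i k) \<longleftrightarrow> (i \<otimes> j) [^] k = \<one>"
    using alt[OF i j] alt[OF j i] by (metis inv_closed inv_equality inv_inv r_inv)
  also have "\<dots> \<longleftrightarrow> ord (i \<otimes> j) dvd k" using ic jc by (intro pow_eq_id) auto
  finally show ?thesis .
qed

lemma ord_pos: "i \<in> S \<Longrightarrow> j \<in> S \<Longrightarrow> 0 < ord (i \<otimes> j)"
  using S_carrier finite_carrier by (intro ord_ge_1[THEN less_le_trans[OF zero_less_one]]) auto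

lemma ord_ge_2: assumes "i \<in> S" "j \<in> S" "i \<noteq> j" shows "2 \<le> ord (i \<otimes> j)"
proof -
  have "ord (i \<otimes> j) \<noteq> 1"
  proof
    assume "ord (i \<otimes> j) = 1"
    then have "i \<otimes> j = \<one>" using pow_ord_eq_1[of "i \<otimes> j"] assms S_carrier by simp
    then have "i = inv j" using assms S_carrier by (metis inv_equality inv_inv)
    then show False using assms S_inv by simp
  qed
  then show ?thesis using ord_pos[OF assms(1,2)] by linarith
qed

text \<open>Equality makes \<open>k\<close> a multiple of the order m. Beyond m the word is not
  reduced: its prefix of length m + 1 spells the same element as an alternating word of length m -
  1.\<close>

lemma red_alt_eq:
  assumes i: "i \<in> S" and j: "j \<in> S" and red: "red (alt i j k)" and eq: "val (alt i j k) = val (alt j i k)"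
  shows "k = 0 \<or> k = ord (i \<otimes> j)"
proof (rule ccontr)
  assume "\<not> (k = 0 \<or> k = ord (i \<otimes> j))"
  moreover define m where "m = ord (i \<otimes> j)"
  moreover have "m dvd k" using iffD1[OF val_alt_eq_iff[OF i j] eq] by (simp add: m_def)
  ultimately have "Suc m \<le> k" using dvd_imp_le[of m k] by (auto simp: le_less)
  then have "red (alt i j (Suc m))" by (rule red_alt_le[OF red])
  moreover have "val (alt i j (Suc m)) = val (alt j i (m - 1))"
  proof -
    obtain n where n: "m = Suc n" using ord_pos[OF i j] by (cases m) (auto simp: m_def)
    have eq': "val (alt i j m) = val (alt j i m)" using val_alt_eq_iff[OF i j, of m] by (simp add: m_def)
    have "val (alt i j (Suc m)) = i \<otimes> val (alt j i m)" by simp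
    also have "\<dots> = i \<otimes> val (alt i j m)" by (simp only: eq')
    also have "\<dots> = i \<otimes> (i \<otimes> val (alt j i n))" by (simp add: n)
    finally have "val (alt i j (Suc m)) = i \<otimes> (i \<otimes> val (alt j i n))" .
    moreover have "val (alt j i n) \<in> carrier W" using set_alt[of j i n] i j by (intro val_closed) auto
    ultimately show ?thesis using i by (simp add: n S_cancel)
  qed
  ultimately have "length (alt i j (Suc m)) \<le> length (alt j i (m - 1))"
    using set_alt[of j i "m - 1"] i j by (intro red_le) auto
  then show False by simp
qed

text \<open>Reduced lengths are determined by the group element, and there are finitely many
  elements.\<close>

lemma longest_exists: "\<exists>u. red u \<and> (\<forall>v. red v \<longrightarrow> length v \<le> length u)"
proof -
  have "{length u |u. red u} \<subseteq> (\<lambda>g. LEAST n. \<exists>u. set u \<subseteq> S \<and> val u = g \<and> length u = n) ` carrier W"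
  proof clarify
    fix u assume u: "red u"
    have "length u = (LEAST n. \<exists>v. set v \<subseteq> S \<and> val v = val u \<and> length v = n)"
    proof (rule Least_equality[symmetric])
      show "\<exists>v. set v \<subseteq> S \<and> val v = val u \<and> length v = length u" using red_lists[OF u] by blast
      fix n assume "\<exists>v. set v \<subseteq> S \<and> val v = val u \<and> length v = n"
      then show "length u \<le> n" using red_le[OF u] by metis
    qed
    then show "length u \<in> (\<lambda>g. LEAST n. \<exists>u. set u \<subseteq> S \<and> val u = g \<and> length u = n) ` carrier W"
      using val_closed[OF red_lists[OF u]] by blast
  qed
  then have fin: "finite {length u |u. red u}" using finite_carrier by (rule finite_surj[rotated])
  have "red []" by (rule redI) auto
  then have "Max {length u |u. red u} \<in> {length u |u. red u}" using fin by (intro Max_in) auto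
  then obtain u where u: "red u" "length u = Max {length u |u. red u}" by auto
  have "length v \<le> length u" if "red v" for v unfolding u(2)
    by (rule Max_ge[OF fin]) (use that in blast)
  then show ?thesis using u(1) by blast
qed

text \<open>The property of a longest word that is used later: up to \<open>R\<close> it may begin
  with any generator. This makes it insensitive to each single crystal operator.\<close>

lemma longest_word:
  assumes R: "\<And>u. R u u" "\<And>u v. R u v \<Longrightarrow> R v u" "\<And>u v w. R u v \<Longrightarrow> R v w \<Longrightarrow> R u w"
    "\<And>a u v. a \<in> S \<Longrightarrow> set u \<subseteq> S \<Longrightarrow> set v \<subseteq> S \<Longrightarrow> R u v \<Longrightarrow> R (a # u) (a # v)"
    "\<And>a u v. a \<in> S \<Longrightarrow> set u \<subseteq> S \<Longrightarrow> set v \<subseteq> S \<Longrightarrow> R u v \<Longrightarrow> R (u @ [a]) (v @ [a])"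
    and braid: "\<And>s t. s \<in> S \<Longrightarrow> t \<in> S \<Longrightarrow> s \<noteq> t \<Longrightarrow> R (alt s t (ord (s \<otimes> t))) (alt t s (ord (s \<otimes> t)))"
  shows "\<exists>u. set u \<subseteq> S \<and> (\<forall>s\<in>S. \<exists>v. set v \<subseteq> S \<and> R u (s # v))"
proof -
  obtain u where u: "red u" "\<And>v. red v \<Longrightarrow> length v \<le> length u" using longest_exists by blast
  have M: "R u v" if "red u" "red v" "val u = val v" for u v
  proof (rule matsumoto[of R, OF R])
    fix i j k
    assume ij: "i \<in> S" "j \<in> S" "i \<noteq> j" and "red (alt i j k)" "val (alt i j k) = val (alt j i k)"
    then have "k = 0 \<or> k = ord (i \<otimes> j)" by (intro red_alt_eq)
    then show "R (alt i j k) (alt j i k)" using braid[OF ij] R(1) by auto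
  qed (use that in auto)
  have "\<exists>v. set v \<subseteq> S \<and> R u (s # v)" if s: "s \<in> S" for s
  proof -
    have "\<not> red (s # u)" using u(2)[of "s # u"] by auto
    then obtain v where v: "red (s # v)" "val u = val (s # v)" using longest_first[OF u(1) s] by blast
    then show "\<exists>v. set v \<subseteq> S \<and> R u (s # v)" using M[OF u(1)] red_lists[OF v(1)] by auto
  qed
  then show ?thesis using red_lists[OF u(1)] by blast
qed

end

section \<open>Injectivity of the Cartan matrix and independence of the simple roots\<close>

section \<open>Nondegeneracy of the Cartan matrix\<close>

lemma det2_zero:
  fixes a b p q :: real
  assumes "2 * p + a * q = 0" "b * p + 2 * q = 0" "a * b < 4"
  shows "p = 0" "q = 0"
proof -
  have "(4 - a * b) * p = 2 * (2 * p + a * q) - a * (b * p + 2 * q)" by (simp add: algebra_simps)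
  then show "p = 0" using assms by simp
  then show "q = 0" using assms by simp
qed

locale coxeter_realization = coxeter W S for W :: "('w, 'x) monoid_scheme" (structure) and S +
  fixes act :: "'w \<Rightarrow> 'v::real_vector \<Rightarrow> 'v" and root :: "'w \<Rightarrow> 'v" and coroot :: "'w \<Rightarrow> 'v \<Rightarrow> real"
  assumes realization: "realization W S act root coroot"
begin

definition cartan :: "'w \<Rightarrow> 'w \<Rightarrow> real" where
  "cartan s t = coroot s (root t)"

lemma coroot_linear: "s \<in> S \<Longrightarrow> linear (coroot s)"
  and act_linear: "g \<in> carrier W \<Longrightarrow> linear (act g)"
  and act_S: "s \<in> S \<Longrightarrow> act s x = x - coroot s x *\<^sub>R root s"
  and cartan_diag: "s \<in> S \<Longrightarrow> cartan s s = 2"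
proof -
  note r = realization[unfolded realization_def, THEN conjunct2]
  show "s \<in> S \<Longrightarrow> linear (coroot s)" by (rule bspec[OF r[THEN conjunct2, THEN conjunct1]])
  show "g \<in> carrier W \<Longrightarrow> linear (act g)" by (rule bspec[OF r[THEN conjunct1]])
  show "s \<in> S \<Longrightarrow> act s x = x - coroot s x *\<^sub>R root s"
    by (rule bspec[OF r[THEN conjunct2, THEN conjunct2, THEN conjunct2, THEN conjunct1], THEN spec])
  show "s \<in> S \<Longrightarrow> cartan s s = 2" unfolding cartan_def
    by (rule bspec[OF r[THEN conjunct2, THEN conjunct2, THEN conjunct1]])
qed

lemma cartan_ord_2: "s \<in> S \<Longrightarrow> t \<in> S \<Longrightarrow> s \<noteq> t \<Longrightarrow> ord (s \<otimes> t) = 2 \<Longrightarrow> cartan s t = 0"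
  and cartan_neg: "s \<in> S \<Longrightarrow> t \<in> S \<Longrightarrow> s \<noteq> t \<Longrightarrow> ord (s \<otimes> t) \<noteq> 2 \<Longrightarrow> cartan s t < 0"
  and cartan_prod: "s \<in> S \<Longrightarrow> t \<in> S \<Longrightarrow> s \<noteq> t \<Longrightarrow> ord (s \<otimes> t) \<noteq> 2 \<Longrightarrow>
      cartan s t * cartan t s = 4 * (cos (pi / real (ord (s \<otimes> t))))\<^sup>2"
proof -
  have "\<forall>s\<in>S. \<forall>t\<in>S. s \<noteq> t \<longrightarrow> (if ord (s \<otimes> t) = 2 then cartan s t = 0 \<and> cartan t s = 0
      else cartan s t < 0 \<and> cartan t s < 0 \<and> cartan s t * cartan t s = 4 * (cos (pi / real (ord (s \<otimes> t))))\<^sup>2)"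
    unfolding cartan_def
    by (rule realization[unfolded realization_def, THEN conjunct2, THEN conjunct2, THEN conjunct2, THEN conjunct2, THEN conjunct2])
  then show "s \<in> S \<Longrightarrow> t \<in> S \<Longrightarrow> s \<noteq> t \<Longrightarrow> ord (s \<otimes> t) = 2 \<Longrightarrow> cartan s t = 0"
    "s \<in> S \<Longrightarrow> t \<in> S \<Longrightarrow> s \<noteq> t \<Longrightarrow> ord (s \<otimes> t) \<noteq> 2 \<Longrightarrow> cartan s t < 0"
    "s \<in> S \<Longrightarrow> t \<in> S \<Longrightarrow> s \<noteq> t \<Longrightarrow> ord (s \<otimes> t) \<noteq> 2 \<Longrightarrow>
      cartan s t * cartan t s = 4 * (cos (pi / real (ord (s \<otimes> t))))\<^sup>2"
    by auto
qed

lemma coroot_simps: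
  "s \<in> S \<Longrightarrow> coroot s (x + y) = coroot s x + coroot s y"
  "s \<in> S \<Longrightarrow> coroot s (x - y) = coroot s x - coroot s y"
  "s \<in> S \<Longrightarrow> coroot s (c *\<^sub>R x) = c * coroot s x"
  "s \<in> S \<Longrightarrow> coroot s 0 = 0"
  "s \<in> S \<Longrightarrow> coroot s (\<Sum>i\<in>A. f i) = (\<Sum>i\<in>A. coroot s (f i))"
  using linear_add[OF coroot_linear] linear_diff[OF coroot_linear] linear_scale[OF coroot_linear]
    linear_0[OF coroot_linear] linear_sum[OF coroot_linear] by simp_all

lemma act_one: "act \<one> x = x" and act_mult: "g \<in> carrier W \<Longrightarrow> h \<in> carrier W \<Longrightarrow> act (g \<otimes> h) x = act g (act h x)"
proof -
  interpret group_action W UNIV act using realization by (simp add: realization_def)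
  show "act \<one> x = x" using id_eq_one by (metis UNIV_I restrict_apply')
  show "g \<in> carrier W \<Longrightarrow> h \<in> carrier W \<Longrightarrow> act (g \<otimes> h) x = act g (act h x)"
    by (simp add: composition_rule)
qed

lemma foldr_act: "set w \<subseteq> S \<Longrightarrow> foldr act w x = act (val w) x"
  by (induction w) (auto simp: act_one act_mult S_carrier val_closed)

text \<open>A finite order of at least 2 keeps the angle strictly between 0 and pi, so the squared
  cosine is below 1.\<close>

lemma cartan_det:
  assumes "s \<in> S" "t \<in> S" "s \<noteq> t" shows "cartan s t * cartan t s < 4"
proof (cases "ord (s \<otimes> t) = 2")
  case True
  then show ?thesis using cartan_ord_2[OF assms] by simp
next
  case False
  define \<theta> where "\<theta> = pi / real (ord (s \<otimes> t))"
  have "ord (s \<otimes> t) \<ge> 2" using ord_ge_2[OF assms] .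
  then have "0 < \<theta>" "\<theta> < pi" by (auto simp: \<theta>_def divide_less_eq)
  then have "sin \<theta> > 0" by (rule sin_gt_zero)
  then have "(cos \<theta>)\<^sup>2 < 1" using sin_cos_squared_add[of \<theta>] by (smt (verit) zero_less_power)
  then show ?thesis using cartan_prod[OF assms False] by (simp add: \<theta>_def)
qed

text \<open>\<open>W\<close> acts by the Cartan matrix on the free space with basis \<open>S\<close>. The relators act trivially there
  because they do so in \<open>V\<close> and any two coroots are independent on the span of their roots.\<close>

definition free_act :: "'w \<Rightarrow> ('w \<Rightarrow> real) \<Rightarrow> 'w \<Rightarrow> real" where
  "free_act s x = x(s := x s - (\<Sum>t\<in>S. cartan s t * x t))"

definition pairing :: "'w \<Rightarrow> ('w \<Rightarrow> real) \<Rightarrow> real" where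
  "pairing s x = (\<Sum>t\<in>S. cartan s t * x t)"

lemma pairing_update: "t \<in> S \<Longrightarrow> pairing s (x(t := x t + p)) = pairing s x + cartan s t * p"
proof -
  assume t: "t \<in> S"
  have "pairing s (x(t := x t + p)) = (\<Sum>u\<in>S. cartan s u * x u + (if u = t then cartan s t * p else 0))"
    unfolding pairing_def by (intro sum.cong) (auto simp: algebra_simps)
  also have "\<dots> = pairing s x + cartan s t * p"
    using t finite_S by (simp add: sum.distrib pairing_def)
  finally show ?thesis .
qed

lemma free_act_eq: "free_act s x = x(s := x s + (- pairing s x))"
  by (simp add: free_act_def pairing_def)

lemma free_act_involution: "s \<in> S \<Longrightarrow> free_act s (free_act s x) = x"
  using pairing_update[of s s x "- pairing s x"] unfolding free_act_eq by (simp add: cartan_diag)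

lemma free_act_relator:
  assumes s: "s \<in> S" and t: "t \<in> S"
  shows "foldr free_act (concat (replicate (ord (s \<otimes> t)) [s, t])) x = x"
proof (cases "s = t")
  case True
  then have "ord (s \<otimes> t) = 1" using s ord_eq_1[of \<one>] S_square by simp
  then show ?thesis using True s by (simp add: free_act_involution)
next
  case False
  define P Q where "P = pairing s x" and "Q = pairing t x"
  define D where "D = 4 - cartan s t * cartan t s"
  have D: "D > 0" using cartan_det[OF s t False] by (simp add: D_def)
  \<comment> \<open>Cramer's rule: the combination of the two roots on which the coroots of
    \<open>s\<close> and \<open>t\<close> take the same values \<open>P\<close> and \<open>Q\<close>
    as the pairings of \<open>x\<close>.\<close>
  define v where "v = ((2 * P - cartan s t * Q) / D) *\<^sub>R root s + ((2 * Q - cartan t s * P) / D) *\<^sub>R root t"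
  have vs: "coroot s v = P" and vt: "coroot t v = Q"
  proof -
    have "D * coroot s v = (2 * P - cartan s t * Q) * 2 + (2 * Q - cartan t s * P) * cartan s t"
      using s D cartan_diag[OF s] by (simp add: v_def coroot_simps cartan_def field_simps)
    also have "\<dots> = D * P" by (simp add: D_def algebra_simps)
    finally show "coroot s v = P" using D by simp
    have "D * coroot t v = (2 * P - cartan s t * Q) * cartan t s + (2 * Q - cartan t s * P) * 2"
      using t D cartan_diag[OF t] by (simp add: v_def coroot_simps cartan_def field_simps)
    also have "\<dots> = D * Q" by (simp add: D_def algebra_simps)
    finally show "coroot t v = Q" using D by simp
  qed
  \<comment> \<open>The letters see only these two values, so the same coefficients describe the
    motion of \<open>x\<close> and of \<open>v\<close>. For \<open>v\<close> the relator is the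
    identity, because \<open>W\<close> acts on the vector space.\<close>
  have par: "\<exists>p q. foldr free_act (concat (replicate k [s, t])) x = x(s := x s + p, t := x t + q) \<and>
      foldr act (concat (replicate k [s, t])) v = v + p *\<^sub>R root s + q *\<^sub>R root t" for k
  proof (induction k)
    case 0 then show ?case by (intro exI[of _ 0]) auto
  next
    case (Suc k)
    then obtain p q where x: "foldr free_act (concat (replicate k [s, t])) x = x(s := x s + p, t := x t + q)"
      and v: "foldr act (concat (replicate k [s, t])) v = v + p *\<^sub>R root s + q *\<^sub>R root t" by blast
    have pr: "pairing u (x(s := x s + p, t := x t + q)) = pairing u x + cartan u s * p + cartan u t * q" for u p q
      using pairing_update[OF t, of u "x(s := x s + p)" q] pairing_update[OF s, of u x p] False by simp
    have cr: "coroot u (v + p *\<^sub>R root s + q *\<^sub>R root t) = coroot u v + cartan u s * p + cartan u t * q" if "u \<in> S" for u p q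
      using that by (simp add: coroot_simps cartan_def)
    define q' where "q' = q - (Q + cartan t s * p + cartan t t * q)"
    define p' where "p' = p - (P + cartan s s * p + cartan s t * q')"
    have "free_act t (x(s := x s + p, t := x t + q)) = x(s := x s + p, t := x t + q')"
      unfolding free_act_eq pr by (simp add: q'_def Q_def algebra_simps)
    moreover have "free_act s (x(s := x s + p, t := x t + q')) = x(s := x s + p', t := x t + q')"
      unfolding free_act_eq pr using False by (simp add: p'_def P_def fun_upd_twist algebra_simps)
    moreover have "act t (v + p *\<^sub>R root s + q *\<^sub>R root t) = v + p *\<^sub>R root s + q' *\<^sub>R root t"
      unfolding act_S[OF t] cr[OF t] vt by (simp add: q'_def algebra_simps)
    moreover have "act s (v + p *\<^sub>R root s + q' *\<^sub>R root t) = v + p' *\<^sub>R root s + q' *\<^sub>R root t"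
      unfolding act_S[OF s] cr[OF s] vs by (simp add: p'_def algebra_simps)
    ultimately have "foldr free_act (concat (replicate (Suc k) [s, t])) x = x(s := x s + p', t := x t + q') \<and>
      foldr act (concat (replicate (Suc k) [s, t])) v = v + p' *\<^sub>R root s + q' *\<^sub>R root t"
      using x v by simp
    then show ?case by blast
  qed
  define w where "w = concat (replicate (ord (s \<otimes> t)) [s, t])"
  obtain p q where x: "foldr free_act w x = x(s := x s + p, t := x t + q)"
    and v: "foldr act w v = v + p *\<^sub>R root s + q *\<^sub>R root t" unfolding w_def using par by blast
  have "val (concat (replicate k [s, t])) = (s \<otimes> t) [^] k" for k
    using s t S_carrier nat_pow_Suc2[of "s \<otimes> t"] by (induction k) (auto simp: m_assoc simp del: nat_pow_Suc)
  then have "val w = \<one>" using s t S_carrier pow_ord_eq_1[of "s \<otimes> t"] by (simp add: w_def)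
  moreover have "set w \<subseteq> S" using s t by (auto simp: w_def)
  ultimately have "foldr act w v = v" by (simp add: foldr_act act_one)
  then have z: "p *\<^sub>R root s + q *\<^sub>R root t = 0" using v by (simp add: add.assoc)
  have "2 * p + cartan s t * q = 0" "cartan t s * p + 2 * q = 0"
    using arg_cong[OF z, of "coroot s"] arg_cong[OF z, of "coroot t"] s t cartan_diag[OF s] cartan_diag[OF t]
    by (simp_all add: coroot_simps cartan_def mult.commute)
  then have "p = 0" "q = 0" using cartan_det[OF s t False] by (rule det2_zero)+
  then show ?thesis using x unfolding w_def by simp
qed

text \<open>Sum the images under all of \<open>W\<close>. A basis vector is negated by its own
  reflection, so its sum vanishes; a kernel vector is fixed by all reflections, so its sum is
  \<open>card (carrier W)\<close> times itself. By linearity the kernel vector is zero.\<close>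

theorem cartan_inj:
  assumes "\<And>s. s \<in> S \<Longrightarrow> (\<Sum>t\<in>S. c t * cartan s t) = 0" and s: "s \<in> S"
  shows "c s = 0"
proof -
  define word where "word g = (SOME w. set w \<subseteq> S \<and> val w = g)" for g
  have word: "set (word g) \<subseteq> S" "val (word g) = g" if "g \<in> carrier W" for g
    using someI_ex[OF val_surj[OF that]] by (auto simp: word_def)
  define T where "T g = foldr free_act (word g)" for g
  define avg where "avg x t = (\<Sum>g\<in>carrier W. T g x t)" for x t
  define e where "e s t = (if t = s then 1 else 0 :: real)" for s t :: 'w
  have lin: "foldr free_act w (\<lambda>t. \<Sum>i\<in>A. k i * X i t) = (\<lambda>t. \<Sum>i\<in>A. k i * foldr free_act w (X i) t)"
    for w k X and A :: "'w set"
  proof (induction w)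
    case (Cons u w)
    have "pairing u (\<lambda>t. \<Sum>i\<in>A. k i * Y i t) = (\<Sum>i\<in>A. k i * pairing u (Y i))" for Y
      unfolding pairing_def sum_distrib_left by (subst sum.swap) (simp add: mult.left_commute)
    then have "free_act u (\<lambda>t. \<Sum>i\<in>A. k i * Y i t) = (\<lambda>t. \<Sum>i\<in>A. k i * free_act u (Y i) t)" for Y
      by (auto simp: free_act_eq fun_eq_iff right_diff_distrib sum_subtractf)
    then show ?case using Cons by simp
  qed simp
  have neg: "foldr free_act w (\<lambda>t. - x t) = (\<lambda>t. - foldr free_act w x t)" for w x
    using lin[where w = w and A = "{undefined}" and k = "\<lambda>_. -1" and X = "\<lambda>_. x"] by simp
  have shift: "avg (free_act u x) t = avg x t" if u: "u \<in> S" for u x t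
  proof -
    have "T g (free_act u x) = T (g \<otimes> u) x" if g: "g \<in> carrier W" for g
    proof -
      have "foldr free_act (word g @ [u]) x = foldr free_act (word (g \<otimes> u)) x"
        using g u word S_carrier[OF u]
        by (intro foldr_cong_val[where D = UNIV]) (auto simp: free_act_involution free_act_relator val_append)
      then show ?thesis by (simp add: T_def)
    qed
    then have "avg (free_act u x) t = (\<Sum>g\<in>carrier W. T (g \<otimes> u) x t)" by (simp add: avg_def)
    also have "\<dots> = avg x t" unfolding avg_def
      using u S_carrier[OF u] by (intro sum.reindex_bij_witness[where i = "\<lambda>g. g \<otimes> u" and j = "\<lambda>g. g \<otimes> u"])
        (auto simp: S_cancel_right)
    finally show ?thesis .
  qed
  have e0: "avg (e u) t = 0" if u: "u \<in> S" for u t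
  proof -
    have "pairing u (e u) = 2" using u finite_S by (simp add: pairing_def e_def cartan_diag if_distrib cong: if_cong)
    then have "free_act u (e u) = (\<lambda>t. - e u t)" by (auto simp: free_act_eq e_def)
    then have "avg (e u) t = avg (\<lambda>t. - e u t) t" using shift[OF u, of "e u" t] by simp
    also have "\<dots> = - avg (e u) t" by (simp add: avg_def T_def neg sum_negf)
    finally show ?thesis by simp
  qed
  define c' where "c' t = (\<Sum>u\<in>S. c u * e u t)" for t
  have c': "c' t = (if t \<in> S then c t else 0)" for t using finite_S by (simp add: c'_def e_def if_distrib cong: if_cong)
  have "pairing u c' = 0" if "u \<in> S" for u
    using assms(1)[OF that] by (simp add: pairing_def c' mult.commute)
  then have "free_act u c' = c'" if "u \<in> S" for u using that by (simp add: free_act_eq)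
  then have "foldr free_act w c' = c'" if "set w \<subseteq> S" for w using that by (induction w) auto
  then have "avg c' s = real (card (carrier W)) * c' s" using word by (simp add: avg_def T_def)
  moreover have "avg c' s = (\<Sum>u\<in>S. c u * avg (e u) s)"
    unfolding avg_def T_def c'_def[abs_def] lin sum_distrib_left by (rule sum.swap)
  ultimately have "real (card (carrier W)) * c' s = 0" by (simp add: e0)
  moreover have "card (carrier W) \<noteq> 0" using finite_carrier one_closed by auto
  ultimately show ?thesis using s by (simp add: c')
qed

lemma roots_independent:
  assumes z: "(\<Sum>t\<in>S. c t *\<^sub>R root t) = 0" and "s \<in> S" shows "c s = 0"
proof (rule cartan_inj[OF _ assms(2)])
  fix u assume u: "u \<in> S"
  show "(\<Sum>t\<in>S. c t * cartan u t) = 0"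
    using arg_cong[OF z, of "coroot u"] u by (simp add: coroot_simps cartan_def)
qed

lemma roots_independent':
  assumes "(\<Sum>t\<in>S. c t *\<^sub>R root t) = (\<Sum>t\<in>S. d t *\<^sub>R root t)" and "s \<in> S" shows "c s = d s"
  using roots_independent[of "\<lambda>t. c t - d t" s] assms by (simp add: scaleR_diff_left sum_subtractf)

lemma root_nonzero: "s \<in> S \<Longrightarrow> root s \<noteq> 0"
  using cartan_diag[of s] coroot_simps(4)[of s] by (auto simp: cartan_def)

end

section \<open>Comparing crystals, and their tensor products, through words of operators\<close>

section \<open>Words of crystal operators\<close>

text \<open>The last letter acts first, and exponents may have either sign: every word then has a
  reverse (\<open>opw_rev_word\<close>), and f-words are the words with nonpositive exponents
  (\<open>f_orbit_iff\<close>).\<close>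

definition opw :: "('b, 's, 'v) crystal \<Rightarrow> ('s \<times> real) list \<Rightarrow> 'b \<Rightarrow> 'b option" where
  "opw B w b = foldr (\<lambda>(s, r). op_e B s r) w (Some b)"

lemma opw_simps [simp]:
  "opw B [] b = Some b" "opw B ((s, r) # w) b = op_e B s r (opw B w b)"
  by (auto simp: opw_def)

lemma
  assumes "is_crystal S \<alpha> \<alpha>v B"
  shows cr_None: "s \<in> S \<Longrightarrow> op_e B s r None = None"
    and cr_funcset: "s \<in> S \<Longrightarrow> op_e B s r \<in> ghosted B \<rightarrow> ghosted B"
    and cr_phi: "s \<in> S \<Longrightarrow> b \<in> carrier B \<Longrightarrow> phi B s b = eps B s b + ereal (\<alpha>v s (wt B b))"
    and cr_zero: "s \<in> S \<Longrightarrow> b \<in> carrier B \<Longrightarrow> op_e B s 0 (Some b) = Some b"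
    and cr_C2: "s \<in> S \<Longrightarrow> b \<in> carrier B \<Longrightarrow> op_e B s r (Some b) = Some c \<Longrightarrow>
        eps B s c = eps B s b - ereal r \<and> phi B s c = phi B s b + ereal r \<and> wt B c = wt B b + r *\<^sub>R \<alpha> s"
    and cr_add': "s \<in> S \<Longrightarrow> b \<in> carrier B \<Longrightarrow> op_e B s r (Some b) \<noteq> None \<Longrightarrow>
        op_e B s (q + r) (Some b) = op_e B s q (op_e B s r (Some b))"
proof -
  note c = assms[unfolded is_crystal_def]
  show "s \<in> S \<Longrightarrow> op_e B s r None = None"
    by (rule c[THEN conjunct2, THEN conjunct2, THEN conjunct2, THEN conjunct2, THEN conjunct1, rule_format])
  show "s \<in> S \<Longrightarrow> op_e B s r \<in> ghosted B \<rightarrow> ghosted B"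
    by (rule c[THEN conjunct1, rule_format])
  show "s \<in> S \<Longrightarrow> b \<in> carrier B \<Longrightarrow> phi B s b = eps B s b + ereal (\<alpha>v s (wt B b))"
    by (rule c[THEN conjunct2, THEN conjunct2, THEN conjunct1, rule_format])
  show "s \<in> S \<Longrightarrow> b \<in> carrier B \<Longrightarrow> op_e B s 0 (Some b) = Some b"
    by (rule c[THEN conjunct2, THEN conjunct2, THEN conjunct2, THEN conjunct2, THEN conjunct2, THEN conjunct1, rule_format])
  show "s \<in> S \<Longrightarrow> b \<in> carrier B \<Longrightarrow> op_e B s r (Some b) = Some c \<Longrightarrow>
        eps B s c = eps B s b - ereal r \<and> phi B s c = phi B s b + ereal r \<and> wt B c = wt B b + r *\<^sub>R \<alpha> s"
    by (rule c[THEN conjunct2, THEN conjunct2, THEN conjunct2, THEN conjunct1, rule_format])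
  show "s \<in> S \<Longrightarrow> b \<in> carrier B \<Longrightarrow> op_e B s r (Some b) \<noteq> None \<Longrightarrow>
        op_e B s (q + r) (Some b) = op_e B s q (op_e B s r (Some b))"
    by (rule c[THEN conjunct2, THEN conjunct2, THEN conjunct2, THEN conjunct2, THEN conjunct2, THEN conjunct2, THEN conjunct1, rule_format])
qed

lemma cr_closed:
  assumes "is_crystal S \<alpha> \<alpha>v B" "s \<in> S" "b \<in> carrier B" "op_e B s r (Some b) = Some c"
  shows "c \<in> carrier B"
  using funcset_mem[OF cr_funcset[OF assms(1,2), of r], of "Some b"] assms by (auto simp: ghosted_def)

lemma cr_wt:
  assumes "is_crystal S \<alpha> \<alpha>v B" "s \<in> S" "b \<in> carrier B" "op_e B s r (Some b) = Some c"
  shows "wt B c = wt B b + r *\<^sub>R \<alpha> s"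
  using cr_C2[OF assms] by blast

lemma cr_add:
  assumes "is_crystal S \<alpha> \<alpha>v B" "s \<in> S" "b \<in> carrier B" "op_e B s r (Some b) = Some c"
  shows "op_e B s q (Some c) = op_e B s (q + r) (Some b)"
  using cr_add'[OF assms(1-3), of r q] assms(4) by simp

lemma cr_inverse:
  assumes "is_crystal S \<alpha> \<alpha>v B" "s \<in> S" "b \<in> carrier B" "op_e B s r (Some b) = Some c"
  shows "op_e B s (- r) (Some c) = Some b"
  using cr_add[OF assms, of "- r"] cr_zero[OF assms(1-3)] by simp

lemma opw_carrier:
  assumes "is_crystal S \<alpha> \<alpha>v B" "b \<in> carrier B"
  shows "fst ` set w \<subseteq> S \<Longrightarrow> opw B w b = Some c \<Longrightarrow> c \<in> carrier B"
proof (induction w arbitrary: c)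
  case (Cons x w)
  obtain s r where x: "x = (s, r)" by (cases x)
  have s: "s \<in> S" using Cons.prems x by auto
  obtain d where d: "opw B w b = Some d"
    using Cons.prems(2) cr_None[OF assms(1) s] x by (cases "opw B w b") auto
  then have "d \<in> carrier B" using Cons by auto
  then show ?case using cr_closed[OF assms(1) s] Cons.prems(2) x d by auto
qed (use assms in auto)

lemma opw_append:
  assumes "opw B v b = Some c"
  shows "opw B (u @ v) b = opw B u c"
  using assms by (simp add: opw_def)

definition rev_word :: "('s \<times> real) list \<Rightarrow> ('s \<times> real) list" where
  "rev_word w = rev (map (\<lambda>(s, r). (s, - r)) w)"

lemma rev_word_rev_word [simp]: "rev_word (rev_word w) = w"
  by (induction w) (auto simp: rev_word_def)

lemma set_rev_word [simp]: "fst ` set (rev_word w) = fst ` set w"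
  by (force simp: rev_word_def image_iff)

lemma opw_rev_word:
  assumes "is_crystal S \<alpha> \<alpha>v B" "b \<in> carrier B"
  shows "fst ` set w \<subseteq> S \<Longrightarrow> opw B w b = Some c \<Longrightarrow> opw B (rev_word w) c = Some b"
proof (induction w arbitrary: c)
  case Nil then show ?case by (simp add: rev_word_def)
next
  case (Cons x w)
  obtain s r where x: "x = (s, r)" by (cases x)
  have s: "s \<in> S" using Cons.prems x by auto
  obtain d where d: "opw B w b = Some d"
    using Cons.prems(2) cr_None[OF assms(1) s] x by (cases "opw B w b") auto
  have dc: "d \<in> carrier B" using opw_carrier[OF assms _ d] Cons.prems by auto
  have "op_e B s (- r) (Some c) = Some d"
    using cr_inverse[OF assms(1) s dc] Cons.prems(2) x d by simp
  then have "opw B (rev_word w @ [(s, - r)]) c = opw B (rev_word w) d" by (intro opw_append) simp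
  then show ?case using Cons.IH[OF _ d] Cons.prems(1) x by (simp add: rev_word_def)
qed

definition word_coeff :: "('s \<times> real) list \<Rightarrow> 's \<Rightarrow> real" where
  "word_coeff w t = (\<Sum>(s, r)\<leftarrow>w. if s = t then r else 0)"

lemma word_coeff_simps [simp]:
  "word_coeff [] t = 0" "word_coeff ((s, r) # w) t = (if s = t then r else 0) + word_coeff w t"
  by (auto simp: word_coeff_def)

lemma opw_wt:
  assumes "is_crystal S \<alpha> \<alpha>v B" "b \<in> carrier B" "finite S"
  shows "fst ` set w \<subseteq> S \<Longrightarrow> opw B w b = Some c \<Longrightarrow> wt B c = wt B b + (\<Sum>t\<in>S. word_coeff w t *\<^sub>R \<alpha> t)"
proof (induction w arbitrary: c)
  case (Cons x w)
  obtain s r where x: "x = (s, r)" by (cases x)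
  have s: "s \<in> S" using Cons.prems x by auto
  obtain d where d: "opw B w b = Some d"
    using Cons.prems(2) cr_None[OF assms(1) s] x by (cases "opw B w b") auto
  have dc: "d \<in> carrier B" using opw_carrier[OF assms(1,2) _ d] Cons.prems by auto
  have "wt B c = wt B d + r *\<^sub>R \<alpha> s" using cr_wt[OF assms(1) s dc] Cons.prems(2) x d by simp
  moreover have "(\<Sum>t\<in>S. word_coeff (x # w) t *\<^sub>R \<alpha> t) =
      (\<Sum>t\<in>S. if t = s then r *\<^sub>R \<alpha> s else 0) + (\<Sum>t\<in>S. word_coeff w t *\<^sub>R \<alpha> t)"
    unfolding sum.distrib[symmetric] by (intro sum.cong) (auto simp: x algebra_simps)
  ultimately show ?case using Cons.IH[OF _ d] Cons.prems(1) s assms(3) by (simp add: algebra_simps)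
qed simp

lemma f_orbit_iff:
  "c \<in> f_orbit S B b \<longleftrightarrow> (\<exists>w. fst ` set w \<subseteq> S \<and> (\<forall>x\<in>set w. snd x \<le> 0) \<and> opw B w b = Some c)"
proof -
  have eq: "foldr (\<lambda>(s, r). op_f B s r) w = foldr (\<lambda>(s, r). op_e B s r) (map (\<lambda>(s, r). (s, - r)) w)" for w
    by (induction w) (auto simp: op_f_def)
  show ?thesis
  proof
    assume "c \<in> f_orbit S B b"
    then obtain w where "w \<in> lists (S \<times> {0..})" "foldr (\<lambda>(s, r). op_f B s r) w (Some b) = Some c"
      by (auto simp: f_orbit_def)
    then show "\<exists>w. fst ` set w \<subseteq> S \<and> (\<forall>x\<in>set w. snd x \<le> 0) \<and> opw B w b = Some c"
      unfolding eq opw_def by (intro exI[of _ "map (\<lambda>(s, r). (s, - r)) w"]) (auto 4 3)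
  next
    assume "\<exists>w. fst ` set w \<subseteq> S \<and> (\<forall>x\<in>set w. snd x \<le> 0) \<and> opw B w b = Some c"
    then obtain w where w: "fst ` set w \<subseteq> S" "\<forall>x\<in>set w. snd x \<le> 0" "opw B w b = Some c" by blast
    have "map (\<lambda>(s, r). (s, - r)) (map (\<lambda>(s, r). (s, - r)) w) = w" by (induction w) auto
    then have "foldr (\<lambda>(s, r). op_f B s r) (map (\<lambda>(s, r). (s, - r)) w) (Some b) = Some c"
      using w(3) unfolding eq by (simp add: opw_def)
    moreover have "map (\<lambda>(s, r). (s, - r)) w \<in> lists (S \<times> {0..})" using w(1,2) by fastforce
    ultimately show "c \<in> f_orbit S B b" unfolding f_orbit_def by blast
  qed
qed

lemma f_orbit_refl: "b \<in> f_orbit S B b"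
  unfolding f_orbit_iff by (rule exI[of _ "[]"]) simp

lemma f_orbit_subset:
  assumes "is_crystal S \<alpha> \<alpha>v B" "b \<in> carrier B" shows "f_orbit S B b \<subseteq> carrier B"
  unfolding f_orbit_iff subset_iff using opw_carrier[OF assms] by blast

section \<open>Crystals with the same words\<close>

definition same_data :: "'s set \<Rightarrow> ('b, 's, 'v) crystal \<Rightarrow> ('c, 's, 'v) crystal \<Rightarrow> 'b \<Rightarrow> 'c \<Rightarrow> bool" where
  "same_data S B B' c c' \<longleftrightarrow>
     wt B c = wt B' c' \<and> (\<forall>s\<in>S. eps B s c = eps B' s c' \<and> phi B s c = phi B' s c')"

text \<open>Elements are compared through the words that reach them, so no map between carriers has
  to be chosen. For generated crystals whose top weight occurs once this suffices for an isomorphism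
  (\<open>sim_iso\<close>).\<close>

definition crystal_sim :: "'s set \<Rightarrow> ('b, 's, 'v) crystal \<Rightarrow> 'b \<Rightarrow> ('c, 's, 'v) crystal \<Rightarrow> 'c \<Rightarrow> bool" where
  "crystal_sim S B b B' b' \<longleftrightarrow>
     (\<forall>w. fst ` set w \<subseteq> S \<longrightarrow> rel_option (same_data S B B') (opw B w b) (opw B' w b'))"

lemma crystal_simD:
  assumes "crystal_sim S B b B' b'" "fst ` set w \<subseteq> S" "opw B w b = Some c"
  shows "\<exists>c'. opw B' w b' = Some c' \<and> same_data S B B' c c'"
  using assms unfolding crystal_sim_def by (cases "opw B' w b'") (fastforce dest: spec[of _ w])+

lemma crystal_sim_sym: "crystal_sim S B b B' b' \<Longrightarrow> crystal_sim S B' b' B b"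
proof -
  have *: "same_data S B' B = (same_data S B B')\<inverse>\<inverse>" by (auto simp: same_data_def fun_eq_iff)
  show "crystal_sim S B b B' b' \<Longrightarrow> crystal_sim S B' b' B b"
    unfolding crystal_sim_def * option.rel_flip conversep_iff by simp
qed

lemma iso_sim:
  assumes c: "is_crystal S \<alpha> \<alpha>v B" "is_crystal S \<alpha> \<alpha>v B'" and iso: "crystal_iso S B B'" and b: "b \<in> carrier B"
  shows "\<exists>b'\<in>carrier B'. crystal_sim S B b B' b'"
proof -
  obtain \<psi> \<psi>' where m: "crystal_morphism S B B' \<psi>" "crystal_morphism S B' B \<psi>'"
    and inv: "\<forall>x\<in>ghosted B. \<psi>' (\<psi> x) = x" "\<forall>y\<in>ghosted B'. \<psi> (\<psi>' y) = y"
    using iso by (auto simp: crystal_iso_def)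
  have img: "\<exists>d\<in>carrier B'. \<psi> (Some c) = Some d \<and> \<psi>' (Some d) = Some c \<and> same_data S B B' c d" if "c \<in> carrier B" for c
  proof -
    have "Some c \<in> ghosted B" using that by (simp add: ghosted_def)
    then have "\<psi> (Some c) \<in> ghosted B'" "\<psi>' (\<psi> (Some c)) = Some c" using m(1) inv by (auto simp: crystal_morphism_def)
    moreover have "\<psi>' None = None" using m(2) by (simp add: crystal_morphism_def)
    ultimately obtain d where "d \<in> carrier B'" "\<psi> (Some c) = Some d" "\<psi>' (Some d) = Some c"
      by (auto simp: ghosted_def)
    moreover from this have "same_data S B B' c d"
      using m(1) that by (auto simp: crystal_morphism_def same_data_def)
    ultimately show ?thesis by blast
  qed
  have op: "op_e B' s r (Some d) = \<psi> (op_e B s r (Some c))"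
    if s: "s \<in> S" and cd: "c \<in> carrier B" "d \<in> carrier B'" "\<psi> (Some c) = Some d" "\<psi>' (Some d) = Some c" for s r c d
  proof (cases "op_e B s r (Some c)")
    case (Some e)
    then have "op_e B s r (Some c) \<in> Some ` carrier B" using cr_closed[OF c(1) s cd(1)] by auto
    then show ?thesis using m(1) s cd unfolding crystal_morphism_def by metis
  next
    case None
    show ?thesis
    proof (cases "op_e B' s r (Some d)")
      case n: None
      then show ?thesis using None m(1) by (simp add: crystal_morphism_def)
    next
      \<comment> \<open>A morphism commutes with an operator only where the operator does not vanish
        in the source. That vanishing in the source forces vanishing in the target follows from the
        inverse morphism.\<close>
      case (Some f)
      then have fc: "f \<in> carrier B'" using cr_closed[OF c(2) s cd(2)] by auto
      then have "op_e B s r (\<psi>' (Some d)) = \<psi>' (op_e B' s r (Some d))"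
        using m(2) s cd Some unfolding crystal_morphism_def by (metis imageI)
      then have "\<psi>' (Some f) = None" using cd Some None by simp
      moreover have "\<psi> (\<psi>' (Some f)) = Some f" using inv fc by (auto simp: ghosted_def)
      ultimately show ?thesis using m(1) by (simp add: crystal_morphism_def)
    qed
  qed
  obtain b' where b': "b' \<in> carrier B'" "\<psi> (Some b) = Some b'" "\<psi>' (Some b') = Some b" using img[OF b] by auto
  have "opw B' w b' = \<psi> (opw B w b)" if "fst ` set w \<subseteq> S" for w
    using that
  proof (induction w)
    case (Cons x w)
    obtain s r where x: "x = (s, r)" by (cases x)
    have s: "s \<in> S" and w: "fst ` set w \<subseteq> S" using Cons.prems x by auto
    show ?case
    proof (cases "opw B w b")
      case None
      then show ?thesis using Cons.IH[OF w] m(1) cr_None[OF c(1) s] cr_None[OF c(2) s] x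
        by (simp add: crystal_morphism_def)
    next
      case (Some e)
      then have ec: "e \<in> carrier B" using opw_carrier[OF c(1) b w] by blast
      obtain d where d: "d \<in> carrier B'" "\<psi> (Some e) = Some d" "\<psi>' (Some d) = Some e" using img[OF ec] by auto
      show ?thesis using op[OF s ec d, of r] Cons.IH[OF w] Some d x by simp
    qed
  qed (use b' in simp)
  note eq = this
  have "crystal_sim S B b B' b'"
    unfolding crystal_sim_def
  proof (intro allI impI)
    fix w :: "(_ \<times> real) list" assume w: "fst ` set w \<subseteq> S"
    show "rel_option (same_data S B B') (opw B w b) (opw B' w b')"
    proof (cases "opw B w b")
      case None
      then show ?thesis using eq[OF w] m(1) by (simp add: crystal_morphism_def)
    next
      case (Some e)
      then show ?thesis using img[OF opw_carrier[OF c(1) b w Some]] eq[OF w] by auto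
    qed
  qed
  then show ?thesis using b' by blast
qed

text \<open>The word \<open>w\<close> followed by the reverse of \<open>v\<close> returns to
  \<open>b\<close>. In \<open>B'\<close> the same operators lead from \<open>b'\<close> to an
  element of the same weight, which can only be \<open>b'\<close>.\<close>

lemma sim_iso_map:
  assumes c: "is_crystal S \<alpha> \<alpha>v B" "is_crystal S \<alpha> \<alpha>v B'"
    and b: "b \<in> carrier B" "b' \<in> carrier B'"
    and u: "\<And>c. c \<in> carrier B' \<Longrightarrow> wt B' c = wt B' b' \<Longrightarrow> c = b'"
    and sim: "crystal_sim S B b B' b'"
    and w: "fst ` set w \<subseteq> S" "fst ` set v \<subseteq> S" "opw B w b = Some d" "opw B v b = Some d"
  shows "opw B' w b' = opw B' v b'"
proof -
  obtain dw where dw: "opw B' w b' = Some dw" using crystal_simD[OF sim w(1,3)] by auto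
  have dwc: "dw \<in> carrier B'" using opw_carrier[OF c(2) b(2) w(1) dw] .
  have "opw B (rev_word v @ w) b = Some b"
    using opw_append[OF w(3)] opw_rev_word[OF c(1) b(1) w(2,4)] by simp
  then obtain e where e: "opw B' (rev_word v @ w) b' = Some e" "same_data S B B' b e"
    using crystal_simD[OF sim, of "rev_word v @ w" b] w by (auto simp: image_Un)
  have "same_data S B B' b b'" using crystal_simD[OF sim, of "[]" b] by simp
  then have "wt B' e = wt B' b'" using e(2) by (simp add: same_data_def)
  moreover have "e \<in> carrier B'" using opw_carrier[OF c(2) b(2) _ e(1)] w by (simp add: image_Un)
  ultimately have "opw B' (rev_word v) dw = Some b'" using e(1) opw_append[OF dw] u by simp
  then have "opw B' v b' = Some dw" using opw_rev_word[OF c(2) dwc, of "rev_word v" b'] w(2) by simp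
  then show ?thesis using dw by simp
qed

lemma sim_morphism:
  assumes c: "is_crystal S \<alpha> \<alpha>v B" "is_crystal S \<alpha> \<alpha>v B'"
    and b: "b \<in> carrier B" "b' \<in> carrier B'"
    and gen: "carrier B = f_orbit S B b"
    and u: "\<And>c. c \<in> carrier B' \<Longrightarrow> wt B' c = wt B' b' \<Longrightarrow> c = b'"
    and sim: "crystal_sim S B b B' b'"
  shows "\<exists>\<psi>. crystal_morphism S B B' \<psi> \<and>
    (\<forall>w d. fst ` set w \<subseteq> S \<longrightarrow> opw B w b = Some d \<longrightarrow> \<psi> (Some d) = opw B' w b')"
proof -
  define word where "word d = (SOME w. fst ` set w \<subseteq> S \<and> opw B w b = Some d)" for d
  have word: "fst ` set (word d) \<subseteq> S" "opw B (word d) b = Some d" if "d \<in> carrier B" for d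
  proof -
    have "\<exists>w. fst ` set w \<subseteq> S \<and> opw B w b = Some d" using that unfolding gen f_orbit_iff by blast
    from someI_ex[OF this] show "fst ` set (word d) \<subseteq> S" "opw B (word d) b = Some d" by (auto simp: word_def)
  qed
  define \<psi> where "\<psi> x = (case x of None \<Rightarrow> None | Some d \<Rightarrow> opw B' (word d) b')" for x
  have psi: "\<psi> (Some d) = opw B' w b'" if w: "fst ` set w \<subseteq> S" "opw B w b = Some d" for w d
  proof -
    have "d \<in> carrier B" using opw_carrier[OF c(1) b(1) w] .
    then show ?thesis using sim_iso_map[OF c b u sim _ w(1) _ w(2)] word by (simp add: \<psi>_def)
  qed
  have "crystal_morphism S B B' \<psi>"
    unfolding crystal_morphism_def
  proof (intro conjI ballI allI impI)
    show "\<psi> \<in> ghosted B \<rightarrow> ghosted B'"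
    proof
      fix x assume "x \<in> ghosted B"
      show "\<psi> x \<in> ghosted B'"
      proof (cases x)
        case (Some d)
        then have "d \<in> carrier B" using \<open>x \<in> ghosted B\<close> by (auto simp: ghosted_def)
        then have "opw B' (word d) b' = Some e \<Longrightarrow> e \<in> carrier B'" for e
          using opw_carrier[OF c(2) b(2) word(1)] by blast
        then show ?thesis using Some by (cases "opw B' (word d) b'") (auto simp: ghosted_def \<psi>_def)
      qed (simp add: ghosted_def \<psi>_def)
    qed
    show "\<psi> None = None" by (simp add: \<psi>_def)
    fix d assume d: "d \<in> carrier B"
    {
      fix e assume e: "\<psi> (Some d) = Some e"
      have "same_data S B B' d e" using crystal_simD[OF sim word[OF d]] e by (auto simp: \<psi>_def)
      then show "wt B' e = wt B d" "\<And>s. s \<in> S \<Longrightarrow> eps B' s e = eps B s d" "\<And>s. s \<in> S \<Longrightarrow> phi B' s e = phi B s d"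
        by (auto simp: same_data_def)
    }
    fix s r assume s: "s \<in> S" and op: "op_e B s r (Some d) \<in> Some ` carrier B"
    then obtain e where e: "op_e B s r (Some d) = Some e" by auto
    have "\<psi> (Some e) = opw B' ((s, r) # word d) b'" using s word[OF d] e by (intro psi) auto
    then show "op_e B' s r (\<psi> (Some d)) = \<psi> (op_e B s r (Some d))" using e by (simp add: \<psi>_def)
  qed
  then show ?thesis using psi by blast
qed

lemma sim_iso:
  assumes c: "is_crystal S \<alpha> \<alpha>v B" "is_crystal S \<alpha> \<alpha>v B'"
    and b: "b \<in> carrier B" "b' \<in> carrier B'"
    and gen: "carrier B = f_orbit S B b" "carrier B' = f_orbit S B' b'"
    and u: "\<And>c. c \<in> carrier B \<Longrightarrow> wt B c = wt B b \<Longrightarrow> c = b"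
    and u': "\<And>c. c \<in> carrier B' \<Longrightarrow> wt B' c = wt B' b' \<Longrightarrow> c = b'"
    and sim: "crystal_sim S B b B' b'"
  shows "crystal_iso S B B'"
proof -
  note sim' = crystal_sim_sym[OF sim]
  obtain \<psi> where psi: "crystal_morphism S B B' \<psi>"
    "\<And>w d. fst ` set w \<subseteq> S \<Longrightarrow> opw B w b = Some d \<Longrightarrow> \<psi> (Some d) = opw B' w b'"
    using sim_morphism[OF c b gen(1) u' sim] by blast
  obtain \<psi>' where chi: "crystal_morphism S B' B \<psi>'"
    "\<And>w d. fst ` set w \<subseteq> S \<Longrightarrow> opw B' w b' = Some d \<Longrightarrow> \<psi>' (Some d) = opw B w b"
    using sim_morphism[OF c(2,1) b(2,1) gen(2) u sim'] by blast
  have N: "\<psi> None = None" "\<psi>' None = None" using psi(1) chi(1) by (auto simp: crystal_morphism_def)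
  have 1: "\<psi>' (\<psi> x) = x" if "x \<in> ghosted B" for x
  proof (cases x)
    case (Some d)
    then have "d \<in> f_orbit S B b" using that gen by (auto simp: ghosted_def)
    then obtain w where w: "fst ` set w \<subseteq> S" "opw B w b = Some d" unfolding f_orbit_iff by blast
    obtain d' where "opw B' w b' = Some d'" using crystal_simD[OF sim w] by blast
    then show ?thesis using psi(2)[OF w] chi(2)[OF w(1)] w(2) Some by simp
  qed (use N in simp)
  have 2: "\<psi> (\<psi>' x) = x" if "x \<in> ghosted B'" for x
  proof (cases x)
    case (Some d)
    then have "d \<in> f_orbit S B' b'" using that gen by (auto simp: ghosted_def)
    then obtain w where w: "fst ` set w \<subseteq> S" "opw B' w b' = Some d" unfolding f_orbit_iff by blast
    obtain d' where "opw B w b = Some d'" using crystal_simD[OF sim' w] by blast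
    then show ?thesis using chi(2)[OF w] psi(2)[OF w(1)] w(2) Some by simp
  qed (use N in simp)
  show ?thesis unfolding crystal_iso_def using psi(1) chi(1) 1 2 by blast
qed

text \<open>Only vanishing has to be compared: weights are read off the word, \<open>eps\<close> is
  by normality the largest exponent that does not vanish, and \<open>phi\<close> differs from
  \<open>eps\<close> by a coroot of the weight.\<close>

lemma crystal_simI_normal:
  assumes c: "is_crystal S \<alpha> \<alpha>v B" "is_crystal S \<alpha> \<alpha>v B'" and n: "normal_crystal S B" "normal_crystal S B'"
    and fin: "finite S" and b: "b \<in> carrier B" "b' \<in> carrier B'" "wt B b = wt B' b'"
    and ne: "\<And>w. fst ` set w \<subseteq> S \<Longrightarrow> opw B w b = None \<longleftrightarrow> opw B' w b' = None"
  shows "crystal_sim S B b B' b'"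
  unfolding crystal_sim_def
proof (intro allI impI)
  fix w :: "('a \<times> real) list" assume w: "fst ` set w \<subseteq> S"
  show "rel_option (same_data S B B') (opw B w b) (opw B' w b')"
  proof (cases "opw B w b")
    case None
    then show ?thesis using ne[OF w] by simp
  next
    case (Some d)
    then obtain d' where d': "opw B' w b' = Some d'" using ne[OF w] by auto
    have dc: "d \<in> carrier B" "d' \<in> carrier B'" using opw_carrier[OF c(1) b(1) w Some] opw_carrier[OF c(2) b(2) w d'] .
    have wt: "wt B d = wt B' d'"
      using opw_wt[OF c(1) b(1) fin w Some] opw_wt[OF c(2) b(2) fin w d'] b(3) by simp
    have "op_e B s r (Some d) = None \<longleftrightarrow> op_e B' s r (Some d') = None" if "s \<in> S" for s r
      using ne[of "(s, r) # w"] that w Some d' by simp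
    then have "eps B s d = eps B' s d'" if "s \<in> S" for s
    proof -
      have "is_maximum {r. r \<ge> 0 \<and> op_e B s r (Some d) \<noteq> None} (eps B s d)"
        "is_maximum {r. r \<ge> 0 \<and> op_e B' s r (Some d') \<noteq> None} (eps B' s d')"
        using n dc that by (auto simp: normal_crystal_def)
      moreover have "{r. r \<ge> 0 \<and> op_e B s r (Some d) \<noteq> None} = {r. r \<ge> 0 \<and> op_e B' s r (Some d') \<noteq> None}"
        using \<open>\<And>s r. s \<in> S \<Longrightarrow> op_e B s r (Some d) = None \<longleftrightarrow> op_e B' s r (Some d') = None\<close> that by auto
      ultimately show ?thesis unfolding is_maximum_def by (metis order_antisym)
    qed
    then show ?thesis using Some d' wt cr_phi[OF c(1) _ dc(1)] cr_phi[OF c(2) _ dc(2)] by (simp add: same_data_def)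
  qed
qed

lemma normal_eps:
  assumes "normal_crystal S B" "s \<in> S" "b \<in> carrier B"
  shows "\<exists>x\<ge>0. eps B s b = ereal x \<and> op_e B s x (Some b) \<noteq> None \<and> (\<forall>r\<ge>0. op_e B s r (Some b) \<noteq> None \<longrightarrow> r \<le> x)"
    and "\<exists>x\<ge>0. phi B s b = ereal x \<and> op_e B s (- x) (Some b) \<noteq> None \<and> (\<forall>r\<ge>0. op_e B s (- r) (Some b) \<noteq> None \<longrightarrow> r \<le> x)"
proof -
  have "is_maximum {r. r \<ge> 0 \<and> op_e B s r (Some b) \<noteq> None} (eps B s b) \<and>
      is_maximum {r. r \<ge> 0 \<and> op_e B s (- r) (Some b) \<noteq> None} (phi B s b)"
    using assms unfolding normal_crystal_def by blast
  then show "\<exists>x\<ge>0. eps B s b = ereal x \<and> op_e B s x (Some b) \<noteq> None \<and> (\<forall>r\<ge>0. op_e B s r (Some b) \<noteq> None \<longrightarrow> r \<le> x)"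
    "\<exists>x\<ge>0. phi B s b = ereal x \<and> op_e B s (- x) (Some b) \<noteq> None \<and> (\<forall>r\<ge>0. op_e B s (- r) (Some b) \<noteq> None \<longrightarrow> r \<le> x)"
    unfolding is_maximum_def by auto
qed

section \<open>Tensor products\<close>

lemma tensor_simps:
  "carrier (tensor B1 B2) = carrier B1 \<times> carrier B2"
  "wt (tensor B1 B2) (b1, b2) = wt B1 b1 + wt B2 b2"
  "eps (tensor B1 B2) s (b1, b2) = eps B1 s b1 + ereal (max 0 (- tensor_sigma B1 B2 s b1 b2))"
  "phi (tensor B1 B2) s (b1, b2) = phi B2 s b2 + ereal (max 0 (tensor_sigma B1 B2 s b1 b2))"
  "op_e (tensor B1 B2) s r None = None"
  "op_e (tensor B1 B2) s r (Some (b1, b2)) =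
     tensor_opt (op_e B1 s (max r (- tensor_sigma B1 B2 s b1 b2) - max 0 (- tensor_sigma B1 B2 s b1 b2)) (Some b1))
                (op_e B2 s (min r (- tensor_sigma B1 B2 s b1 b2) + max 0 (tensor_sigma B1 B2 s b1 b2)) (Some b2))"
  by (auto simp: tensor_def tensor_e_def Let_def)

lemma tensor_opt_eq_Some: "tensor_opt x y = Some z \<longleftrightarrow> x = Some (fst z) \<and> y = Some (snd z)"
  by (cases "(x, y)" rule: tensor_opt.cases) auto

lemma tensor_opt_None [simp]: "tensor_opt None y = None" "tensor_opt x None = None"
  by (cases x; simp)+

text \<open>Stronger than sharing data: linked elements of similar crystals stay linked under all
  operators, as the induction for tensor products requires.\<close>

definition linked :: "'s set \<Rightarrow> ('b, 's, 'v) crystal \<Rightarrow> 'b \<Rightarrow> ('c, 's, 'v) crystal \<Rightarrow> 'c \<Rightarrow> 'b \<Rightarrow> 'c \<Rightarrow> bool" where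
  "linked S B b B' b' c c' \<longleftrightarrow> (\<exists>w. fst ` set w \<subseteq> S \<and> opw B w b = Some c \<and> opw B' w b' = Some c')"

lemma linked_same_data: "crystal_sim S B b B' b' \<Longrightarrow> linked S B b B' b' c c' \<Longrightarrow> same_data S B B' c c'"
  unfolding linked_def by (metis crystal_simD option.inject)

lemma linked_op:
  assumes "crystal_sim S B b B' b'" "linked S B b B' b' c c'" "s \<in> S"
  shows "rel_option (linked S B b B' b') (op_e B s r (Some c)) (op_e B' s r (Some c'))"
proof -
  obtain w where w: "fst ` set w \<subseteq> S" "opw B w b = Some c" "opw B' w b' = Some c'"
    using assms by (auto simp: linked_def)
  have w': "fst ` set ((s, r) # w) \<subseteq> S" using w assms(3) by auto
  have "rel_option (same_data S B B') (opw B ((s, r) # w) b) (opw B' ((s, r) # w) b')"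
    using assms(1) w' unfolding crystal_sim_def by blast
  moreover have "linked S B b B' b' d d'" if "opw B ((s, r) # w) b = Some d" "opw B' ((s, r) # w) b' = Some d'" for d d'
    using that w' unfolding linked_def by blast
  ultimately show ?thesis using w
    by (cases "op_e B s r (Some c)"; cases "op_e B' s r (Some c')") auto
qed

lemma rel_option_tensor_opt:
  "rel_option L1 x1 y1 \<Longrightarrow> rel_option L2 x2 y2 \<Longrightarrow>
    rel_option (rel_prod L1 L2) (tensor_opt x1 x2) (tensor_opt y1 y2)"
  by (cases x1; cases y1; cases x2; cases y2) auto

text \<open>How an operator is distributed over the two factors depends only on
  \<open>tensor_sigma\<close>, which linked pairs have in common.\<close>

lemma tensor_linked:
  assumes s1: "crystal_sim S B1 b1 B1' b1'" and s2: "crystal_sim S B2 b2 B2' b2'" and w: "fst ` set w \<subseteq> S"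
  shows "rel_option (rel_prod (linked S B1 b1 B1' b1') (linked S B2 b2 B2' b2'))
    (opw (tensor B1 B2) w (b1, b2)) (opw (tensor B1' B2') w (b1', b2'))"
  using w
proof (induction w)
  case Nil
  have "linked S B1 b1 B1' b1' b1 b1'" "linked S B2 b2 B2' b2' b2 b2'"
    unfolding linked_def by (rule exI[of _ "[]"], simp)+
  then show ?case by simp
next
  case (Cons x w)
  obtain s r where x: "x = (s, r)" by (cases x)
  have s: "s \<in> S" and w: "fst ` set w \<subseteq> S" using Cons.prems x by auto
  from Cons.IH[OF w] show ?case
  proof (cases rule: option.rel_cases)
    case None
    then show ?thesis by (simp add: x tensor_simps)
  next
    case (Some c c')
    obtain c1 c2 where cc: "c = (c1, c2)" by (cases c)
    obtain c1' c2' where cc': "c' = (c1', c2')" by (cases c')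
    have l1: "linked S B1 b1 B1' b1' c1 c1'" and l2: "linked S B2 b2 B2' b2' c2 c2'" using Some(3) cc cc' by auto
    have "tensor_sigma B1 B2 s c1 c2 = tensor_sigma B1' B2' s c1' c2'"
      using linked_same_data[OF s1 l1] linked_same_data[OF s2 l2] s by (simp add: same_data_def tensor_sigma_def)
    then show ?thesis
      using linked_op[OF s1 l1 s] linked_op[OF s2 l2 s]
      by (simp add: x Some cc cc' tensor_simps rel_option_tensor_opt)
  qed
qed

lemma assoc_amounts:
  fixes f1 e2 f2 e3 r :: real
  defines "s12 \<equiv> f1 - e2" and "s23 \<equiv> f2 - e3"
  defines "s \<equiv> f2 + max 0 s12 - e3" and "t \<equiv> f1 - (e2 + max 0 (- s23))"
  defines "p \<equiv> max r (- s) - max 0 (- s)" and "q \<equiv> min r (- t) + max 0 t"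
  shows "max p (- s12) - max 0 (- s12) = max r (- t) - max 0 (- t)"
    "min p (- s12) + max 0 s12 = max q (- s23) - max 0 (- s23)"
    "min r (- s) + max 0 s = min q (- s23) + max 0 s23"
proof -
  have s: "s = s23 + max 0 s12" and t: "t = s12 - max 0 (- s23)" by (simp_all add: assms(1-4))
  show "max p (- s12) - max 0 (- s12) = max r (- t) - max 0 (- t)"
    "min p (- s12) + max 0 s12 = max q (- s23) - max 0 (- s23)"
    "min r (- s) + max 0 s = min q (- s23) + max 0 s23"
    unfolding p_def q_def s t
    by (cases "s12 \<ge> 0"; cases "s23 \<ge> 0"; cases "s12 + s23 \<ge> 0"; simp add: max_def min_def)+
qed

definition reassoc :: "('a \<times> 'b) \<times> 'c \<Rightarrow> 'a \<times> 'b \<times> 'c" where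
  "reassoc = (\<lambda>((x, y), z). (x, (y, z)))"

lemma tensor_opt_assoc:
  "tensor_opt x (tensor_opt y z) = map_option reassoc (tensor_opt (tensor_opt x y) z)"
  by (cases x; cases y; cases z) (auto simp: reassoc_def)

text \<open>Both bracketings move the three factors by the same amounts
  (\<open>assoc_amounts\<close>). The statement is along words, in the form in which elements are
  compared throughout.\<close>

lemma tensor_assoc:
  assumes c: "is_crystal S \<alpha> \<alpha>v B1" "is_crystal S \<alpha> \<alpha>v B2" "is_crystal S \<alpha> \<alpha>v B3"
    and n: "normal_crystal S B1" "normal_crystal S B2" "normal_crystal S B3"
    and b: "b1 \<in> carrier B1" "b2 \<in> carrier B2" "b3 \<in> carrier B3" and w: "fst ` set w \<subseteq> S"
  shows "opw (tensor B1 (tensor B2 B3)) w (b1, b2, b3) =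
      map_option reassoc (opw (tensor (tensor B1 B2) B3) w ((b1, b2), b3)) \<and>
    (\<forall>d1 d2 d3. opw (tensor (tensor B1 B2) B3) w ((b1, b2), b3) = Some ((d1, d2), d3) \<longrightarrow>
      d1 \<in> carrier B1 \<and> d2 \<in> carrier B2 \<and> d3 \<in> carrier B3)"
  using w
proof (induction w)
  case Nil
  then show ?case using b by (simp add: reassoc_def)
next
  case (Cons x w)
  obtain s r where x: "x = (s, r)" by (cases x)
  have s: "s \<in> S" and w: "fst ` set w \<subseteq> S" using Cons.prems x by auto
  note IH = Cons.IH[OF w]
  show ?case
  proof (cases "opw (tensor (tensor B1 B2) B3) w ((b1, b2), b3)")
    case None
    then show ?thesis using IH by (simp add: x tensor_simps)
  next
    case (Some d)
    obtain d1 d2 d3 where d: "d = ((d1, d2), d3)" by (metis prod.exhaust)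
    have dc: "d1 \<in> carrier B1" "d2 \<in> carrier B2" "d3 \<in> carrier B3" using IH Some d by auto
    have R: "opw (tensor B1 (tensor B2 B3)) w (b1, b2, b3) = Some (d1, d2, d3)"
      using IH Some d by (simp add: reassoc_def)
    obtain f1 where f1: "phi B1 s d1 = ereal f1" using normal_eps(2)[OF n(1) s dc(1)] by blast
    obtain e2 where e2: "eps B2 s d2 = ereal e2" using normal_eps(1)[OF n(2) s dc(2)] by blast
    obtain f2 where f2: "phi B2 s d2 = ereal f2" using normal_eps(2)[OF n(2) s dc(2)] by blast
    obtain e3 where e3: "eps B3 s d3 = ereal e3" using normal_eps(1)[OF n(3) s dc(3)] by blast
    have sg12: "tensor_sigma B1 B2 s d1 d2 = f1 - e2" and sg23: "tensor_sigma B2 B3 s d2 d3 = f2 - e3"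
      by (simp_all add: tensor_sigma_def f1 e2 f2 e3)
    have sg: "tensor_sigma (tensor B1 B2) B3 s (d1, d2) d3 = f2 + max 0 (f1 - e2) - e3"
      "tensor_sigma B1 (tensor B2 B3) s d1 (d2, d3) = f1 - (e2 + max 0 (- (f2 - e3)))"
      unfolding tensor_sigma_def[of "tensor B1 B2"] tensor_sigma_def[of B1 "tensor B2 B3"]
      by (simp_all add: tensor_simps sg12 sg23 f1 e2 f2 e3 del: ereal_max)
    define P1 where "P1 = max r (- (f1 - (e2 + max 0 (- (f2 - e3))))) - max 0 (- (f1 - (e2 + max 0 (- (f2 - e3)))))"
    define P23 where "P23 = min r (- (f1 - (e2 + max 0 (- (f2 - e3))))) + max 0 (f1 - (e2 + max 0 (- (f2 - e3))))"
    define P2 where "P2 = max P23 (- (f2 - e3)) - max 0 (- (f2 - e3))"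
    define P3 where "P3 = min P23 (- (f2 - e3)) + max 0 (f2 - e3)"
    note Ps = assoc_amounts[of r f2 f1 e2 e3, folded P23_def, folded P1_def P2_def P3_def]
    have L: "op_e (tensor (tensor B1 B2) B3) s r (Some ((d1, d2), d3)) =
        tensor_opt (tensor_opt (op_e B1 s P1 (Some d1)) (op_e B2 s P2 (Some d2))) (op_e B3 s P3 (Some d3))"
      by (simp only: tensor_simps sg sg12 Ps)
    have R': "op_e (tensor B1 (tensor B2 B3)) s r (Some (d1, d2, d3)) =
        tensor_opt (op_e B1 s P1 (Some d1)) (tensor_opt (op_e B2 s P2 (Some d2)) (op_e B3 s P3 (Some d3)))"
      by (simp only: tensor_simps sg sg23 P23_def P1_def P2_def P3_def)
    show ?thesis
      using cr_closed[OF c(1) s dc(1)] cr_closed[OF c(2) s dc(2)] cr_closed[OF c(3) s dc(3)]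
      by (auto simp: x Some d R L R' tensor_opt_assoc tensor_opt_eq_Some)
  qed
qed

section \<open>Inverting the one-dimensional Pitman transform\<close>

section \<open>Running infima\<close>

definition reversed :: "(real \<Rightarrow> real) \<Rightarrow> real \<Rightarrow> real" where
  "reversed g s = g (1 - s) - g 1"

text \<open>The infimum of \<open>g\<close> over all times from \<open>t\<close> on, written through
  \<open>run\<close> of the reversed path so that bounds and continuity are inherited.\<close>

definition inf_after :: "(real \<Rightarrow> real) \<Rightarrow> real \<Rightarrow> real" where
  "inf_after g t = g 1 - run (reversed g) (1 - t)"

lemma cpath_reversed: assumes "cpath g" shows "cpath (reversed g)"
proof -
  have "continuous_on UNIV (reversed g)" unfolding reversed_def
    by (intro continuous_on_diff continuous_on_compose2[OF cpath_cont[OF assms, of UNIV]] continuous_intros) auto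
  moreover have "reversed g t = 0" if "t \<le> 0" for t using cpath_1[OF assms, of "1 - t"] that by (simp add: reversed_def)
  moreover have "reversed g t = reversed g 1" if "t \<ge> 1" for t
    using cpath_0[OF assms, of "1 - t"] cpath_0[OF assms, of 0] that by (simp add: reversed_def)
  ultimately show ?thesis unfolding cpath_def by blast
qed

context
  fixes g assumes g: "cpath g"
begin

lemma inf_after_le: assumes "t \<le> u" shows "inf_after g t \<le> g u"
  using run_ge[OF cpath_reversed[OF g], of "1 - u" "1 - t"] assms by (simp add: inf_after_def reversed_def)

lemma inf_after_ge: assumes "\<And>u. t \<le> u \<Longrightarrow> c \<le> g u" shows "c \<le> inf_after g t"
proof -
  have "run (reversed g) (1 - t) \<le> g 1 - c"
  proof (rule run_le[OF cpath_reversed[OF g]])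
    fix s assume "s \<le> 1 - t"
    then show "- reversed g s \<le> g 1 - c" using assms[of "1 - s"] by (simp add: reversed_def)
  qed
  then show ?thesis by (simp add: inf_after_def)
qed

lemma inf_after_mono: "s \<le> t \<Longrightarrow> inf_after g s \<le> inf_after g t"
  by (intro inf_after_ge inf_after_le) simp

lemma inf_after_1: assumes "t \<ge> 1" shows "inf_after g t = g 1"
  using run_0[OF cpath_reversed[OF g], of "1 - t"] assms by (simp add: inf_after_def)

lemma cpath_inf_after: assumes nn: "\<And>t. 0 \<le> g t" shows "cpath (inf_after g)"
proof -
  have "continuous_on UNIV (inf_after g)" unfolding inf_after_def
    by (intro continuous_on_diff continuous_on_compose2[OF run_continuous[OF cpath_reversed[OF g]]] continuous_intros) auto
  moreover have "inf_after g t = 0" if "t \<le> 0" for t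
  proof (rule antisym)
    show "inf_after g t \<le> 0" using inf_after_le[of t t] cpath_0[OF g that] by simp
    show "0 \<le> inf_after g t" by (intro inf_after_ge nn)
  qed
  moreover have "inf_after g t = inf_after g 1" if "t \<ge> 1" for t using inf_after_1[OF that] inf_after_1[of 1] by simp
  ultimately show ?thesis unfolding cpath_def by blast
qed

text \<open>The two halves of the invertibility of the Pitman transform.\<close>

lemma run_lower:
  assumes nn: "\<And>t. 0 \<le> g t" and x: "0 \<le> x"
  shows "run (\<lambda>t. g t - 2 * min x (inf_after g t)) t = min x (inf_after g t)"
proof -
  note cM = cpath_inf_after[OF nn]
  have cmin: "cpath (\<lambda>t. min x (inf_after g t))"
  proof -
    have "continuous_on UNIV (\<lambda>t. min x (inf_after g t))"
      by (intro continuous_on_min continuous_on_const cpath_cont[OF cM])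
    moreover have "min x (inf_after g t) = 0" if "t \<le> 0" for t using cpath_0[OF cM that] x by simp
    moreover have "min x (inf_after g t) = min x (inf_after g 1)" if "t \<ge> 1" for t using cpath_1[OF cM that] by simp
    ultimately show ?thesis unfolding cpath_def by blast
  qed
  define f where "f t = g t - 2 * min x (inf_after g t)" for t
  have cf: "cpath f" unfolding f_def by (intro cpath_diff cpath_mult g cmin)
  define c where "c = min x (inf_after g t)"
  have "run f t = c"
  proof (rule antisym)
    show "run f t \<le> c"
    proof (rule run_le[OF cf])
      fix s assume "s \<le> t"
      then have "min x (inf_after g s) \<le> min x (inf_after g t)" by (intro min.mono inf_after_mono) simp_all
      then show "- f s \<le> c" using inf_after_le[of s s] unfolding f_def c_def by linarith
    qed
    show "c \<le> run f t"
    proof (cases "t \<le> 0")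
      case True
      then show ?thesis using cpath_0[OF cmin True] run_0[OF cf True] by (simp add: c_def)
    next
      case False
      have c0: "0 \<le> c" using x inf_after_ge[of t 0] nn by (simp add: c_def)
      define K where "K = {s \<in> {0..t}. g s \<le> c}"
      have "K = {0..t} \<inter> {s. g s \<le> c}" by (auto simp: K_def)
      moreover have "closed {s. g s \<le> c}" using cpath_cont[OF g, of UNIV] by (intro closed_Collect_le continuous_on_const)
      ultimately have "compact K" using compact_Int_closed[OF compact_Icc] by simp
      moreover have "0 \<in> K" using False cpath_0[OF g, of 0] c0 by (simp add: K_def)
      \<comment> \<open>The last time up to \<open>t\<close> at which \<open>g\<close> is at most
        \<open>c\<close>. There \<open>g\<close> equals \<open>c\<close>, and it is at least
        \<open>c\<close> ever after, so the lowered path takes the value \<open>- c\<close>.\<close>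
      ultimately obtain s where s: "s \<in> K" "\<And>u. u \<in> K \<Longrightarrow> u \<le> s" using compact_attains_sup[of K] by blast
      have st: "0 \<le> s" "s \<le> t" "g s \<le> c" using s(1) by (auto simp: K_def)
      have "c \<le> g t" using inf_after_le[of t t] by (simp add: c_def)
      then obtain v where v: "s \<le> v" "v \<le> t" "g v = c"
        using IVT'[of g s c t] st cpath_cont[OF g] by auto
      then have "v \<in> K" using st by (simp add: K_def)
      then have gs: "g s = c" using s(2)[of v] v by simp
      have "c \<le> inf_after g s"
      proof (rule inf_after_ge)
        fix u assume u: "s \<le> u"
        show "c \<le> g u"
        proof (cases "u \<le> t")
          case True
          then show ?thesis using s(2)[of u] u st gs by (cases "g u \<le> c") (auto simp: K_def)
        next
          case False
          then show ?thesis using inf_after_le[of t u] by (simp add: c_def)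
        qed
      qed
      then have "inf_after g s = c" using inf_after_le[of s s] gs by simp
      then have "- f s = c" using gs by (simp add: f_def c_def)
      then show ?thesis using run_ge[OF cf st(2)] by simp
    qed
  qed
  then show ?thesis by (simp add: f_def[abs_def] c_def)
qed

end

context
  fixes g assumes g: "cpath g"
begin

lemma run_raise:
  defines "h \<equiv> \<lambda>t. g t + 2 * run g t"
  shows "0 \<le> h t" and "min (run g 1) (inf_after h t) = run g t"
proof -
  have ch: "cpath h" unfolding h_def by (intro cpath_add cpath_mult g cpath_run)
  have hge: "run g u \<le> h u" for u using run_ge[OF g, of u u] by (simp add: h_def)
  show "0 \<le> h t" using hge run_nonneg[OF g, of t] order_trans by blast
  have le1: "run g t \<le> run g 1" using run_mono[OF g, of t 1] run_1[OF g, of t] by (cases "t \<le> 1") auto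
  have "run g t \<le> inf_after h t"
  proof -
    have "run g t \<le> h u" if "t \<le> u" for u using hge[of u] run_mono[OF g that] by simp
    then show ?thesis using inf_after_ge[OF ch] by blast
  qed
  moreover have "inf_after h t \<le> run g t" if ne: "run g t \<noteq> run g 1"
  proof -
    have lt: "run g t < run g 1" using ne le1 by simp
    obtain s' where s': "s' \<le> 1" "run g 1 = - g s'" using run_attained[OF g] by blast
    have ts': "t < s'" using lt s' run_ge[OF g, of s' t] by force
    define K where "K = {s \<in> {t..s'}. g s \<le> - run g t}"
    have "K = {t..s'} \<inter> {s. g s \<le> - run g t}" by (auto simp: K_def)
    moreover have "closed {s. g s \<le> - run g t}" using cpath_cont[OF g, of UNIV] by (intro closed_Collect_le continuous_on_const)
    ultimately have "compact K" using compact_Int_closed[OF compact_Icc] by simp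
    moreover have "s' \<in> K" using lt s' ts' by (simp add: K_def)
    \<comment> \<open>The first time from \<open>t\<close> on at which \<open>g\<close> is down to
      its previous minimum. Up to then the running supremum has not grown, so \<open>h\<close> is at
      most \<open>run g t\<close> there.\<close>
    ultimately obtain s where s: "s \<in> K" "\<And>u. u \<in> K \<Longrightarrow> s \<le> u" using compact_attains_inf[of K] by blast
    have st: "t \<le> s" "s \<le> s'" "g s \<le> - run g t" using s(1) by (auto simp: K_def)
    have "- run g t \<le> g t" using run_ge[OF g, of t t] by simp
    then obtain v where v: "t \<le> v" "v \<le> s" "g v = - run g t"
      using IVT2'[of g s "- run g t" t] st cpath_cont[OF g] by auto
    then have "v \<in> K" using st by (simp add: K_def)
    then have gs: "g s = - run g t" using s(2)[of v] v by simp
    have "run g s \<le> run g t"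
    proof (rule run_le[OF g])
      fix u assume u: "u \<le> s"
      show "- g u \<le> run g t"
      proof (cases "u \<le> t")
        case True then show ?thesis by (rule run_ge[OF g])
      next
        case False
        then show ?thesis using s(2)[of u] u st gs by (cases "g u \<le> - run g t") (auto simp: K_def)
      qed
    qed
    then have "h s \<le> run g t" using gs by (simp add: h_def)
    then show ?thesis using inf_after_le[OF ch st(1)] by simp
  qed
  ultimately show "min (run g 1) (inf_after h t) = run g t" using le1 by (cases "run g t = run g 1") auto
qed

end

lemma run_eq_0: assumes "cpath g" "run g 1 = 0" shows "run g t = 0"
  using run_mono[OF assms(1), of t 1] run_1[OF assms(1), of t] run_nonneg[OF assms(1), of t] assms(2)
  by (cases "t \<le> 1") auto

lemma run_nonneg_path: assumes "cpath g" "\<And>t. 0 \<le> g t" shows "run g t = 0"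
  using run_le[OF assms(1), of t 0] run_nonneg[OF assms(1), of t] assms(2) by fastforce

section \<open>The path model: strings, their tops, and orbits of dominant paths\<close>

section \<open>The crystal of paths\<close>

context coxeter_realization
begin

text \<open>Zero off \<open>S\<close>, as is \<open>cmat\<close>, so that raising a path and
  transforming its coordinates agree as functions on the whole type
  (\<open>proj_raise\<close>).\<close>

definition proj :: "(real \<Rightarrow> 'v) \<Rightarrow> 'w \<Rightarrow> real \<Rightarrow> real" where
  "proj p s t = (if s \<in> S then coroot s (p t) else 0)"

definition cmat :: "'w \<Rightarrow> 'w \<Rightarrow> real" where
  "cmat j i = (if j \<in> S then cartan j i else 0)"

text \<open>The vector space carries no topology, so continuity is demanded of the coordinates under
  the coroots.\<close>

definition paths :: "(real \<Rightarrow> 'v) set" where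
  "paths = {p. (\<forall>s\<in>S. cpath (proj p s)) \<and> (\<forall>t\<le>0. p t = 0) \<and> (\<forall>t\<ge>1. p t = p 1)}"

definition p_eps :: "'w \<Rightarrow> (real \<Rightarrow> 'v) \<Rightarrow> real" where
  "p_eps s p = run (proj p s) 1"

definition p_phi :: "'w \<Rightarrow> (real \<Rightarrow> 'v) \<Rightarrow> real" where
  "p_phi s p = p_eps s p + coroot s (p 1)"

definition raise :: "'w \<Rightarrow> (real \<Rightarrow> 'v) \<Rightarrow> real \<Rightarrow> 'v" where
  "raise s p t = p t + run (proj p s) t *\<^sub>R root s"

definition lower :: "'w \<Rightarrow> real \<Rightarrow> (real \<Rightarrow> 'v) \<Rightarrow> real \<Rightarrow> 'v" where
  "lower s x p t = p t - min x (inf_after (proj p s) t) *\<^sub>R root s"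

text \<open>\<open>raise s\<close> moves a path to the top of its \<open>s\<close>-string, and \<open>lower s x\<close> goes down from the top by \<open>x\<close>.\<close>

definition p_op :: "'w \<Rightarrow> real \<Rightarrow> (real \<Rightarrow> 'v) option \<Rightarrow> (real \<Rightarrow> 'v) option" where
  "p_op s r x = (case x of None \<Rightarrow> None | Some p \<Rightarrow>
     if - p_phi s p \<le> r \<and> r \<le> p_eps s p then Some (lower s (p_eps s p - r) (raise s p)) else None)"

definition path_crystal :: "(real \<Rightarrow> 'v) set \<Rightarrow> (real \<Rightarrow> 'v, 'w, 'v) crystal" where
  "path_crystal K = \<lparr>carrier = K, wt = (\<lambda>p. p 1), eps = (\<lambda>s p. ereal (p_eps s p)),
     phi = (\<lambda>s p. ereal (p_phi s p)), op_e = p_op\<rparr>"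

lemma path_crystal_simps [simp]:
  "carrier (path_crystal K) = K" "wt (path_crystal K) p = p 1" "eps (path_crystal K) s p = ereal (p_eps s p)"
  "phi (path_crystal K) s p = ereal (p_phi s p)" "op_e (path_crystal K) = p_op"
  by (auto simp: path_crystal_def)

lemma paths_proj: "p \<in> paths \<Longrightarrow> s \<in> S \<Longrightarrow> cpath (proj p s)"
  and paths_0: "p \<in> paths \<Longrightarrow> t \<le> 0 \<Longrightarrow> p t = 0"
  and paths_1: "p \<in> paths \<Longrightarrow> t \<ge> 1 \<Longrightarrow> p t = p 1"
  unfolding paths_def by blast+

lemma proj_add: "proj (\<lambda>t. p t + f t *\<^sub>R root i) s = (\<lambda>t. proj p s t + cmat s i * f t)"
  by (auto simp: proj_def cmat_def cartan_def coroot_simps fun_eq_iff)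

lemma proj_raise: "proj (raise i p) = pitman cmat i (proj p)"
  unfolding raise_def[abs_def] by (rule ext) (simp add: proj_add pitman_def)

lemma proj_raise_same: "s \<in> S \<Longrightarrow> proj (raise s p) s = (\<lambda>t. proj p s t + 2 * run (proj p s) t)"
  by (simp add: proj_raise pitman_def cmat_def cartan_diag)

lemma proj_lower_same: "s \<in> S \<Longrightarrow> proj (lower s x p) s = (\<lambda>t. proj p s t - 2 * min x (inf_after (proj p s) t))"
  using proj_add[of p "\<lambda>t. - min x (inf_after (proj p s) t)" s s]
  by (simp add: lower_def[abs_def] cmat_def cartan_diag)

lemma paths_add:
  assumes p: "p \<in> paths" and f: "cpath f" shows "(\<lambda>t. p t + f t *\<^sub>R root i) \<in> paths"
proof -
  have "cpath (proj (\<lambda>t. p t + f t *\<^sub>R root i) s)" if "s \<in> S" for s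
    unfolding proj_add using paths_proj[OF p that] f by (intro cpath_add cpath_mult)
  moreover have "p t + f t *\<^sub>R root i = 0" if "t \<le> 0" for t using paths_0[OF p that] cpath_0[OF f that] by simp
  moreover have "p t + f t *\<^sub>R root i = p 1 + f 1 *\<^sub>R root i" if "t \<ge> 1" for t
    using paths_1[OF p that] cpath_1[OF f that] by simp
  ultimately show ?thesis unfolding paths_def by blast
qed

lemma raise_paths: "p \<in> paths \<Longrightarrow> s \<in> S \<Longrightarrow> raise s p \<in> paths"
  unfolding raise_def[abs_def] by (intro paths_add cpath_run paths_proj)

lemma proj_nonneg_top:
  assumes "p \<in> paths" "s \<in> S" "p_eps s p = 0" shows "0 \<le> proj p s t"
proof -
  have "run (proj p s) t = 0" using run_eq_0[OF paths_proj[OF assms(1,2)]] assms(3) by (simp add: p_eps_def)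
  then show ?thesis using run_ge[OF paths_proj[OF assms(1,2)], of t t] by simp
qed

lemma raise_top:
  assumes "p \<in> paths" "s \<in> S" "p_eps s p = 0" shows "raise s p = p"
  using run_eq_0[OF paths_proj[OF assms(1,2)]] assms(3) by (simp add: p_eps_def raise_def fun_eq_iff)

lemma lower_paths:
  assumes p: "p \<in> paths" "s \<in> S" "p_eps s p = 0" and x: "0 \<le> x" shows "lower s x p \<in> paths"
proof -
  have nn: "0 \<le> proj p s t" for t using proj_nonneg_top[OF p] .
  note cM = cpath_inf_after[OF paths_proj[OF p(1,2)] nn]
  have "cpath (\<lambda>t. - min x (inf_after (proj p s) t))"
  proof -
    have "continuous_on UNIV (\<lambda>t. - min x (inf_after (proj p s) t))"
      by (intro continuous_on_minus continuous_on_min continuous_on_const cpath_cont[OF cM])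
    moreover have "- min x (inf_after (proj p s) t) = 0" if "t \<le> 0" for t using cpath_0[OF cM that] x by simp
    moreover have "- min x (inf_after (proj p s) t) = - min x (inf_after (proj p s) 1)" if "t \<ge> 1" for t
      using cpath_1[OF cM that] by simp
    ultimately show ?thesis unfolding cpath_def by blast
  qed
  from paths_add[OF p(1) this, of s] show ?thesis by (simp add: lower_def[abs_def])
qed

lemma p_eps_nonneg: "p \<in> paths \<Longrightarrow> s \<in> S \<Longrightarrow> 0 \<le> p_eps s p"
  unfolding p_eps_def by (intro run_nonneg paths_proj)

lemma p_phi_nonneg: "p \<in> paths \<Longrightarrow> s \<in> S \<Longrightarrow> 0 \<le> p_phi s p"
  using run_ge[OF paths_proj, of p s 1 1] by (simp add: p_phi_def p_eps_def proj_def)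

lemma p_eps_raise: "p \<in> paths \<Longrightarrow> s \<in> S \<Longrightarrow> p_eps s (raise s p) = 0"
  unfolding p_eps_def proj_raise_same
  by (rule run_nonneg_path) (intro run_raise(1) paths_proj cpath_add cpath_mult cpath_run; assumption)+

lemma min_inf_after_raise:
  "p \<in> paths \<Longrightarrow> s \<in> S \<Longrightarrow> min (p_eps s p) (inf_after (proj (raise s p) s) t) = run (proj p s) t"
  unfolding p_eps_def proj_raise_same by (rule run_raise(2)[OF paths_proj])

lemma lower_raise: "p \<in> paths \<Longrightarrow> s \<in> S \<Longrightarrow> lower s (p_eps s p) (raise s p) = p"
  by (rule ext) (simp add: lower_def min_inf_after_raise raise_def)

text \<open>The explicit form of a raising operator: only the part of the running supremum above the
  level \<open>p_eps s p - r\<close> is added. The second factor of a concatenation changes in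
  exactly this way.\<close>

lemma lower_raise_partial:
  assumes "p \<in> paths" "s \<in> S" "0 \<le> r"
  shows "lower s (p_eps s p - r) (raise s p) t = p t + max 0 (run (proj p s) t - (p_eps s p - r)) *\<^sub>R root s"
proof -
  have "min (p_eps s p - r) (inf_after (proj (raise s p) s) t) = min (p_eps s p - r) (run (proj p s) t)"
    using min_inf_after_raise[OF assms(1,2), of t] assms(3) by linarith
  then show ?thesis
    by (cases "run (proj p s) t \<le> p_eps s p - r") (simp_all add: lower_def raise_def max_def algebra_simps)
qed

lemma lower_top:
  assumes p: "p \<in> paths" "s \<in> S" "p_eps s p = 0" and x: "0 \<le> x" "x \<le> coroot s (p 1)"
  shows "p_eps s (lower s x p) = x" "raise s (lower s x p) = p" "lower s x p 1 = p 1 - x *\<^sub>R root s"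
proof -
  have rl: "run (proj (lower s x p) s) t = min x (inf_after (proj p s) t)" for t
    unfolding proj_lower_same[OF p(2)] using run_lower[OF paths_proj[OF p(1,2)] proj_nonneg_top[OF p] x(1)] .
  have m1: "min x (inf_after (proj p s) 1) = x"
    using inf_after_1[OF paths_proj[OF p(1,2)], of 1] x p(2) by (simp add: proj_def)
  show "p_eps s (lower s x p) = x" unfolding p_eps_def rl m1 ..
  show "raise s (lower s x p) = p" by (rule ext) (simp add: raise_def[of s "lower s x p"] rl, simp add: lower_def)
  show "lower s x p 1 = p 1 - x *\<^sub>R root s" by (simp add: lower_def m1)
qed

lemma raise_1: "raise s p 1 = p 1 + p_eps s p *\<^sub>R root s"
  by (simp add: raise_def p_eps_def)

lemma p_op_Some:
  assumes p: "p \<in> paths" "s \<in> S" and op: "p_op s r (Some p) = Some q"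
  shows "q \<in> paths" "p_eps s q = p_eps s p - r" "p_phi s q = p_phi s p + r" "raise s q = raise s p"
    "q 1 = p 1 + r *\<^sub>R root s"
proof -
  have r: "- p_phi s p \<le> r" "r \<le> p_eps s p" and q: "q = lower s (p_eps s p - r) (raise s p)"
    using op by (auto simp: p_op_def split: if_splits)
  have c1: "coroot s (raise s p 1) = p_phi s p + p_eps s p"
    using p(2) cartan_diag[OF p(2)] by (simp add: raise_1 p_phi_def coroot_simps cartan_def)
  note t = lower_top[OF raise_paths[OF p] p(2) p_eps_raise[OF p], of "p_eps s p - r"]
  show "q \<in> paths" unfolding q using r by (intro lower_paths raise_paths p p_eps_raise) simp
  show e: "p_eps s q = p_eps s p - r" "raise s q = raise s p" unfolding q using t(1,2) r c1 by auto
  show q1: "q 1 = p 1 + r *\<^sub>R root s" unfolding q using t(3) r c1 by (simp add: raise_1 algebra_simps)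
  show "p_phi s q = p_phi s p + r"
    using p(2) cartan_diag[OF p(2)] by (simp add: p_phi_def e q1 coroot_simps cartan_def)
qed

text \<open>By \<open>lower_raise\<close> a path is recovered from the top of its string and its
  distance from it, so the result of an operator can be verified on these two data.\<close>

lemma p_op_eq_Some_iff:
  assumes p: "p \<in> paths" "s \<in> S" and q: "q \<in> paths"
  shows "p_op s r (Some p) = Some q \<longleftrightarrow> raise s q = raise s p \<and> p_eps s q = p_eps s p - r"
proof
  assume "p_op s r (Some p) = Some q"
  then show "raise s q = raise s p \<and> p_eps s q = p_eps s p - r" using p_op_Some[OF p] by blast
next
  assume h: "raise s q = raise s p \<and> p_eps s q = p_eps s p - r"
  then have "q 1 + p_eps s q *\<^sub>R root s = p 1 + p_eps s p *\<^sub>R root s" using raise_1[of s q] raise_1[of s p] by simp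
  then have "q 1 = p 1 + r *\<^sub>R root s" using h by (simp add: algebra_simps)
  then have "p_phi s q = p_phi s p + r"
    using h p(2) cartan_diag[OF p(2)] by (simp add: p_phi_def coroot_simps cartan_def)
  then have "- p_phi s p \<le> r" "r \<le> p_eps s p"
    using p_phi_nonneg[OF q p(2)] p_eps_nonneg[OF q p(2)] h by auto
  moreover have "lower s (p_eps s p - r) (raise s p) = q" using lower_raise[OF q p(2)] h by simp
  ultimately show "p_op s r (Some p) = Some q" by (simp add: p_op_def)
qed

lemma p_op_None_iff: "p_op s r (Some p) = None \<longleftrightarrow> \<not> (- p_phi s p \<le> r \<and> r \<le> p_eps s p)"
  by (simp add: p_op_def)

lemma p_op_0: "p \<in> paths \<Longrightarrow> s \<in> S \<Longrightarrow> p_op s 0 (Some p) = Some p"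
  by (simp add: p_op_eq_Some_iff)

lemma p_op_add:
  assumes p: "p \<in> paths" "s \<in> S" and op: "p_op s r (Some p) = Some q"
  shows "p_op s x (Some q) = p_op s (x + r) (Some p)"
proof -
  note q = p_op_Some(2-4)[OF p op]
  have 1: "p_eps s q - x = p_eps s p - (x + r)" using q(1) by simp
  have 2: "- p_phi s q \<le> x \<and> x \<le> p_eps s q \<longleftrightarrow> - p_phi s p \<le> x + r \<and> x + r \<le> p_eps s p"
    unfolding q(1,2) by linarith
  show ?thesis unfolding p_op_def option.case q(3) 1 2 ..
qed

lemma p_op_raise: "p \<in> paths \<Longrightarrow> s \<in> S \<Longrightarrow> p_op s (p_eps s p) (Some p) = Some (raise s p)"
  by (simp add: p_op_eq_Some_iff raise_paths p_eps_raise raise_top)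

lemma path_crystal_is_crystal:
  assumes K: "K \<subseteq> paths" and closed: "\<And>s r p q. s \<in> S \<Longrightarrow> p \<in> K \<Longrightarrow> p_op s r (Some p) = Some q \<Longrightarrow> q \<in> K"
  shows "is_crystal S root coroot (path_crystal K)"
  unfolding is_crystal_def path_crystal_simps
proof (intro conjI ballI allI impI)
  fix s r assume s: "s \<in> S"
  show N: "p_op s r None = None" by (simp add: p_op_def)
  show "p_op s r \<in> ghosted (path_crystal K) \<rightarrow> ghosted (path_crystal K)"
  proof
    fix x assume "x \<in> ghosted (path_crystal K)"
    then show "p_op s r x \<in> ghosted (path_crystal K)"
      using closed[OF s] N by (cases x; cases "p_op s r x") (auto simp: ghosted_def)
  qed
next
  fix s p assume s: "s \<in> S" and "p \<in> K"
  then have p: "p \<in> paths" using K by auto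
  show "ereal (p_phi s p) = ereal (p_eps s p) + ereal (coroot s (p 1))" by (simp add: p_phi_def)
  show "p_op s 0 (Some p) = Some p" using p_op_0[OF p s] .
  {
    fix r q assume op: "p_op s r (Some p) = Some q"
    show "ereal (p_eps s q) = ereal (p_eps s p) - ereal r" "ereal (p_phi s q) = ereal (p_phi s p) + ereal r"
      "q 1 = p 1 + r *\<^sub>R root s" using p_op_Some[OF p s op] by auto
  }
  fix r q assume "p_op s r (Some p) \<noteq> None"
  then obtain p' where op: "p_op s r (Some p) = Some p'" by auto
  show "p_op s (q + r) (Some p) = p_op s q (p_op s r (Some p))" using p_op_add[OF p s op, of q] op by simp
qed auto

lemma path_crystal_normal:
  assumes K: "K \<subseteq> paths" shows "normal_crystal S (path_crystal K)"
  unfolding normal_crystal_def path_crystal_simps is_maximum_def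
proof (intro ballI conjI)
  fix s p assume s: "s \<in> S" and "p \<in> K"
  then have p: "p \<in> paths" using K by auto
  note nn = p_eps_nonneg[OF p s] p_phi_nonneg[OF p s]
  show "\<exists>x\<in>{r. r \<ge> 0 \<and> p_op s r (Some p) \<noteq> None}. ereal (p_eps s p) = ereal x \<and>
      (\<forall>y\<in>{r. r \<ge> 0 \<and> p_op s r (Some p) \<noteq> None}. y \<le> x)"
    using nn by (intro bexI[of _ "p_eps s p"]) (auto simp: p_op_None_iff)
  show "\<exists>x\<in>{r. r \<ge> 0 \<and> p_op s (- r) (Some p) \<noteq> None}. ereal (p_phi s p) = ereal x \<and>
      (\<forall>y\<in>{r. r \<ge> 0 \<and> p_op s (- r) (Some p) \<noteq> None}. y \<le> x)"
    using nn by (intro bexI[of _ "p_phi s p"]) (auto simp: p_op_None_iff)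
qed

abbreviation PC :: "(real \<Rightarrow> 'v, 'w, 'v) crystal" where "PC \<equiv> path_crystal paths"

lemma PC_crystal: "is_crystal S root coroot PC"
  by (rule path_crystal_is_crystal) (auto dest: p_op_Some(1))

lemma opw_path_crystal: "opw (path_crystal K) = opw PC"
  by (simp add: opw_def fun_eq_iff)

lemma f_orbit_path_crystal: "f_orbit S (path_crystal K) = f_orbit S PC"
  by (simp add: fun_eq_iff set_eq_iff f_orbit_iff opw_path_crystal[of K])

lemma PC_opw_paths: "p \<in> paths \<Longrightarrow> fst ` set w \<subseteq> S \<Longrightarrow> opw PC w p = Some q \<Longrightarrow> q \<in> paths"
  using opw_carrier[OF PC_crystal] by simp

section \<open>Dominant paths\<close>

lemma proj_cpaths: "p \<in> paths \<Longrightarrow> proj p \<in> cpaths S"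
  by (simp add: cpaths_def paths_proj)

lemma weq_braid_relation:
  assumes s: "s \<in> S" and t: "t \<in> S" and ne: "s \<noteq> t"
  shows "weq cmat S (alt s t (ord (s \<otimes> t))) (alt t s (ord (s \<otimes> t)))"
proof (cases "ord (s \<otimes> t) = 2")
  case True
  have "t \<otimes> s = inv (s \<otimes> t)" using s t S_carrier by (simp add: inv_mult_group S_inv)
  then have "ord (t \<otimes> s) = 2" using True s t S_carrier by (simp add: ord_inv)
  then have "cartan s t = 0" "cartan t s = 0" using cartan_ord_2 True s t ne by auto
  then show ?thesis using s t by (simp add: True numeral_2_eq_2 weq_commute cmat_def)
next
  case False
  have "t \<otimes> s = inv (s \<otimes> t)" using s t S_carrier by (simp add: inv_mult_group S_inv)
  then have o: "ord (t \<otimes> s) = ord (s \<otimes> t)" using s t S_carrier by (simp add: ord_inv)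
  have "ord (s \<otimes> t) \<ge> 3" using ord_ge_2[OF s t ne] False by linarith
  then show ?thesis
    using s t ne False cartan_neg[OF s t ne False] cartan_neg[OF t s] cartan_prod[OF s t ne False] o
    by (intro weq_dihedral) (auto simp: cmat_def cartan_diag)
qed

text \<open>Plays the part of the longest element: as far as Pitman transforms and strings are
  concerned, it may begin with any generator.\<close>

definition long :: "'w list" where
  "long = (SOME u. set u \<subseteq> S \<and> (\<forall>s\<in>S. \<exists>v. set v \<subseteq> S \<and> weq cmat S u (s # v)))"

lemma long: "set long \<subseteq> S"
  and long_first: "s \<in> S \<Longrightarrow> \<exists>v. set v \<subseteq> S \<and> weq cmat S long (s # v)"
proof -
  have "\<exists>u. set u \<subseteq> S \<and> (\<forall>s\<in>S. \<exists>v. set v \<subseteq> S \<and> weq cmat S u (s # v))"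
    by (rule longest_word[OF weq_refl weq_sym weq_trans])
      (auto intro: weq_Cons weq_append finite_S weq_braid_relation)
  from someI_ex[OF this] show "set long \<subseteq> S"
    "s \<in> S \<Longrightarrow> \<exists>v. set v \<subseteq> S \<and> weq cmat S long (s # v)" unfolding long_def by blast+
qed

lemma fold_raise_gains:
  "set u \<subseteq> S \<Longrightarrow> fold raise u p t = p t + (\<Sum>s\<in>S. gains cmat u (proj p) s t *\<^sub>R root s)"
proof (induction u arbitrary: p)
  case (Cons i u)
  have "(\<Sum>s\<in>S. gains cmat (i # u) (proj p) s t *\<^sub>R root s) =
      (\<Sum>s\<in>S. if s = i then run (proj p i) t *\<^sub>R root i else 0) + (\<Sum>s\<in>S. gains cmat u (proj (raise i p)) s t *\<^sub>R root s)"
    unfolding sum.distrib[symmetric] by (intro sum.cong) (auto simp: proj_raise scaleR_add_left)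
  also have "(\<Sum>s\<in>S. if s = i then run (proj p i) t *\<^sub>R root i else 0) = run (proj p i) t *\<^sub>R root i"
    using finite_S Cons.prems by simp
  finally show ?case using Cons by (simp add: raise_def add.assoc)
qed simp

lemma weq_fold_raise:
  assumes "weq cmat S u v" "set u \<subseteq> S" "set v \<subseteq> S" "p \<in> paths"
  shows "fold raise u p = fold raise v p"
proof
  have "gains cmat u (proj p) = gains cmat v (proj p)" using assms(1) proj_cpaths[OF assms(4)] by (simp add: weq_def)
  then show "fold raise u p t = fold raise v p t" for t using fold_raise_gains assms(2,3) by simp
qed

definition dominant :: "(real \<Rightarrow> 'v) \<Rightarrow> bool" where
  "dominant p \<longleftrightarrow> p \<in> paths \<and> (\<forall>s\<in>S. p_eps s p = 0)"

lemma dominant_fold_raise: "dominant p \<Longrightarrow> set u \<subseteq> S \<Longrightarrow> fold raise u p = p"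
  by (induction u) (auto simp: dominant_def raise_top)

lemma dominant_strings: "dominant p \<Longrightarrow> set u \<subseteq> S \<Longrightarrow> strings cmat u (proj p) = replicate (length u) 0"
proof (induction u)
  case (Cons s u)
  then have "pitman cmat s (proj p) = proj p" using raise_top[of p s] proj_raise[of s p] by (simp add: dominant_def)
  then show ?case using Cons by (simp add: dominant_def p_eps_def)
qed simp

text \<open>Rewrite \<open>long\<close> to begin with \<open>s\<close>. Its first step forgets the
  position in the \<open>s\<close>-string, which is all that the operator changes.\<close>

lemma fold_raise_long_op:
  assumes p: "p \<in> paths" and s: "s \<in> S" and op: "p_op s r (Some p) = Some q"
  shows "fold raise long q = fold raise long p"
proof -
  obtain v where v: "set v \<subseteq> S" "weq cmat S long (s # v)" using long_first[OF s] by blast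
  have "fold raise long x = fold raise v (raise s x)" if "x \<in> paths" for x
    using weq_fold_raise[OF v(2) long _ that] v(1) s by simp
  then show ?thesis using p p_op_Some(1,4)[OF p s op] by simp
qed

lemma fold_raise_long_opw:
  assumes p: "p \<in> paths" shows "fst ` set w \<subseteq> S \<Longrightarrow> opw PC w p = Some q \<Longrightarrow> fold raise long q = fold raise long p"
proof (induction w arbitrary: q)
  case (Cons x w)
  obtain s r where x: "x = (s, r)" by (cases x)
  have s: "s \<in> S" and w: "fst ` set w \<subseteq> S" using Cons.prems x by auto
  obtain d where d: "opw PC w p = Some d"
    using Cons.prems(2) x by (cases "opw PC w p") (auto simp: p_op_def)
  show ?case using fold_raise_long_op[OF PC_opw_paths[OF p w d] s, of r q] Cons.IH[OF w d] Cons.prems(2) x d by simp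
qed simp

lemma f_orbit_fold_raise:
  "set u \<subseteq> S \<Longrightarrow> p \<in> paths \<Longrightarrow> p \<in> f_orbit S PC (fold raise u p)"
proof (induction u arbitrary: p)
  case Nil then show ?case by (simp add: f_orbit_refl)
next
  case (Cons s u)
  then have s: "s \<in> S" by simp
  obtain w where w: "fst ` set w \<subseteq> S" "\<forall>x\<in>set w. snd x \<le> 0" "opw PC w (fold raise u (raise s p)) = Some (raise s p)"
    using Cons.IH[of "raise s p"] raise_paths[OF Cons.prems(2) s] Cons.prems(1) unfolding f_orbit_iff by auto
  have "p_op s (- p_eps s p) (Some (raise s p)) = p_op s (- p_eps s p + p_eps s p) (Some p)"
    by (rule p_op_add[OF Cons.prems(2) s p_op_raise[OF Cons.prems(2) s]])
  then have "opw PC ((s, - p_eps s p) # w) (fold raise (s # u) p) = Some p"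
    using w(3) p_op_0[OF Cons.prems(2) s] by simp
  moreover have "fst ` set ((s, - p_eps s p) # w) \<subseteq> S" "\<forall>x\<in>set ((s, - p_eps s p) # w). snd x \<le> 0"
    using w s p_eps_nonneg[OF Cons.prems(2) s] by auto
  ultimately show ?case unfolding f_orbit_iff by blast
qed

text \<open>Whatever operators lead from \<open>p\<close> to \<open>q\<close>, going up along
  \<open>long\<close> leads back to \<open>p\<close>, and descending the same strings reaches
  \<open>q\<close> by lowering operators alone. So the f-orbit of a dominant path is stable under
  all operators.\<close>

lemma dominant_orbit:
  assumes d: "dominant p" and w: "fst ` set w \<subseteq> S" "opw PC w p = Some q"
  shows "q \<in> f_orbit S PC p"
proof -
  have p: "p \<in> paths" using d by (simp add: dominant_def)
  have "fold raise long q = p" using fold_raise_long_opw[OF p w] dominant_fold_raise[OF d long] by simp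
  then show ?thesis using f_orbit_fold_raise[OF long PC_opw_paths[OF p w]] by simp
qed

lemma dominant_orbit_crystal:
  assumes d: "dominant p"
  shows "f_orbit S PC p \<subseteq> paths" "is_crystal S root coroot (path_crystal (f_orbit S PC p))"
    "normal_crystal S (path_crystal (f_orbit S PC p))"
proof -
  have p: "p \<in> paths" using d by (simp add: dominant_def)
  show sub: "f_orbit S PC p \<subseteq> paths" using f_orbit_subset[OF PC_crystal] p by simp
  show "is_crystal S root coroot (path_crystal (f_orbit S PC p))"
  proof (rule path_crystal_is_crystal[OF sub])
    fix s r q q' assume s: "s \<in> S" and q: "q \<in> f_orbit S PC p" and op: "p_op s r (Some q) = Some q'"
    obtain w where w: "fst ` set w \<subseteq> S" "opw PC w p = Some q" using q unfolding f_orbit_iff by blast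
    show "q' \<in> f_orbit S PC p" using dominant_orbit[OF d, of "(s, r) # w"] w s op by simp
  qed
  show "normal_crystal S (path_crystal (f_orbit S PC p))" by (rule path_crystal_normal[OF sub])
qed

text \<open>The strings along \<open>long\<close> and the weight determine all further strings, so words act alike on
  dominant paths with the same endpoint.\<close>

lemma dominant_same_words:
  assumes d: "dominant p" "dominant p'" and eq: "p 1 = p' 1" and w: "fst ` set w \<subseteq> S"
  shows "rel_option (\<lambda>q q'. strings cmat long (proj q) = strings cmat long (proj q') \<and> q 1 = q' 1)
    (opw PC w p) (opw PC w p')"
  using w
proof (induction w)
  case Nil
  then show ?case using dominant_strings[OF d(1) long] dominant_strings[OF d(2) long] eq by simp
next
  case (Cons x w)
  obtain s r where x: "x = (s, r)" by (cases x)
  have s: "s \<in> S" and w: "fst ` set w \<subseteq> S" using Cons.prems x by auto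
  have pp: "p \<in> paths" "p' \<in> paths" using d by (auto simp: dominant_def)
  from Cons.IH[OF w] show ?case
  proof (cases rule: option.rel_cases)
    case None
    then show ?thesis by (simp add: x p_op_def)
  next
    case (Some q q')
    have qp: "q \<in> paths" "q' \<in> paths" using PC_opw_paths[OF pp(1) w] PC_opw_paths[OF pp(2) w] Some by auto
    obtain v where v: "set v \<subseteq> S" "weq cmat S long (s # v)" using long_first[OF s] by blast
    \<comment> \<open>With \<open>long\<close> rewritten to begin with \<open>s\<close>, the first
      string is the position in the \<open>s\<close>-string and the others depend only on its top.
      An operator shifts the former and keeps the latter.\<close>
    have W: "strings cmat long (proj a) = strings cmat long (proj b) \<longleftrightarrow>
        p_eps s a = p_eps s b \<and> strings cmat v (proj (raise s a)) = strings cmat v (proj (raise s b))"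
      if "a \<in> paths" "b \<in> paths" for a b
      using v(2) proj_cpaths[OF that(1)] proj_cpaths[OF that(2)] by (simp add: weq_def p_eps_def proj_raise)
    have e: "p_eps s q = p_eps s q'" and tl: "strings cmat v (proj (raise s q)) = strings cmat v (proj (raise s q'))"
      using W[OF qp] Some by auto
    have f: "p_phi s q = p_phi s q'" using e Some by (simp add: p_phi_def)
    show ?thesis
    proof (cases "p_op s r (Some q)")
      case None
      then have "p_op s r (Some q') = None" using e f by (simp add: p_op_None_iff)
      then show ?thesis using None Some by (simp add: x)
    next
      case S1: (Some a)
      then obtain a' where S2: "p_op s r (Some q') = Some a'" using e f by (cases "p_op s r (Some q')") (auto simp: p_op_None_iff p_op_def split: if_splits)
      note A = p_op_Some[OF qp(1) s S1] and A' = p_op_Some[OF qp(2) s S2]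
      have "strings cmat long (proj a) = strings cmat long (proj a')"
        unfolding W[OF A(1) A'(1)] using A A' e tl by simp
      then show ?thesis using Some S1 S2 A(5) A'(5) by (simp add: x)
    qed
  qed
qed

lemma dominant_same_None:
  assumes "dominant p" "dominant p'" "p 1 = p' 1" "fst ` set w \<subseteq> S"
  shows "opw PC w p = None \<longleftrightarrow> opw PC w p' = None"
  using dominant_same_words[OF assms] by (cases "opw PC w p"; cases "opw PC w p'") auto

end

lemma word_coeff_nonpos: "\<forall>x\<in>set w. snd x \<le> 0 \<Longrightarrow> word_coeff w t \<le> 0"
  by (induction w) (auto intro!: add_nonpos_nonpos)

lemma word_coeff_zero:
  "\<forall>x\<in>set w. snd x \<le> 0 \<Longrightarrow> \<forall>t\<in>fst ` set w. word_coeff w t = 0 \<Longrightarrow> \<forall>x\<in>set w. snd x = 0"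
proof (induction w)
  case (Cons x w)
  obtain s r where x: "x = (s, r)" by (cases x)
  have np: "r \<le> 0" "word_coeff w t \<le> 0" for t using Cons.prems x word_coeff_nonpos[of w t] by auto
  have z: "(if s = t then r else 0) + word_coeff w t = 0" if "t \<in> fst ` set (x # w)" for t
    using Cons.prems(2) that x by auto
  have "word_coeff w t = 0" if "t \<in> fst ` set (x # w)" for t
    using z[OF that] np by (cases "s = t") (auto intro: antisym)
  moreover have "r + word_coeff w s = 0" using z[of s] x by simp
  then have "r = 0" using np(1) np(2)[of s] by linarith
  ultimately show ?case using Cons x by auto
qed simp

lemma opw_zero:
  assumes "is_crystal S \<alpha> \<alpha>v B" "b \<in> carrier B"
  shows "fst ` set w \<subseteq> S \<Longrightarrow> \<forall>x\<in>set w. snd x = 0 \<Longrightarrow> opw B w b = Some b"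
proof (induction w)
  case (Cons x w)
  then show ?case using cr_zero[OF assms(1) _ assms(2)] by (cases x) auto
qed simp

text \<open>Concatenation will embed the orbit inside a tensor product into the crystal of paths;
  the axioms are then inherited instead of being checked against the tensor rule.\<close>

lemma crystal_pullback:
  assumes X: "is_crystal S \<alpha> \<alpha>v X"
    and \<kappa>: "\<And>x. x \<in> carrier R \<Longrightarrow> \<kappa> x \<in> carrier X" "inj_on \<kappa> (carrier R)"
    and data: "\<And>x. x \<in> carrier R \<Longrightarrow> same_data S R X x (\<kappa> x)"
    and N: "\<And>s r. s \<in> S \<Longrightarrow> op_e R s r None = None"
    and closed: "\<And>s r x y. s \<in> S \<Longrightarrow> x \<in> carrier R \<Longrightarrow> op_e R s r (Some x) = Some y \<Longrightarrow> y \<in> carrier R"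
    and comm: "\<And>s r x. s \<in> S \<Longrightarrow> x \<in> carrier R \<Longrightarrow> map_option \<kappa> (op_e R s r (Some x)) = op_e X s r (Some (\<kappa> x))"
  shows "is_crystal S \<alpha> \<alpha>v R" and "normal_crystal S X \<Longrightarrow> normal_crystal S R"
proof -
  note c = X[unfolded is_crystal_def]
  have fin: "eps X s x \<noteq> \<infinity> \<and> phi X s x \<noteq> \<infinity>" if "s \<in> S" "x \<in> carrier X" for s x
    by (rule c[THEN conjunct2, THEN conjunct1, rule_format, OF that])
  have C4: "op_e X s r (Some x) = None" if "s \<in> S" "x \<in> carrier X" "phi X s x = -\<infinity>" "r \<noteq> 0" for s x r
    by (rule c[THEN conjunct2, THEN conjunct2, THEN conjunct2, THEN conjunct2, THEN conjunct2, THEN conjunct2, THEN conjunct2,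
        rule_format, OF that])
  have eq: "wt R x = wt X (\<kappa> x)" "s \<in> S \<Longrightarrow> eps R s x = eps X s (\<kappa> x)" "s \<in> S \<Longrightarrow> phi R s x = phi X s (\<kappa> x)"
    if "x \<in> carrier R" for x s using data[OF that] by (auto simp: same_data_def)
  have Some: "op_e X s r (Some (\<kappa> x)) = Some (\<kappa> y)" if "s \<in> S" "x \<in> carrier R" "op_e R s r (Some x) = Some y" for s r x y
    using comm[OF that(1,2), of r] that(3) by simp
  have None: "op_e X s r (Some (\<kappa> x)) = None \<longleftrightarrow> op_e R s r (Some x) = None" if "s \<in> S" "x \<in> carrier R" for s r x
    using comm[OF that, of r, symmetric] by (cases "op_e R s r (Some x)") auto
  have inj: "y = z" if "y \<in> carrier R" "z \<in> carrier R" "\<kappa> y = \<kappa> z" for y z using \<kappa>(2) that by (auto dest: inj_onD)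
  show "is_crystal S \<alpha> \<alpha>v R"
    unfolding is_crystal_def
  proof (intro conjI ballI allI impI)
    fix s r assume s: "s \<in> S"
    show "op_e R s r None = None" using N[OF s] .
    show "op_e R s r \<in> ghosted R \<rightarrow> ghosted R"
    proof
      fix x assume "x \<in> ghosted R"
      then show "op_e R s r x \<in> ghosted R"
        using closed[OF s] N[OF s] by (cases x; cases "op_e R s r x") (auto simp: ghosted_def)
    qed
  next
    fix s x assume s: "s \<in> S" and x: "x \<in> carrier R"
    show "eps R s x \<noteq> \<infinity>" "phi R s x \<noteq> \<infinity>" using fin[OF s \<kappa>(1)[OF x]] eq[OF x] s by auto
    show "phi R s x = eps R s x + ereal (\<alpha>v s (wt R x))" using cr_phi[OF X s \<kappa>(1)[OF x]] eq[OF x] s by simp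
    show "op_e R s 0 (Some x) = Some x"
    proof -
      have "map_option \<kappa> (op_e R s 0 (Some x)) = Some (\<kappa> x)" using comm[OF s x] cr_zero[OF X s \<kappa>(1)[OF x]] by simp
      then obtain y where y: "op_e R s 0 (Some x) = Some y" "\<kappa> y = \<kappa> x" by auto
      then show ?thesis using inj[OF closed[OF s x y(1)] x] by simp
    qed
    {
      fix r y assume op: "op_e R s r (Some x) = Some y"
      note y = closed[OF s x op]
      show "eps R s y = eps R s x - ereal r" "phi R s y = phi R s x + ereal r" "wt R y = wt R x + r *\<^sub>R \<alpha> s"
        using cr_C2[OF X s \<kappa>(1)[OF x] Some[OF s x op]] eq[OF x] eq[OF y] s by auto
    }
    {
      fix r q assume "op_e R s r (Some x) \<noteq> None"
      then obtain y where y: "op_e R s r (Some x) = Some y" by auto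
      note yc = closed[OF s x y]
      have "map_option \<kappa> (op_e R s (q + r) (Some x)) = map_option \<kappa> (op_e R s q (Some y))"
        using comm[OF s x] comm[OF s yc] cr_add[OF X s \<kappa>(1)[OF x] Some[OF s x y]] by simp
      then have "op_e R s (q + r) (Some x) = op_e R s q (Some y)"
        using inj closed[OF s x] closed[OF s yc]
        by (cases "op_e R s (q + r) (Some x)"; cases "op_e R s q (Some y)") auto
      then show "op_e R s (q + r) (Some x) = op_e R s q (op_e R s r (Some x))" using y by simp
    }
    fix r :: real assume "phi R s x = - \<infinity>" "r \<noteq> 0"
    then show "op_e R s r (Some x) = None" using C4[OF s \<kappa>(1)[OF x]] None[OF s x] eq[OF x] s by simp
  qed
  show "normal_crystal S R" if "normal_crystal S X"
    unfolding normal_crystal_def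
  proof (intro ballI)
    fix s x assume s: "s \<in> S" and x: "x \<in> carrier R"
    have "is_maximum {r. r \<ge> 0 \<and> op_e X s r (Some (\<kappa> x)) \<noteq> None} (eps X s (\<kappa> x)) \<and>
        is_maximum {r. r \<ge> 0 \<and> op_e X s (- r) (Some (\<kappa> x)) \<noteq> None} (phi X s (\<kappa> x))"
      using that \<kappa>(1)[OF x] s unfolding normal_crystal_def by blast
    then show "is_maximum {r. r \<ge> 0 \<and> op_e R s r (Some x) \<noteq> None} (eps R s x) \<and>
        is_maximum {r. r \<ge> 0 \<and> op_e R s (- r) (Some x) \<noteq> None} (phi R s x)"
      unfolding None[OF s x] eq(2)[OF x s] eq(3)[OF x s] .
  qed
qed

context coxeter_realization
begin

lemma f_orbit_coeff:
  assumes "is_crystal S root coroot B" "b \<in> carrier B" "c \<in> f_orbit S B b"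
  shows "\<exists>x. (\<forall>t\<in>S. 0 \<le> x t) \<and> wt B c = wt B b - (\<Sum>t\<in>S. x t *\<^sub>R root t)"
proof -
  obtain w where w: "fst ` set w \<subseteq> S" "\<forall>x\<in>set w. snd x \<le> 0" "opw B w b = Some c"
    using assms(3) unfolding f_orbit_iff by blast
  have "wt B c = wt B b - (\<Sum>t\<in>S. (- word_coeff w t) *\<^sub>R root t)"
    using opw_wt[OF assms(1,2) finite_S w(1,3)] by (simp add: sum_negf)
  then show ?thesis using word_coeff_nonpos[OF w(2)] by (intro exI[of _ "\<lambda>t. - word_coeff w t"]) auto
qed

text \<open>If an f-word keeps the weight, its exponents add up to zero for each generator by
  independence of the roots; being nonpositive, they are all zero.\<close>

lemma f_orbit_top:
  assumes B: "is_crystal S root coroot B" "b \<in> carrier B" "c \<in> f_orbit S B b" and eq: "wt B c = wt B b"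
  shows "c = b"
proof -
  obtain w where w: "fst ` set w \<subseteq> S" "\<forall>x\<in>set w. snd x \<le> 0" "opw B w b = Some c"
    using assms(3) unfolding f_orbit_iff by blast
  have "(\<Sum>t\<in>S. word_coeff w t *\<^sub>R root t) = 0"
    using opw_wt[OF B(1,2) finite_S w(1,3)] eq by simp
  then have "word_coeff w t = 0" if "t \<in> S" for t using roots_independent that by blast
  then have "\<forall>x\<in>set w. snd x = 0" using word_coeff_zero[OF w(2)] w(1) by blast
  then show ?thesis using opw_zero[OF B(1,2) w(1)] w(3) by simp
qed

section \<open>Concatenation realizes the tensor product; existence of the closed family\<close>

section \<open>Concatenation of paths\<close>

text \<open>Both paths run at double speed, one after the other. A plain sum works because
  \<open>q\<close> is zero at negative times and \<open>p\<close> is constant from time 1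
  on.\<close>

definition cat :: "(real \<Rightarrow> 'v) \<Rightarrow> (real \<Rightarrow> 'v) \<Rightarrow> real \<Rightarrow> 'v" where
  "cat p q t = p (2 * t) + q (2 * t - 1)"

lemma proj_cat: "proj (cat p q) s t = proj p s (2 * t) + proj q s (2 * t - 1)"
  by (simp add: proj_def cat_def coroot_simps)

lemma cat_paths: assumes p: "p \<in> paths" and q: "q \<in> paths" shows "cat p q \<in> paths"
proof -
  have "cpath (proj (cat p q) s)" if s: "s \<in> S" for s
  proof -
    note cp = paths_proj[OF p s] and cq = paths_proj[OF q s]
    have "continuous_on UNIV (\<lambda>t. proj p s (2 * t) + proj q s (2 * t - 1))"
      by (intro continuous_on_add continuous_on_compose2[OF cpath_cont[OF cp, of UNIV]]
          continuous_on_compose2[OF cpath_cont[OF cq, of UNIV]] continuous_intros) auto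
    then have "continuous_on UNIV (proj (cat p q) s)" by (simp add: proj_cat[abs_def])
    moreover have "proj (cat p q) s t = 0" if "t \<le> 0" for t using cpath_0[OF cp] cpath_0[OF cq] that by (simp add: proj_cat)
    moreover have "proj (cat p q) s t = proj (cat p q) s 1" if "t \<ge> 1" for t
      using cpath_1[OF cp, of "2 * t"] cpath_1[OF cp, of 2] cpath_1[OF cq, of "2 * t - 1"] that by (simp add: proj_cat)
    ultimately show ?thesis unfolding cpath_def by blast
  qed
  moreover have "cat p q t = 0" if "t \<le> 0" for t using paths_0[OF p] paths_0[OF q] that by (simp add: cat_def)
  moreover have "cat p q t = cat p q 1" if "t \<ge> 1" for t
    using paths_1[OF p, of "2 * t"] paths_1[OF p, of 2] paths_1[OF q, of "2 * t - 1"] that by (simp add: cat_def)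
  ultimately show ?thesis unfolding paths_def by blast
qed

lemma cat_1: "p \<in> paths \<Longrightarrow> cat p q 1 = p 1 + q 1"
  using paths_1[of p 2] by (simp add: cat_def)

lemma cat_inj:
  assumes "p \<in> paths" "q \<in> paths" "p' \<in> paths" "q' \<in> paths" and eq: "cat p q = cat p' q'"
  shows "p = p'" "q = q'"
proof -
  have *: "p t = p' t" if "t \<le> 1" for t
    using fun_cong[OF eq, of "t / 2"] paths_0[OF assms(2), of "t - 1"] paths_0[OF assms(4), of "t - 1"] that
    by (simp add: cat_def)
  then show pp: "p = p'" using paths_1[OF assms(1)] paths_1[OF assms(3)] by (metis ext linear order_refl)
  show "q = q'"
  proof
    fix t show "q t = q' t" using fun_cong[OF eq, of "t / 2 + 1 / 2"] pp by (simp add: cat_def)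
  qed
qed

lemma run_cat_left:
  assumes p: "p \<in> paths" and q: "q \<in> paths" and s: "s \<in> S" and t: "2 * t \<le> 1"
  shows "run (proj (cat p q) s) t = run (proj p s) (2 * t)"
proof (rule antisym)
  note c = paths_proj[OF cat_paths[OF p q] s] and cp = paths_proj[OF p s] and cq = paths_proj[OF q s]
  show "run (proj (cat p q) s) t \<le> run (proj p s) (2 * t)"
  proof (rule run_le[OF c])
    fix u assume "u \<le> t"
    then show "- proj (cat p q) s u \<le> run (proj p s) (2 * t)"
      using run_ge[OF cp, of "2 * u" "2 * t"] cpath_0[OF cq, of "2 * u - 1"] t by (simp add: proj_cat)
  qed
  obtain u where u: "u \<le> 2 * t" "run (proj p s) (2 * t) = - proj p s u" using run_attained[OF cp] by blast
  then show "run (proj p s) (2 * t) \<le> run (proj (cat p q) s) t"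
    using run_ge[OF c, of "u / 2" t] cpath_0[OF cq, of "u - 1"] t by (simp add: proj_cat)
qed

lemma run_cat_right:
  assumes p: "p \<in> paths" and q: "q \<in> paths" and s: "s \<in> S" and t: "1 \<le> 2 * t"
  shows "run (proj (cat p q) s) t = p_eps s p + max 0 (run (proj q s) (2 * t - 1) - p_phi s p)"
proof -
  note c = paths_proj[OF cat_paths[OF p q] s] and cp = paths_proj[OF p s] and cq = paths_proj[OF q s]
  have p1: "proj p s 1 = coroot s (p 1)" using s by (simp add: proj_def)
  have "run (proj (cat p q) s) t = max (p_eps s p) (run (proj q s) (2 * t - 1) - proj p s 1)"
  proof (rule antisym)
    show "run (proj (cat p q) s) t \<le> max (p_eps s p) (run (proj q s) (2 * t - 1) - proj p s 1)"
    proof (rule run_le[OF c])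
      fix u assume u: "u \<le> t"
      show "- proj (cat p q) s u \<le> max (p_eps s p) (run (proj q s) (2 * t - 1) - proj p s 1)"
      proof (cases "2 * u \<le> 1")
        case True
        then show ?thesis using run_ge[OF cp, of "2 * u" 1] cpath_0[OF cq, of "2 * u - 1"] by (simp add: proj_cat p_eps_def)
      next
        case False
        then show ?thesis
          using run_ge[OF cq, of "2 * u - 1" "2 * t - 1"] cpath_1[OF cp, of "2 * u"] u by (simp add: proj_cat)
      qed
    qed
    have "p_eps s p \<le> run (proj (cat p q) s) t"
    proof -
      obtain u where u: "u \<le> 1" "p_eps s p = - proj p s u" using run_attained[OF cp] unfolding p_eps_def by blast
      then show ?thesis using run_ge[OF c, of "u / 2" t] cpath_0[OF cq, of "u - 1"] t by (simp add: proj_cat)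
    qed
    moreover have "run (proj q s) (2 * t - 1) - proj p s 1 \<le> run (proj (cat p q) s) t"
    proof -
      obtain u' where u': "u' \<le> 2 * t - 1" "run (proj q s) (2 * t - 1) = - proj q s u'" using run_attained[OF cq] by blast
      \<comment> \<open>The supremum may be attained at a negative time, where \<open>q\<close> is
        zero; moved to time 0, it falls where \<open>p\<close> has already ended.\<close>
      define u where "u = max u' 0"
      have u: "u \<le> 2 * t - 1" "run (proj q s) (2 * t - 1) = - proj q s u" "0 \<le> u"
        using u' t cpath_0[OF cq, of u'] cpath_0[OF cq, of 0] by (auto simp: u_def max_def)
      then show ?thesis
        using run_ge[OF c, of "u / 2 + 1 / 2" t] cpath_1[OF cp, of "u + 1"] by (simp add: proj_cat)
    qed
    ultimately show "max (p_eps s p) (run (proj q s) (2 * t - 1) - proj p s 1) \<le> run (proj (cat p q) s) t" by simp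
  qed
  then show ?thesis by (simp add: p_phi_def p1 max_def)
qed

lemma p_eps_cat:
  assumes "p \<in> paths" "q \<in> paths" "s \<in> S"
  shows "p_eps s (cat p q) = p_eps s p + max 0 (p_eps s q - p_phi s p)"
  using run_cat_right[OF assms, of 1] by (simp add: p_eps_def)

lemma p_phi_cat:
  assumes "p \<in> paths" "q \<in> paths" "s \<in> S"
  shows "p_phi s (cat p q) = p_phi s q + max 0 (p_phi s p - p_eps s q)"
  using p_eps_cat[OF assms] assms(3) by (simp add: p_phi_def cat_1[OF assms(1)] coroot_simps max_def)

text \<open>By \<open>run_cat_right\<close> the second factor receives only the excess of its
  running supremum over \<open>p_phi s p\<close>, and \<open>lower_raise_partial\<close> identifies
  this with a raising operator applied to \<open>q\<close>.\<close>

lemma raise_cat: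
  assumes p: "p \<in> paths" and q: "q \<in> paths" and s: "s \<in> S"
  shows "\<exists>q1. p_op s (max 0 (p_eps s q - p_phi s p)) (Some q) = Some q1 \<and> raise s (cat p q) = cat (raise s p) q1"
proof -
  define \<rho> where "\<rho> = max 0 (p_eps s q - p_phi s p)"
  have nn: "0 \<le> p_phi s p" "0 \<le> p_eps s q" "0 \<le> p_phi s q"
    using p_phi_nonneg[OF p s] p_eps_nonneg[OF q s] p_phi_nonneg[OF q s] by auto
  have rho: "0 \<le> \<rho>" "\<rho> \<le> p_eps s q" using nn by (auto simp: \<rho>_def)
  define q1 where "q1 = lower s (p_eps s q - \<rho>) (raise s q)"
  have op: "p_op s \<rho> (Some q) = Some q1" using rho nn by (simp add: p_op_def q1_def)
  have le: "run (proj q s) u \<le> p_eps s q" for u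
    using run_mono[OF paths_proj[OF q s], of u 1] run_1[OF paths_proj[OF q s], of u] by (cases "u \<le> 1") (auto simp: p_eps_def)
  have q1: "q1 u = q u + max 0 (run (proj q s) u - p_phi s p) *\<^sub>R root s" for u
  proof -
    have "max 0 (run (proj q s) u - (p_eps s q - \<rho>)) = max 0 (run (proj q s) u - p_phi s p)"
      using le[of u] by (simp add: \<rho>_def max_def)
    then show ?thesis using lower_raise_partial[OF q s rho(1), of u] by (simp add: q1_def)
  qed
  have "raise s (cat p q) t = cat (raise s p) q1 t" for t
  proof (cases "2 * t \<le> 1")
    case True
    then have "run (proj q s) (2 * t - 1) = 0" using run_0[OF paths_proj[OF q s]] by simp
    then have "max 0 (run (proj q s) (2 * t - 1) - p_phi s p) = 0" using nn by simp
    then show ?thesis using run_cat_left[OF p q s True] by (simp add: raise_def cat_def q1)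
  next
    case False
    then have t: "1 \<le> 2 * t" by simp
    have "run (proj p s) (2 * t) = p_eps s p" using run_1[OF paths_proj[OF p s] t] by (simp add: p_eps_def)
    then show ?thesis using run_cat_right[OF p q s t] by (simp add: raise_def cat_def q1 algebra_simps)
  qed
  then show ?thesis using op unfolding \<rho>_def by blast
qed

lemma cat_amounts:
  fixes e1 f1 e2 f2 r :: real
  assumes "0 \<le> e1" "0 \<le> f1" "0 \<le> e2" "0 \<le> f2"
  defines "\<sigma> \<equiv> f1 - e2"
  defines "r1 \<equiv> max r (- \<sigma>) - max 0 (- \<sigma>)" and "r2 \<equiv> min r (- \<sigma>) + max 0 \<sigma>"
  shows "- (f2 + max 0 \<sigma>) \<le> r \<Longrightarrow> r \<le> e1 + max 0 (- \<sigma>) \<Longrightarrow> - f1 \<le> r1 \<and> r1 \<le> e1 \<and> - f2 \<le> r2 \<and> r2 \<le> e2"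
    and "e1 - r1 + max 0 ((e2 - r2) - (f1 + r1)) = e1 + max 0 (e2 - f1) - r"
    and "max 0 ((e2 - r2) - (f1 + r1)) + r2 = max 0 (e2 - f1)"
proof -
  have e2: "e2 = f1 - \<sigma>" by (simp add: \<sigma>_def)
  show "- (f2 + max 0 \<sigma>) \<le> r \<Longrightarrow> r \<le> e1 + max 0 (- \<sigma>) \<Longrightarrow> - f1 \<le> r1 \<and> r1 \<le> e1 \<and> - f2 \<le> r2 \<and> r2 \<le> e2"
    using assms(1-4) unfolding r1_def r2_def e2
    by (cases "\<sigma> \<ge> 0"; cases "r \<ge> - \<sigma>"; simp add: max_def min_def)
  show "e1 - r1 + max 0 ((e2 - r2) - (f1 + r1)) = e1 + max 0 (e2 - f1) - r"
    "max 0 ((e2 - r2) - (f1 + r1)) + r2 = max 0 (e2 - f1)"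
    unfolding r1_def r2_def e2 by (cases "\<sigma> \<ge> 0"; cases "r \<ge> - \<sigma>"; simp add: max_def min_def)+
qed

text \<open>Vanishing is matched by the bounds on the amounts. Otherwise both sides are compared by
  \<open>p_op_eq_Some_iff\<close>: their tops agree because the amounts by which the second factor
  is raised add up (\<open>cat_amounts\<close>).\<close>

lemma p_op_cat:
  assumes p: "p \<in> paths" and q: "q \<in> paths" and s: "s \<in> S"
  defines "\<sigma> \<equiv> p_phi s p - p_eps s q"
  shows "p_op s r (Some (cat p q)) = map_option (case_prod cat)
    (tensor_opt (p_op s (max r (- \<sigma>) - max 0 (- \<sigma>)) (Some p)) (p_op s (min r (- \<sigma>) + max 0 \<sigma>) (Some q)))"
proof -
  define r1 r2 where "r1 = max r (- \<sigma>) - max 0 (- \<sigma>)" and "r2 = min r (- \<sigma>) + max 0 \<sigma>"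
  note nn = p_eps_nonneg[OF p s] p_phi_nonneg[OF p s] p_eps_nonneg[OF q s] p_phi_nonneg[OF q s]
  note am = cat_amounts[OF nn, of r, folded \<sigma>_def, folded r1_def r2_def]
  have ec: "p_eps s (cat p q) = p_eps s p + max 0 (- \<sigma>)" and fc: "p_phi s (cat p q) = p_phi s q + max 0 \<sigma>"
    using p_eps_cat[OF p q s] p_phi_cat[OF p q s] by (auto simp: \<sigma>_def)
  have "p_op s r (Some (cat p q)) = map_option (case_prod cat) (tensor_opt (p_op s r1 (Some p)) (p_op s r2 (Some q)))"
  proof (cases "p_op s r1 (Some p) = None \<or> p_op s r2 (Some q) = None")
    case True
    then have "\<not> (- p_phi s p \<le> r1 \<and> r1 \<le> p_eps s p \<and> - p_phi s q \<le> r2 \<and> r2 \<le> p_eps s q)"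
      unfolding p_op_None_iff by blast
    then have "p_op s r (Some (cat p q)) = None" unfolding p_op_None_iff ec fc using am(1) by blast
    then show ?thesis using True by auto
  next
    case False
    then obtain p' q' where op: "p_op s r1 (Some p) = Some p'" "p_op s r2 (Some q) = Some q'" by auto
    note P = p_op_Some[OF p s op(1)] and Q = p_op_Some[OF q s op(2)]
    obtain q1 where q1: "p_op s (max 0 (p_eps s q - p_phi s p)) (Some q) = Some q1" "raise s (cat p q) = cat (raise s p) q1"
      using raise_cat[OF p q s] by blast
    obtain q1' where q1': "p_op s (max 0 (p_eps s q' - p_phi s p')) (Some q') = Some q1'" "raise s (cat p' q') = cat (raise s p') q1'"
      using raise_cat[OF P(1) Q(1) s] by blast
    have "Some q1' = p_op s (max 0 (p_eps s q' - p_phi s p') + r2) (Some q)"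
      using p_op_add[OF q s op(2)] q1'(1) by simp
    also have "max 0 (p_eps s q' - p_phi s p') + r2 = max 0 (p_eps s q - p_phi s p)"
      using am(3) by (simp add: P(3) Q(2))
    finally have "q1' = q1" using q1(1) by simp
    then have "raise s (cat p' q') = raise s (cat p q)" using q1(2) q1'(2) P(4) by simp
    moreover have "p_eps s (cat p' q') = p_eps s (cat p q) - r"
      unfolding p_eps_cat[OF P(1) Q(1) s] p_eps_cat[OF p q s] using am(2) by (simp add: P(2,3) Q(2))
    ultimately have "p_op s r (Some (cat p q)) = Some (cat p' q')"
      using p_op_eq_Some_iff[OF cat_paths[OF p q] s cat_paths[OF P(1) Q(1)]] by simp
    then show ?thesis using op by simp
  qed
  then show ?thesis by (simp only: r1_def r2_def)
qed

lemma opw_tensor_cat: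
  assumes p: "p \<in> paths" and q: "q \<in> paths"
  shows "fst ` set w \<subseteq> S \<Longrightarrow>
    map_option (case_prod cat) (opw (tensor (path_crystal K1) (path_crystal K2)) w (p, q)) = opw PC w (cat p q) \<and>
    (\<forall>p' q'. opw (tensor (path_crystal K1) (path_crystal K2)) w (p, q) = Some (p', q') \<longrightarrow> p' \<in> paths \<and> q' \<in> paths)"
proof (induction w)
  case Nil then show ?case using p q by simp
next
  case (Cons x w)
  obtain s r where x: "x = (s, r)" by (cases x)
  have s: "s \<in> S" and w: "fst ` set w \<subseteq> S" using Cons.prems x by auto
  show ?case
  proof (cases "opw (tensor (path_crystal K1) (path_crystal K2)) w (p, q)")
    case None
    then have "opw PC w (cat p q) = None" using Cons.IH[OF w] by simp
    then show ?thesis using None by (simp add: x tensor_simps p_op_def)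
  next
    case (Some d)
    obtain a b where d: "d = (a, b)" by (cases d)
    have ab: "a \<in> paths" "b \<in> paths" and X: "opw PC w (cat p q) = Some (cat a b)"
      using Cons.IH[OF w] Some d by auto
    have "tensor_sigma (path_crystal K1) (path_crystal K2) s a b = p_phi s a - p_eps s b"
      by (simp add: tensor_sigma_def)
    then show ?thesis
      using p_op_cat[OF ab s, of r] p_op_Some(1)[OF ab(1) s] p_op_Some(1)[OF ab(2) s]
      by (auto simp: x Some d X tensor_simps tensor_opt_eq_Some)
  qed
qed

section \<open>Existence\<close>

definition segment :: "'v \<Rightarrow> real \<Rightarrow> 'v" where
  "segment \<mu> t = max 0 (min 1 t) *\<^sub>R \<mu>"

definition path_family :: "'v \<Rightarrow> (real \<Rightarrow> 'v, 'w, 'v) crystal" where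
  "path_family \<mu> = path_crystal (f_orbit S PC (segment \<mu>))"

lemma segment_dominant:
  assumes "\<mu> \<in> closed_chamber S coroot" shows "dominant (segment \<mu>)"
proof -
  have pr: "proj (segment \<mu>) s = (\<lambda>t. coroot s \<mu> * max 0 (min 1 t))" if "s \<in> S" for s
    using that by (simp add: proj_def segment_def coroot_simps fun_eq_iff)
  have c: "cpath (\<lambda>t. max 0 (min 1 t) :: real)"
    unfolding cpath_def by (auto intro!: continuous_intros)
  have cp: "cpath (proj (segment \<mu>) s)" if "s \<in> S" for s unfolding pr[OF that] by (rule cpath_mult[OF c])
  then have "segment \<mu> \<in> paths" unfolding paths_def by (auto simp: segment_def)
  moreover have "p_eps s (segment \<mu>) = 0" if s: "s \<in> S" for s
    unfolding p_eps_def
  proof (rule run_nonneg_path[OF cp[OF s]])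
    show "0 \<le> proj (segment \<mu>) s t" for t using assms s by (simp add: pr closed_chamber_def)
  qed
  ultimately show ?thesis by (simp add: dominant_def)
qed

lemma segment_1 [simp]: "segment \<mu> 1 = \<mu>"
  by (simp add: segment_def)

lemma cat_dominant:
  assumes "dominant p" "dominant q" shows "dominant (cat p q)"
proof -
  have pq: "p \<in> paths" "q \<in> paths" using assms by (auto simp: dominant_def)
  have "p_eps s (cat p q) = 0" if "s \<in> S" for s
    using p_eps_cat[OF pq that] p_phi_nonneg[OF pq(1) that] assms that by (simp add: dominant_def)
  then show ?thesis using cat_paths[OF pq] by (simp add: dominant_def)
qed

lemma path_family_highest:
  assumes "\<mu> \<in> closed_chamber S coroot"
  shows "highest_weight_element S (path_family \<mu>) \<mu> (segment \<mu>)"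
  unfolding highest_weight_element_def path_family_def path_crystal_simps
proof (intro conjI ballI allI impI)
  show "segment \<mu> \<in> f_orbit S PC (segment \<mu>)" by (rule f_orbit_refl)
  show "segment \<mu> 1 = \<mu>" by simp
  fix s and r :: real assume "s \<in> S" "r > 0"
  then show "p_op s r (Some (segment \<mu>)) = None"
    using segment_dominant[OF assms] by (simp add: p_op_None_iff dominant_def)
next
  show "f_orbit S PC (segment \<mu>) = f_orbit S (path_crystal (f_orbit S PC (segment \<mu>))) (segment \<mu>)"
    by (rule fun_cong[OF f_orbit_path_crystal, symmetric])
qed

lemma path_family_crystal:
  assumes "\<mu> \<in> closed_chamber S coroot"
  shows "is_crystal S root coroot (path_family \<mu>)" "normal_crystal S (path_family \<mu>)"
  unfolding path_family_def using dominant_orbit_crystal[OF segment_dominant[OF assms]] by blast+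

lemma highest_weight_element_unique:
  assumes "is_crystal S root coroot B" "highest_weight_element S B \<mu> b" "highest_weight_element S B \<mu> c"
  shows "c = b"
proof (rule f_orbit_top[OF assms(1)])
  have b: "b \<in> carrier B" "wt B b = \<mu>" "carrier B = f_orbit S B b"
    and c: "c \<in> carrier B" "wt B c = \<mu>"
    using assms(2,3) unfolding highest_weight_element_def by blast+
  show "b \<in> carrier B" by (rule b(1))
  show "c \<in> f_orbit S B b" using c(1) unfolding b(3) .
  show "wt B c = wt B b" unfolding b(2) c(2) ..
qed

theorem path_family_closed: "closed_family S root coroot path_family"
  unfolding closed_family_def Let_def
proof (intro ballI allI impI)
  fix \<mu> \<nu> b c
  assume mu: "\<mu> \<in> closed_chamber S coroot" and nu: "\<nu> \<in> closed_chamber S coroot"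
    and b: "highest_weight_element S (path_family \<mu>) \<mu> b" and c: "highest_weight_element S (path_family \<nu>) \<nu> c"
  have bc: "b = segment \<mu>" "c = segment \<nu>"
    using highest_weight_element_unique[OF path_family_crystal(1)[OF mu] path_family_highest[OF mu] b]
      highest_weight_element_unique[OF path_family_crystal(1)[OF nu] path_family_highest[OF nu] c] by auto
  have d: "dominant b" "dominant c" using segment_dominant mu nu bc by auto
  have P: "b \<in> paths" "c \<in> paths" using d by (auto simp: dominant_def)
  have mn: "\<mu> + \<nu> \<in> closed_chamber S coroot" using mu nu by (simp add: closed_chamber_def coroot_simps)
  define T where "T = tensor (path_family \<mu>) (path_family \<nu>)"
  define R where "R = T\<lparr>carrier := f_orbit S T (b, c)\<rparr>"
  have T: "map_option (case_prod cat) (opw T w (b, c)) = opw PC w (cat b c)"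
    "opw T w (b, c) = Some (p, q) \<Longrightarrow> p \<in> paths \<and> q \<in> paths" if "fst ` set w \<subseteq> S" for w p q
    using opw_tensor_cat[OF P that] unfolding T_def path_family_def by blast+
  have Rs: "carrier R = f_orbit S T (b, c)" "op_e R = op_e T" "wt R = wt T" "eps R = eps T" "phi R = phi T"
    by (simp_all add: R_def)
  have opwR: "opw R = opw T" by (simp add: opw_def fun_eq_iff Rs)
  have inP: "p \<in> paths \<and> q \<in> paths" if "(p, q) \<in> f_orbit S T (b, c)" for p q
    using that T(2) unfolding f_orbit_iff by blast
  have catP: "case_prod cat x \<in> paths" if "x \<in> f_orbit S T (b, c)" for x
    using inP[of "fst x" "snd x"] that cat_paths by (cases x) auto
  have inj: "x = y" if "case_prod cat x = case_prod cat y" "fst x \<in> paths \<and> snd x \<in> paths" "fst y \<in> paths \<and> snd y \<in> paths" for x y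
    using that cat_inj by (cases x; cases y) auto
  have dcat: "dominant (cat b c)" by (rule cat_dominant[OF d])
  have pq: "fst x \<in> paths \<and> snd x \<in> paths" if "x \<in> carrier R" for x
    using inP[of "fst x" "snd x"] that by (simp add: Rs)
  have k1: "case_prod cat x \<in> carrier PC" if "x \<in> carrier R" for x
    using catP that by (simp add: Rs)
  have k2: "inj_on (case_prod cat) (carrier R)"
    using inj pq by (intro inj_onI) blast
  have k3: "same_data S R PC x (case_prod cat x)" if "x \<in> carrier R" for x
  proof (cases x)
    case (Pair p q)
    then have "p \<in> paths" "q \<in> paths" using pq[OF that] by auto
    then show ?thesis
      unfolding same_data_def Rs T_def path_family_def Pair
      by (simp add: tensor_simps cat_1 p_eps_cat p_phi_cat tensor_sigma_def del: ereal_max)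
  qed
  have k4: "op_e R s r None = None" for s r by (simp add: Rs T_def tensor_simps)
  have k6: "map_option (case_prod cat) (op_e R s r (Some x)) = op_e PC s r (Some (case_prod cat x))"
    if s: "s \<in> S" and x: "x \<in> carrier R" for s r x
  proof (cases x)
    case (Pair p q)
    then have "p \<in> paths" "q \<in> paths" using pq[OF x] by auto
    from opw_tensor_cat[OF this, of "[(s, r)]" "f_orbit S PC (segment \<mu>)" "f_orbit S PC (segment \<nu>)"] s
    show ?thesis by (simp add: Rs T_def path_family_def Pair)
  qed
  \<comment> \<open>Stability of the orbit: for the concatenated path \<open>dominant_orbit\<close>
    supplies an f-word, and injectivity of \<open>cat\<close> carries its result back to
    pairs.\<close>
  have k5: "y \<in> carrier R" if s: "s \<in> S" and x: "x \<in> carrier R" and y: "op_e R s r (Some x) = Some y" for s r x y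
  proof -
    obtain w where w: "fst ` set w \<subseteq> S" "opw T w (b, c) = Some x" using x unfolding Rs f_orbit_iff by blast
    have w': "fst ` set ((s, r) # w) \<subseteq> S" "opw T ((s, r) # w) (b, c) = Some y" using w s y by (auto simp: Rs)
    have "opw PC ((s, r) # w) (cat b c) = Some (case_prod cat y)" using T(1)[OF w'(1)] w'(2) by simp
    then have "case_prod cat y \<in> f_orbit S PC (cat b c)" by (rule dominant_orbit[OF dcat w'(1)])
    then obtain v where v: "fst ` set v \<subseteq> S" "\<forall>x\<in>set v. snd x \<le> 0" "opw PC v (cat b c) = Some (case_prod cat y)"
      unfolding f_orbit_iff by blast
    then obtain z where z: "opw T v (b, c) = Some z" "case_prod cat z = case_prod cat y" using T(1)[OF v(1)] by auto
    have "fst z \<in> paths \<and> snd z \<in> paths" using T(2)[OF v(1), of "fst z" "snd z"] z(1) by simp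
    moreover have "fst y \<in> paths \<and> snd y \<in> paths" using T(2)[OF w'(1), of "fst y" "snd y"] w'(2) by simp
    ultimately have "z = y" by (rule inj[OF z(2)])
    then show ?thesis unfolding Rs f_orbit_iff using v z by blast
  qed
  note pb = crystal_pullback[OF PC_crystal k1 k2 k3 k4 k5 k6]
  have R: "is_crystal S root coroot R" "normal_crystal S R"
    using pb(1) pb(2) path_crystal_normal[of paths] by auto
  have bR: "(b, c) \<in> carrier R" by (simp add: Rs f_orbit_refl)
  have gen: "carrier R = f_orbit S R (b, c)" by (simp add: set_eq_iff Rs f_orbit_iff opwR)
  have wtR: "wt R (b, c) = \<mu> + \<nu>" by (simp add: Rs T_def tensor_simps path_family_def bc)
  let ?B = "path_family (\<mu> + \<nu>)" and ?e = "segment (\<mu> + \<nu>)"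
  note Bc = path_family_crystal[OF mn] and Bh = path_family_highest[OF mn]
  have Bh': "?e \<in> carrier ?B" "wt ?B ?e = \<mu> + \<nu>" "carrier ?B = f_orbit S ?B ?e"
    using Bh by (auto simp: highest_weight_element_def)
  have "crystal_iso S R ?B"
  proof (rule sim_iso[OF R(1) Bc(1) bR Bh'(1) gen Bh'(3)])
    show "x = (b, c)" if "x \<in> carrier R" "wt R x = wt R (b, c)" for x
      using f_orbit_top[OF R(1) bR] that gen by blast
    show "x = ?e" if "x \<in> carrier ?B" "wt ?B x = wt ?B ?e" for x
      using f_orbit_top[OF Bc(1) Bh'(1)] that Bh'(3) by blast
    show "crystal_sim S R (b, c) ?B ?e"
    proof (rule crystal_simI_normal[OF R(1) Bc(1) R(2) Bc(2) finite_S bR Bh'(1)])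
      show "wt R (b, c) = wt ?B ?e" using wtR Bh'(2) by simp
      fix w :: "('w \<times> real) list" assume w: "fst ` set w \<subseteq> S"
      have "opw R w (b, c) = None \<longleftrightarrow> opw PC w (cat b c) = None" unfolding opwR T(1)[OF w, symmetric] by simp
      \<comment> \<open>The concatenation and the straight path are both dominant and have the same
        endpoint.\<close>
      also have "\<dots> \<longleftrightarrow> opw PC w ?e = None"
        using dominant_same_None[OF dcat segment_dominant[OF mn] _ w] cat_1[OF P(1), of c] bc by simp
      finally show "opw R w (b, c) = None \<longleftrightarrow> opw ?B w ?e = None" unfolding path_family_def opw_path_crystal[of "f_orbit S PC ?e"] .
    qed
  qed
  then show "is_crystal S root coroot (tensor (path_family \<mu>) (path_family \<nu>)
      \<lparr>carrier := f_orbit S (tensor (path_family \<mu>) (path_family \<nu>)) (b, c)\<rparr>) \<and>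
    crystal_iso S (tensor (path_family \<mu>) (path_family \<nu>)
      \<lparr>carrier := f_orbit S (tensor (path_family \<mu>) (path_family \<nu>)) (b, c)\<rparr>) (path_family (\<mu> + \<nu>))"
    using R(1) unfolding R_def T_def by blast
qed

theorem path_family_highest_weight_normal: "highest_weight_normal_family S root coroot path_family"
  unfolding highest_weight_normal_family_def of_highest_weight_def
  using path_family_crystal path_family_highest by blast

end

section \<open>Uniqueness: string bounds, traces and their recursion\<close>

section \<open>Uniqueness\<close>

lemma opw_tensor_carrier:
  assumes "is_crystal S \<alpha> \<alpha>v B1" "is_crystal S \<alpha> \<alpha>v B2" "b1 \<in> carrier B1" "b2 \<in> carrier B2"
  shows "fst ` set w \<subseteq> S \<Longrightarrow> opw (tensor B1 B2) w (b1, b2) = Some (c1, c2) \<Longrightarrow> c1 \<in> carrier B1 \<and> c2 \<in> carrier B2"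
proof (induction w arbitrary: c1 c2)
  case Nil then show ?case using assms by simp
next
  case (Cons x w)
  obtain s r where x: "x = (s, r)" by (cases x)
  have s: "s \<in> S" and w: "fst ` set w \<subseteq> S" using Cons.prems x by auto
  obtain d where d: "opw (tensor B1 B2) w (b1, b2) = Some d"
    using Cons.prems(2) x by (cases "opw (tensor B1 B2) w (b1, b2)") (auto simp: tensor_simps)
  obtain d1 d2 where dd: "d = (d1, d2)" by (cases d)
  have dc: "d1 \<in> carrier B1" "d2 \<in> carrier B2" using Cons.IH[OF w] d dd by auto
  show ?case
    using Cons.prems(2) cr_closed[OF assms(1) s dc(1)] cr_closed[OF assms(2) s dc(2)]
    by (auto simp: x d dd tensor_simps tensor_opt_eq_Some)
qed

lemma crystal_sim_refl: "crystal_sim S B b B b"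
  unfolding crystal_sim_def same_data_def by (auto intro: option.rel_refl)

lemma linked_refl: "linked S B b B b c c' \<Longrightarrow> c = c'"
  by (auto simp: linked_def)

text \<open>Divide [0, x] into n + 1 equal steps. The increments \<open>e\<close> and
  \<open>e'\<close> are unknown, but both lie between 0 and K x / (n + 1), and a maximum with the
  previous values does not amplify their difference. So the error never exceeds the bound of a
  single step, however many steps there are.\<close>

lemma recursion_determines:
  fixes h h' a :: "real \<Rightarrow> real"
  assumes h: "\<And>x y. 0 \<le> x \<Longrightarrow> x \<le> y \<Longrightarrow> y \<le> 1 \<Longrightarrow> \<exists>e. 0 \<le> e \<and> e \<le> K * (y - x) \<and> h y = max (h x) (e - a x)"
    and h': "\<And>x y. 0 \<le> x \<Longrightarrow> x \<le> y \<Longrightarrow> y \<le> 1 \<Longrightarrow> \<exists>e. 0 \<le> e \<and> e \<le> K * (y - x) \<and> h' y = max (h' x) (e - a x)"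
    and start: "h 0 = h' 0" and x: "0 \<le> x" "x \<le> 1"
  shows "h x = h' x"
proof -
  have step: "\<bar>h x - h' x\<bar> \<le> K * x / real (Suc n)" for n
  proof -
    obtain q where q: "q = x / real (Suc n)" by blast
    have q0: "0 \<le> q" using x by (simp add: q)
    define y where "y k = real k * q" for k
    have y01: "0 \<le> y k" "y k \<le> y (Suc k)" for k using q0 by (simp_all add: y_def algebra_simps)
    have yx: "y (Suc n) = x" by (simp add: y_def q)
    have mono: "y k \<le> x" if "k \<le> Suc n" for k
    proof -
      have "real k * x \<le> real (Suc n) * x" using that x by (intro mult_right_mono) auto
      then show ?thesis by (simp add: y_def q divide_le_eq mult.commute)
    qed
    have "\<bar>h (y k) - h' (y k)\<bar> \<le> K * x / real (Suc n)" if "k \<le> Suc n" for k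
      using that
    proof (induction k)
      case 0
      obtain e where "0 \<le> e" "e \<le> K * (x - 0)" using h[of 0 x] x by auto
      then have "0 \<le> K * x" by simp
      then show ?case using start by (simp add: y_def)
    next
      case (Suc k)
      have le: "y (Suc k) \<le> 1" using mono[OF Suc.prems] x by simp
      have "y (Suc k) - y k = q" by (simp add: y_def distrib_right)
      then have diff: "K * (y (Suc k) - y k) = K * x / real (Suc n)" by (simp add: q)
      obtain e where e: "0 \<le> e" "e \<le> K * (y (Suc k) - y k)" "h (y (Suc k)) = max (h (y k)) (e - a (y k))"
        using h[OF y01(1) y01(2) le] by blast
      obtain e' where e': "0 \<le> e'" "e' \<le> K * (y (Suc k) - y k)" "h' (y (Suc k)) = max (h' (y k)) (e' - a (y k))"
        using h'[OF y01(1) y01(2) le] by blast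
      have "\<bar>h (y k) - h' (y k)\<bar> \<le> K * x / real (Suc n)" using Suc by simp
      then show ?case unfolding e(3) e'(3) using e(1,2) e'(1,2) unfolding diff by linarith
    qed
    from this[of "Suc n"] show ?thesis by (simp add: yx)
  qed
  have "(\<lambda>n. K * x / real (Suc n)) \<longlonglongrightarrow> 0"
    using tendsto_mult[OF tendsto_const[of "K * x"] LIMSEQ_inverse_real_of_nat] by (simp add: field_simps)
  then have "\<bar>h x - h' x\<bar> \<le> 0"
    by (rule LIMSEQ_le_const) (use step in blast)
  then show ?thesis by simp
qed

context coxeter_realization
begin

text \<open>Normality provides both ends of the \<open>s\<close>-string through an element, and the
  reflected weight lies on the segment between their weights, whether or not an element of the
  string has that weight.\<close>

lemma act_convex_hull:
  assumes B: "is_crystal S root coroot B" "normal_crystal S B" and s: "s \<in> S"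
    and v: "v \<in> convex hull (wt B ` carrier B)"
  shows "act s v \<in> convex hull (wt B ` carrier B)"
proof -
  let ?P = "wt B ` carrier B"
  have "act s ` ?P \<subseteq> convex hull ?P"
  proof clarify
    fix c assume c: "c \<in> carrier B"
    obtain e where e: "e \<ge> 0" "eps B s c = ereal e" "op_e B s e (Some c) \<noteq> None" using normal_eps(1)[OF B(2) s c] by blast
    obtain f where f: "f \<ge> 0" "phi B s c = ereal f" "op_e B s (- f) (Some c) \<noteq> None" using normal_eps(2)[OF B(2) s c] by blast
    obtain a where a: "op_e B s e (Some c) = Some a" using e(3) by auto
    obtain b where b: "op_e B s (- f) (Some c) = Some b" using f(3) by auto
    have "wt B a = wt B c + e *\<^sub>R root s" "wt B b = wt B c + (- f) *\<^sub>R root s"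
      using cr_wt[OF B(1) s c a] cr_wt[OF B(1) s c b] by auto
    moreover have "wt B a \<in> ?P" "wt B b \<in> ?P" using cr_closed[OF B(1) s c a] cr_closed[OF B(1) s c b] by auto
    ultimately have ends: "wt B c + e *\<^sub>R root s \<in> ?P" "wt B c - f *\<^sub>R root s \<in> ?P" by auto
    have "f = e + coroot s (wt B c)" using cr_phi[OF B(1) s c] e(2) f(2) by simp
    then have act: "act s (wt B c) = wt B c - (f - e) *\<^sub>R root s" using act_S[OF s] by simp
    show "act s (wt B c) \<in> convex hull ?P"
    proof (cases "e + f = 0")
      case True
      then have "act s (wt B c) = wt B c" using act e(1) f(1) by simp
      then show ?thesis using c by (simp add: hull_inc)
    next
      case False
      then have ef: "e + f > 0" using e(1) f(1) by simp
      \<comment> \<open>The reflected weight is reached from the upper end by moving down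
        \<open>f\<close> of the total length \<open>e + f\<close>.\<close>
      define u where "u = f / (e + f)"
      have u: "0 \<le> u" "u \<le> 1" "u * (e + f) = f" using ef e(1) f(1) by (auto simp: u_def)
      have "(1 - u) *\<^sub>R (wt B c + e *\<^sub>R root s) + u *\<^sub>R (wt B c - f *\<^sub>R root s) = wt B c + (e - u * (e + f)) *\<^sub>R root s"
        by (simp add: algebra_simps)
      also have "\<dots> = act s (wt B c)" unfolding act u(3) by (simp add: algebra_simps)
      finally show ?thesis
        using convexD_alt[OF convex_convex_hull, of "wt B c + e *\<^sub>R root s" ?P "wt B c - f *\<^sub>R root s" u]
          hull_inc[OF ends(1), of convex] hull_inc[OF ends(2), of convex] u(1,2) by simp
    qed
  qed
  then have "convex hull (act s ` ?P) \<subseteq> convex hull ?P" by (rule hull_minimal[where S = convex]) (rule convex_convex_hull)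
  moreover have "act s ` (convex hull ?P) = convex hull (act s ` ?P)"
    using act_linear[OF S_carrier[OF s]] by (rule convex_hull_linear_image)
  ultimately show ?thesis using v by blast
qed

definition depth :: "'v \<Rightarrow> 'v \<Rightarrow> ('w \<Rightarrow> real) \<Rightarrow> bool" where
  "depth \<mu> v x \<longleftrightarrow> (\<forall>t\<in>S. 0 \<le> x t) \<and> v = \<mu> - (\<Sum>t\<in>S. x t *\<^sub>R root t)"

text \<open>The weights of a normal crystal need not be \<open>W\<close>-stable a priori, as strings might have gaps,
  but their convex hull is. Averaging a weight over \<open>W\<close> gives a bound that is linear in the highest weight.\<close>

lemma depth_bound:
  assumes B: "is_crystal S root coroot B" "normal_crystal S B" and b: "b \<in> carrier B" "carrier B = f_orbit S B b"
    and d: "d \<in> carrier B"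
  shows "\<exists>y. (\<forall>s\<in>S. (\<Sum>t\<in>S. y t * cartan s t) = real (card (carrier W)) * coroot s (wt B b)) \<and>
    (\<forall>x. depth (wt B b) (wt B d) x \<longrightarrow> (\<forall>t\<in>S. x t \<le> y t))"
proof -
  let ?P = "wt B ` carrier B" and ?\<mu> = "wt B b"
  have "?P \<subseteq> {v. \<exists>x. depth ?\<mu> v x}"
    using f_orbit_coeff[OF B(1) b(1)] b(2) by (auto simp: depth_def)
  moreover have "convex {v. \<exists>x. depth ?\<mu> v x}"
  proof (rule convexI)
    fix v v' and p q :: real
    assume "v \<in> {v. \<exists>x. depth ?\<mu> v x}" "v' \<in> {v. \<exists>x. depth ?\<mu> v x}" and pq: "0 \<le> p" "0 \<le> q" "p + q = 1"
    then obtain x x' where x: "depth ?\<mu> v x" "depth ?\<mu> v' x'" by auto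
    have v: "v = ?\<mu> - (\<Sum>t\<in>S. x t *\<^sub>R root t)" and v': "v' = ?\<mu> - (\<Sum>t\<in>S. x' t *\<^sub>R root t)"
      using x by (auto simp: depth_def)
    have "p *\<^sub>R v + q *\<^sub>R v' = (p + q) *\<^sub>R ?\<mu> - (\<Sum>t\<in>S. (p * x t + q * x' t) *\<^sub>R root t)"
      unfolding v v' by (simp add: scaleR_sum_right sum.distrib scaleR_diff_right scaleR_add_left)
    then have "depth ?\<mu> (p *\<^sub>R v + q *\<^sub>R v') (\<lambda>t. p * x t + q * x' t)"
      using x pq by (simp add: depth_def)
    then show "p *\<^sub>R v + q *\<^sub>R v' \<in> {v. \<exists>x. depth ?\<mu> v x}" by blast
  qed
  ultimately have hull: "convex hull ?P \<subseteq> {v. \<exists>x. depth ?\<mu> v x}" by (rule hull_minimal[where S = convex])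
  have actg: "act g v \<in> convex hull ?P" if g: "g \<in> carrier W" and v: "v \<in> convex hull ?P" for g v
  proof -
    obtain w where w: "set w \<subseteq> S" "val w = g" using val_surj[OF g] by blast
    have "foldr act w v \<in> convex hull ?P" using w(1) v by (induction w) (auto intro: act_convex_hull[OF B])
    then show ?thesis using foldr_act[OF w(1), of v] w(2) by simp
  qed
  define v where "v = wt B d"
  have vP: "v \<in> convex hull ?P" using d by (simp add: v_def hull_inc)
  have "\<forall>g\<in>carrier W. \<exists>x. depth ?\<mu> (act g v) x" using actg[OF _ vP] hull by blast
  then obtain X where X: "\<And>g. g \<in> carrier W \<Longrightarrow> depth ?\<mu> (act g v) (X g)" by metis
  define y where "y t = (\<Sum>g\<in>carrier W. X g t)" for t
  define A where "A = (\<Sum>g\<in>carrier W. act g v)"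
  have A: "A = real (card (carrier W)) *\<^sub>R ?\<mu> - (\<Sum>t\<in>S. y t *\<^sub>R root t)"
  proof -
    have "A = (\<Sum>g\<in>carrier W. ?\<mu> - (\<Sum>t\<in>S. X g t *\<^sub>R root t))"
      unfolding A_def using X by (intro sum.cong) (auto simp: depth_def)
    also have "\<dots> = real (card (carrier W)) *\<^sub>R ?\<mu> - (\<Sum>g\<in>carrier W. \<Sum>t\<in>S. X g t *\<^sub>R root t)"
      by (simp add: sum_subtractf sum_constant_scaleR)
    also have "(\<Sum>g\<in>carrier W. \<Sum>t\<in>S. X g t *\<^sub>R root t) = (\<Sum>t\<in>S. y t *\<^sub>R root t)"
      unfolding y_def scaleR_sum_left by (rule sum.swap)
    finally show ?thesis .
  qed
  \<comment> \<open>The sum over the orbit is fixed by every reflection, so every coroot vanishes on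
    it; written out, this is the Cartan system for \<open>y\<close>.\<close>
  have inv: "coroot s A = 0" if s: "s \<in> S" for s
  proof -
    note sc = S_carrier[OF s]
    have "act s A = (\<Sum>g\<in>carrier W. act s (act g v))" unfolding A_def by (rule linear_sum[OF act_linear[OF sc]])
    also have "\<dots> = (\<Sum>g\<in>carrier W. act (s \<otimes> g) v)" using sc by (intro sum.cong) (auto simp: act_mult)
    also have "\<dots> = A" unfolding A_def using s sc
      by (intro sum.reindex_bij_witness[where i = "\<lambda>g. s \<otimes> g" and j = "\<lambda>g. s \<otimes> g"]) (auto simp: S_cancel)
    finally have "coroot s A *\<^sub>R root s = 0" using act_S[OF s, of A] by simp
    then show ?thesis using root_nonzero[OF s] by simp
  qed
  have "(\<Sum>t\<in>S. y t * cartan s t) = real (card (carrier W)) * coroot s ?\<mu>" if s: "s \<in> S" for s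
    using inv[OF s] s unfolding A by (simp add: coroot_simps cartan_def)
  moreover have "x t \<le> y t" if x: "depth ?\<mu> (wt B d) x" and t: "t \<in> S" for x t
  proof -
    \<comment> \<open>The identity contributes the depth of the weight itself, and the other terms
      of \<open>y\<close> are nonnegative.\<close>
    have "depth ?\<mu> (wt B d) (X \<one>)" using X[of \<one>] by (simp add: act_one v_def)
    then have "x t = X \<one> t" using x roots_independent'[OF _ t, of x "X \<one>"] by (simp add: depth_def)
    also have "\<dots> \<le> y t" unfolding y_def
      using X t finite_carrier by (intro member_le_sum) (auto simp: depth_def)
    finally show ?thesis .
  qed
  ultimately show ?thesis by blast
qed

lemma depth_shift:
  assumes x: "depth \<mu> v x" and s: "s \<in> S" and x': "depth \<mu> (v + r *\<^sub>R root s) x'"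
  shows "x' s = x s - r"
proof -
  have "(\<Sum>t\<in>S. (x t - (if t = s then r else 0)) *\<^sub>R root t) = (\<Sum>t\<in>S. x t *\<^sub>R root t) - r *\<^sub>R root s"
    using s finite_S by (simp add: scaleR_diff_left sum_subtractf if_distrib[where f = "\<lambda>r. r *\<^sub>R _"] cong: if_cong)
  also have "(\<Sum>t\<in>S. x t *\<^sub>R root t) = \<mu> - v" using x by (simp add: depth_def)
  also have "\<mu> - v - r *\<^sub>R root s = \<mu> - (v + r *\<^sub>R root s)" by simp
  also have "\<dots> = (\<Sum>t\<in>S. x' t *\<^sub>R root t)" using x' by (simp add: depth_def)
  finally show ?thesis using roots_independent'[OF _ s, of "\<lambda>t. x t - (if t = s then r else 0)" x'] by simp
qed

end

locale closed_crystal_family = coxeter_realization W S act root coroot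
  for W :: "('w, 'x) monoid_scheme" (structure) and S
    and act :: "'w \<Rightarrow> 'v::real_vector \<Rightarrow> 'v" and root coroot +
  fixes B :: "'v \<Rightarrow> ('b, 'w, 'v) crystal"
  assumes family: "highest_weight_normal_family S root coroot B" and closed: "closed_family S root coroot B"
begin

abbreviation "chamber \<equiv> closed_chamber S coroot"

definition top :: "'v \<Rightarrow> 'b" where
  "top \<mu> = (SOME b. highest_weight_element S (B \<mu>) \<mu> b)"

lemma crystal: "\<mu> \<in> chamber \<Longrightarrow> is_crystal S root coroot (B \<mu>)"
  and normal: "\<mu> \<in> chamber \<Longrightarrow> normal_crystal S (B \<mu>)"
  using family unfolding highest_weight_normal_family_def by blast+

lemma top: assumes "\<mu> \<in> chamber" shows "highest_weight_element S (B \<mu>) \<mu> (top \<mu>)"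
  using family assms unfolding highest_weight_normal_family_def of_highest_weight_def top_def
  by (metis (mono_tags, lifting) someI_ex)

lemma top_carrier: "\<mu> \<in> chamber \<Longrightarrow> top \<mu> \<in> carrier (B \<mu>)"
  and top_wt: "\<mu> \<in> chamber \<Longrightarrow> wt (B \<mu>) (top \<mu>) = \<mu>"
  and carrier_eq: "\<mu> \<in> chamber \<Longrightarrow> carrier (B \<mu>) = f_orbit S (B \<mu>) (top \<mu>)"
  using top unfolding highest_weight_element_def by blast+

text \<open>Closedness in terms of words. The isomorphism sends the pair of tops to an element of
  the full highest weight, which only the top has.\<close>

lemma pair_sim:
  assumes m: "\<mu> \<in> chamber" and n: "\<nu> \<in> chamber"
  shows "crystal_sim S (tensor (B \<mu>) (B \<nu>)) (top \<mu>, top \<nu>) (B (\<mu> + \<nu>)) (top (\<mu> + \<nu>))"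
proof -
  have mn: "\<mu> + \<nu> \<in> chamber" using m n by (simp add: closed_chamber_def coroot_simps)
  let ?T = "tensor (B \<mu>) (B \<nu>)" and ?b = "(top \<mu>, top \<nu>)"
  define R where "R = ?T\<lparr>carrier := f_orbit S ?T ?b\<rparr>"
  have R: "is_crystal S root coroot R" "crystal_iso S R (B (\<mu> + \<nu>))"
    using closed[unfolded closed_family_def Let_def, rule_format, OF m n top[OF m] top[OF n]] by (auto simp: R_def)
  have "?b \<in> carrier R" by (simp add: R_def f_orbit_refl)
  from iso_sim[OF R(1) crystal[OF mn] R(2) this] obtain b' where
    b': "b' \<in> carrier (B (\<mu> + \<nu>))" "crystal_sim S R ?b (B (\<mu> + \<nu>)) b'" by blast
  have sim: "crystal_sim S ?T ?b (B (\<mu> + \<nu>)) b'"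
    using b'(2) unfolding crystal_sim_def same_data_def opw_def R_def by simp
  have "same_data S ?T (B (\<mu> + \<nu>)) ?b b'" using crystal_simD[OF sim, of "[]" ?b] by simp
  then have "wt (B (\<mu> + \<nu>)) b' = \<mu> + \<nu>" by (simp add: same_data_def tensor_simps top_wt m n)
  then have "b' = top (\<mu> + \<nu>)"
    using f_orbit_top[OF crystal[OF mn] top_carrier[OF mn]] b'(1) carrier_eq[OF mn] top_wt[OF mn] by simp
  then show ?thesis using sim by simp
qed

lemma scale_chamber: "\<theta> \<in> chamber \<Longrightarrow> 0 \<le> x \<Longrightarrow> x *\<^sub>R \<theta> \<in> chamber"
  by (simp add: closed_chamber_def coroot_simps)

lemma coeff_exists:
  assumes "\<mu> \<in> chamber" "d \<in> carrier (B \<mu>)" shows "\<exists>x. depth \<mu> (wt (B \<mu>) d) x"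
  using f_orbit_coeff[OF crystal[OF assms(1)] top_carrier[OF assms(1)], of d] assms
  by (simp add: depth_def carrier_eq[symmetric] top_wt)

text \<open>The bounds of \<open>depth_bound\<close> solve a Cartan system whose right side is
  linear in the highest weight. By \<open>cartan_inj\<close> the bound for
  \<open>x *\<^sub>R \<theta>\<close> is \<open>x\<close> times that for \<open>\<theta>\<close>,
  and a string stays between depth 0 and this bound.\<close>

lemma string_bound:
  assumes l: "\<theta> \<in> chamber"
  shows "\<exists>K\<ge>0. \<forall>x\<ge>0. \<forall>d\<in>carrier (B (x *\<^sub>R \<theta>)). \<forall>s\<in>S. \<forall>r.
    op_e (B (x *\<^sub>R \<theta>)) s r (Some d) \<noteq> None \<longrightarrow> \<bar>r\<bar> \<le> K * x"
proof -
  obtain y0 where y0: "\<And>s. s \<in> S \<Longrightarrow> (\<Sum>t\<in>S. y0 t * cartan s t) = real (card (carrier W)) * coroot s \<theta>"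
    "\<And>x. depth \<theta> \<theta> x \<Longrightarrow> \<forall>t\<in>S. x t \<le> y0 t"
    using depth_bound[OF crystal[OF l] normal[OF l] top_carrier[OF l] carrier_eq[OF l] top_carrier[OF l]]
    unfolding top_wt[OF l] by blast
  have y0nn: "0 \<le> y0 t" if "t \<in> S" for t using y0(2)[of "\<lambda>_. 0"] that by (simp add: depth_def)
  have bound: "z s \<le> x * y0 s" if x: "x \<ge> 0" and d: "d \<in> carrier (B (x *\<^sub>R \<theta>))" and s: "s \<in> S"
    and z: "depth (x *\<^sub>R \<theta>) (wt (B (x *\<^sub>R \<theta>)) d) z" for x d s z
  proof -
    note xl = scale_chamber[OF l x]
    obtain y where y: "\<And>s. s \<in> S \<Longrightarrow> (\<Sum>t\<in>S. y t * cartan s t) = real (card (carrier W)) * coroot s (x *\<^sub>R \<theta>)"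
      "\<And>z. depth (x *\<^sub>R \<theta>) (wt (B (x *\<^sub>R \<theta>)) d) z \<Longrightarrow> \<forall>t\<in>S. z t \<le> y t"
      using depth_bound[OF crystal[OF xl] normal[OF xl] top_carrier[OF xl] carrier_eq[OF xl] d]
      unfolding top_wt[OF xl] by blast
    have "(\<Sum>t\<in>S. (y t - x * y0 t) * cartan u t) = 0" if u: "u \<in> S" for u
    proof -
      have "(\<Sum>t\<in>S. (y t - x * y0 t) * cartan u t) = (\<Sum>t\<in>S. y t * cartan u t) - x * (\<Sum>t\<in>S. y0 t * cartan u t)"
        by (simp add: left_diff_distrib sum_subtractf sum_distrib_left mult.assoc)
      then show ?thesis using y(1)[OF u] y0(1)[OF u] u by (simp add: coroot_simps)
    qed
    then have "y s - x * y0 s = 0" by (rule cartan_inj[OF _ s])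
    then show ?thesis using y(2)[OF z] s by auto
  qed
  define K where "K = (\<Sum>s\<in>S. y0 s)"
  have K: "0 \<le> K" "\<And>s. s \<in> S \<Longrightarrow> y0 s \<le> K"
    using y0nn finite_S by (auto simp: K_def intro: sum_nonneg member_le_sum)
  have "\<bar>r\<bar> \<le> K * x" if x: "x \<ge> 0" and d: "d \<in> carrier (B (x *\<^sub>R \<theta>))" and s: "s \<in> S"
    and op: "op_e (B (x *\<^sub>R \<theta>)) s r (Some d) \<noteq> None" for x d s r
  proof -
    note xl = scale_chamber[OF l x]
    obtain d' where d': "op_e (B (x *\<^sub>R \<theta>)) s r (Some d) = Some d'" using op by auto
    note dc = cr_closed[OF crystal[OF xl] s d d']
    obtain z where z: "depth (x *\<^sub>R \<theta>) (wt (B (x *\<^sub>R \<theta>)) d) z" using coeff_exists[OF xl d] by blast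
    obtain z' where z': "depth (x *\<^sub>R \<theta>) (wt (B (x *\<^sub>R \<theta>)) d') z'" using coeff_exists[OF xl dc] by blast
    have "z' s = z s - r" using depth_shift[OF z s] z' cr_wt[OF crystal[OF xl] s d d'] by simp
    moreover have "0 \<le> z s" "0 \<le> z' s" using z z' s by (auto simp: depth_def)
    moreover have "z s \<le> x * y0 s" "z' s \<le> x * y0 s" using bound[OF x d s z] bound[OF x dc s z'] .
    moreover have "x * y0 s \<le> K * x" using mult_left_mono[OF K(2)[OF s] x] by (simp add: mult.commute)
    ultimately show ?thesis by linarith
  qed
  then show ?thesis using K(1) by blast
qed

definition rate :: "'v \<Rightarrow> real" where
  "rate \<theta> = (SOME K. 0 \<le> K \<and> (\<forall>x\<ge>0. \<forall>d\<in>carrier (B (x *\<^sub>R \<theta>)). \<forall>s\<in>S. \<forall>r.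
    op_e (B (x *\<^sub>R \<theta>)) s r (Some d) \<noteq> None \<longrightarrow> \<bar>r\<bar> \<le> K * x))"

lemma
  assumes "\<theta> \<in> chamber"
  shows rate_nonneg: "0 \<le> rate \<theta>"
    and op_rate: "0 \<le> x \<Longrightarrow> d \<in> carrier (B (x *\<^sub>R \<theta>)) \<Longrightarrow> s \<in> S \<Longrightarrow>
      op_e (B (x *\<^sub>R \<theta>)) s r (Some d) \<noteq> None \<Longrightarrow> \<bar>r\<bar> \<le> rate \<theta> * x"
proof -
  have ex: "\<exists>K. 0 \<le> K \<and> (\<forall>x\<ge>0. \<forall>d\<in>carrier (B (x *\<^sub>R \<theta>)). \<forall>s\<in>S. \<forall>r.
      op_e (B (x *\<^sub>R \<theta>)) s r (Some d) \<noteq> None \<longrightarrow> \<bar>r\<bar> \<le> K * x)"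
    using string_bound[OF assms] by blast
  note P = someI_ex[OF ex, folded rate_def]
  show "0 \<le> rate \<theta>" by (rule P[THEN conjunct1])
  show "0 \<le> x \<Longrightarrow> d \<in> carrier (B (x *\<^sub>R \<theta>)) \<Longrightarrow> s \<in> S \<Longrightarrow>
      op_e (B (x *\<^sub>R \<theta>)) s r (Some d) \<noteq> None \<Longrightarrow> \<bar>r\<bar> \<le> rate \<theta> * x"
    by (rule P[THEN conjunct2, rule_format])
qed

lemma eps_real:
  assumes "\<mu> \<in> chamber" "s \<in> S" "d \<in> carrier (B \<mu>)"
  shows "\<exists>e\<ge>0. eps (B \<mu>) s d = ereal e \<and> phi (B \<mu>) s d = ereal (e + coroot s (wt (B \<mu>) d)) \<and>
    0 \<le> e + coroot s (wt (B \<mu>) d) \<and>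
    op_e (B \<mu>) s e (Some d) \<noteq> None \<and> op_e (B \<mu>) s (- (e + coroot s (wt (B \<mu>) d))) (Some d) \<noteq> None \<and>
    (\<forall>r. op_e (B \<mu>) s r (Some d) \<noteq> None \<longrightarrow> - (e + coroot s (wt (B \<mu>) d)) \<le> r \<and> r \<le> e)"
proof -
  obtain e where e: "e \<ge> 0" "eps (B \<mu>) s d = ereal e" "op_e (B \<mu>) s e (Some d) \<noteq> None"
    "\<And>r. r \<ge> 0 \<Longrightarrow> op_e (B \<mu>) s r (Some d) \<noteq> None \<Longrightarrow> r \<le> e"
    using normal_eps(1)[OF normal[OF assms(1)] assms(2,3)] by blast
  obtain f where f: "f \<ge> 0" "phi (B \<mu>) s d = ereal f" "op_e (B \<mu>) s (- f) (Some d) \<noteq> None"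
    "\<And>r. r \<ge> 0 \<Longrightarrow> op_e (B \<mu>) s (- r) (Some d) \<noteq> None \<Longrightarrow> r \<le> f"
    using normal_eps(2)[OF normal[OF assms(1)] assms(2,3)] by blast
  have fe: "f = e + coroot s (wt (B \<mu>) d)"
    using cr_phi[OF crystal[OF assms(1)] assms(2,3)] e(2) f(2) by simp
  have "- f \<le> r \<and> r \<le> e" if "op_e (B \<mu>) s r (Some d) \<noteq> None" for r
    using e(1) f(1) e(4)[of r] f(4)[of "- r"] that by (cases "r \<ge> 0") auto
  then show ?thesis using e(1,2,3) f(1,2,3) unfolding fe by blast
qed

context
  fixes \<theta> :: 'v
  assumes theta: "\<theta> \<in> chamber"
begin

abbreviation "low x \<equiv> B (x *\<^sub>R \<theta>)"
abbreviation "high x \<equiv> B ((1 - x) *\<^sub>R \<theta>)"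

definition left :: "('w \<times> real) list \<Rightarrow> real \<Rightarrow> 'b" where
  "left w x = fst (the (opw (tensor (low x) (high x)) w (top (x *\<^sub>R \<theta>), top ((1 - x) *\<^sub>R \<theta>))))"

definition right :: "('w \<times> real) list \<Rightarrow> real \<Rightarrow> 'b" where
  "right w x = snd (the (opw (tensor (low x) (high x)) w (top (x *\<^sub>R \<theta>), top ((1 - x) *\<^sub>R \<theta>))))"

text \<open>\<open>B(\<theta>)\<close> embeds into \<open>B(x\<theta>) \<otimes> B((1 - x)\<theta>)\<close>. The weight of the left factor, as a function of \<open>x\<close>,
  is the path that the element would have in the path model.\<close>

definition trace :: "('w \<times> real) list \<Rightarrow> real \<Rightarrow> 'v" where
  "trace w x = wt (low x) (left w x)"

text \<open>In the path model this is the running supremum, up to \<open>x\<close>, of minus the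
  \<open>s\<close>-coordinate of the trace. For an abstract family \<open>up_recursion\<close> takes
  the place of that formula.\<close>

definition up :: "('w \<times> real) list \<Rightarrow> 'w \<Rightarrow> real \<Rightarrow> real" where
  "up w s x = real_of_ereal (eps (low x) s (left w x))"

text \<open>In the path model this is the final \<open>s\<close>-coordinate of the trace minus its
  infimum from \<open>x\<close> on; hence the recursion for it runs from 1 downwards.\<close>

definition down :: "('w \<times> real) list \<Rightarrow> 'w \<Rightarrow> real \<Rightarrow> real" where
  "down w s x = real_of_ereal (phi (high x) s (right w x))"

lemma low_high_sim:
  assumes "0 \<le> x" "x \<le> 1"
  shows "crystal_sim S (tensor (low x) (high x)) (top (x *\<^sub>R \<theta>), top ((1 - x) *\<^sub>R \<theta>)) (B \<theta>) (top \<theta>)"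
proof -
  have "x *\<^sub>R \<theta> + (1 - x) *\<^sub>R \<theta> = \<theta>" by (simp add: scaleR_left_distrib[symmetric])
  then show ?thesis
    using pair_sim[OF scale_chamber[OF theta assms(1)] scale_chamber[OF theta, of "1 - x"]] assms by simp
qed

lemma top_trace: "0 \<le> x \<Longrightarrow> trace [] x = x *\<^sub>R \<theta>"
  by (simp add: trace_def left_def top_wt scale_chamber theta)

context
  fixes w c
  assumes w: "fst ` set w \<subseteq> S" and c: "opw (B \<theta>) w (top \<theta>) = Some c"
begin

lemma c_carrier: "c \<in> carrier (B \<theta>)"
  by (rule opw_carrier[OF crystal[OF theta] top_carrier[OF theta] w c])

lemma
  assumes "0 \<le> x" "x \<le> 1"
  shows opw_left_right: "opw (tensor (low x) (high x)) w (top (x *\<^sub>R \<theta>), top ((1 - x) *\<^sub>R \<theta>)) = Some (left w x, right w x)"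
    and left_carrier: "left w x \<in> carrier (low x)"
    and right_carrier: "right w x \<in> carrier (high x)"
    and left_right_data: "same_data S (tensor (low x) (high x)) (B \<theta>) (left w x, right w x) c"
proof -
  obtain d where d: "opw (tensor (low x) (high x)) w (top (x *\<^sub>R \<theta>), top ((1 - x) *\<^sub>R \<theta>)) = Some d"
    and sd: "same_data S (B \<theta>) (tensor (low x) (high x)) c d"
    using crystal_simD[OF crystal_sim_sym[OF low_high_sim[OF assms]] w c] by blast
  have dd: "d = (left w x, right w x)" unfolding left_def right_def d by simp
  show op: "opw (tensor (low x) (high x)) w (top (x *\<^sub>R \<theta>), top ((1 - x) *\<^sub>R \<theta>)) = Some (left w x, right w x)"
    using d dd by simp
  have ch: "x *\<^sub>R \<theta> \<in> chamber" "(1 - x) *\<^sub>R \<theta> \<in> chamber" using assms theta by (auto intro: scale_chamber)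
  show "left w x \<in> carrier (low x)" "right w x \<in> carrier (high x)"
    using opw_tensor_carrier[OF crystal[OF ch(1)] crystal[OF ch(2)] top_carrier[OF ch(1)] top_carrier[OF ch(2)] w op] by auto
  show "same_data S (tensor (low x) (high x)) (B \<theta>) (left w x, right w x) c"
    using sd dd by (auto simp: same_data_def)
qed

text \<open>Apply the word to three factors, of highest weights x\<theta>, (y - x)\<theta> and (1 -
  y)\<theta>. By associativity, merging the first two gives the splitting at \<open>y\<close>, and
  merging the last two gives the one at \<open>x\<close>. So the outer factors are
  \<open>left w x\<close> and \<open>right w y\<close>, and \<open>d\<close> is the middle
  one.\<close>

lemma split:
  assumes "0 \<le> x" "x \<le> y" "y \<le> 1"
  shows "\<exists>d\<in>carrier (B ((y - x) *\<^sub>R \<theta>)).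
    same_data S (tensor (low x) (B ((y - x) *\<^sub>R \<theta>))) (low y) (left w x, d) (left w y) \<and>
    same_data S (tensor (B ((y - x) *\<^sub>R \<theta>)) (high y)) (high x) (d, right w y) (right w x)"
proof -
  let ?M = "B ((y - x) *\<^sub>R \<theta>)"
  let ?a = "top (x *\<^sub>R \<theta>)" and ?b = "top ((y - x) *\<^sub>R \<theta>)" and ?c = "top ((1 - y) *\<^sub>R \<theta>)"
  have ch: "x *\<^sub>R \<theta> \<in> chamber" "(y - x) *\<^sub>R \<theta> \<in> chamber" "(1 - y) *\<^sub>R \<theta> \<in> chamber"
    using assms theta by (auto intro: scale_chamber)
  have eq: "x *\<^sub>R \<theta> + (y - x) *\<^sub>R \<theta> = y *\<^sub>R \<theta>" "(y - x) *\<^sub>R \<theta> + (1 - y) *\<^sub>R \<theta> = (1 - x) *\<^sub>R \<theta>"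
    by (simp_all add: scaleR_left_distrib[symmetric])
  have s1: "crystal_sim S (tensor (low x) ?M) (?a, ?b) (low y) (top (y *\<^sub>R \<theta>))"
    using pair_sim[OF ch(1,2)] unfolding eq .
  have s2: "crystal_sim S (tensor ?M (high y)) (?b, ?c) (high x) (top ((1 - x) *\<^sub>R \<theta>))"
    using pair_sim[OF ch(2,3)] unfolding eq .
  note ox = opw_left_right[of x] and oy = opw_left_right[of y]
  have "rel_option (rel_prod (linked S (tensor (low x) ?M) (?a, ?b) (low y) (top (y *\<^sub>R \<theta>))) (linked S (high y) ?c (high y) ?c))
      (opw (tensor (tensor (low x) ?M) (high y)) w ((?a, ?b), ?c)) (Some (left w y, right w y))"
    using tensor_linked[OF s1 crystal_sim_refl w, of "high y" ?c] oy assms by simp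
  then obtain d1 d2 d3 where d: "opw (tensor (tensor (low x) ?M) (high y)) w ((?a, ?b), ?c) = Some ((d1, d2), d3)"
    and l1: "linked S (tensor (low x) ?M) (?a, ?b) (low y) (top (y *\<^sub>R \<theta>)) (d1, d2) (left w y)"
    and "linked S (high y) ?c (high y) ?c d3 (right w y)"
    by (cases "opw (tensor (tensor (low x) ?M) (high y)) w ((?a, ?b), ?c)") auto
  then have d3: "d3 = right w y" by (simp add: linked_refl)
  note ta = tensor_assoc[OF crystal[OF ch(1)] crystal[OF ch(2)] crystal[OF ch(3)]
      normal[OF ch(1)] normal[OF ch(2)] normal[OF ch(3)] top_carrier[OF ch(1)] top_carrier[OF ch(2)] top_carrier[OF ch(3)] w]
  have d': "opw (tensor (low x) (tensor ?M (high y))) w (?a, ?b, ?c) = Some (d1, d2, d3)"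
    using ta d by (simp add: reassoc_def)
  have "rel_option (rel_prod (linked S (low x) ?a (low x) ?a) (linked S (tensor ?M (high y)) (?b, ?c) (high x) (top ((1 - x) *\<^sub>R \<theta>))))
      (Some (d1, d2, d3)) (Some (left w x, right w x))"
    using tensor_linked[OF crystal_sim_refl s2 w, of "low x" ?a] ox assms d' by simp
  then have "linked S (low x) ?a (low x) ?a d1 (left w x)"
    and l2: "linked S (tensor ?M (high y)) (?b, ?c) (high x) (top ((1 - x) *\<^sub>R \<theta>)) (d2, d3) (right w x)" by auto
  then have d1: "d1 = left w x" by (simp add: linked_refl)
  show ?thesis
    using linked_same_data[OF s1 l1] linked_same_data[OF s2 l2] ta d unfolding d1 d3 by blast
qed

lemma data:
  assumes x: "0 \<le> x" "x \<le> 1" and s: "s \<in> S"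
  shows "0 \<le> up w s x" "0 \<le> down w s x"
    "0 \<le> up w s x + coroot s (trace w x)" "0 \<le> down w s x - coroot s (wt (B \<theta>) c - trace w x)"
    "eps (low x) s (left w x) = ereal (up w s x)"
    "phi (low x) s (left w x) = ereal (up w s x + coroot s (trace w x))"
    "eps (high x) s (right w x) = ereal (down w s x - coroot s (wt (B \<theta>) c - trace w x))"
    "phi (high x) s (right w x) = ereal (down w s x)"
    "tensor_sigma (low x) (high x) s (left w x) (right w x) = up w s x - down w s x + coroot s (wt (B \<theta>) c)"
    "up w s x \<le> rate \<theta> * x" "down w s x \<le> rate \<theta> * (1 - x)"
    "up w s x + coroot s (trace w x) \<le> rate \<theta> * x"
    "down w s x - coroot s (wt (B \<theta>) c - trace w x) \<le> rate \<theta> * (1 - x)"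
proof -
  have x1: "0 \<le> 1 - x" using x by simp
  have ch: "x *\<^sub>R \<theta> \<in> chamber" "(1 - x) *\<^sub>R \<theta> \<in> chamber" using x theta by (auto intro: scale_chamber)
  note lc = left_carrier[OF x] and rc = right_carrier[OF x]
  have "wt (B \<theta>) c = trace w x + wt (high x) (right w x)"
    using left_right_data[OF x] by (simp add: same_data_def tensor_simps trace_def)
  then have wr: "wt (high x) (right w x) = wt (B \<theta>) c - trace w x" by simp
  obtain e where e: "e \<ge> 0" "eps (low x) s (left w x) = ereal e"
    "phi (low x) s (left w x) = ereal (e + coroot s (trace w x))" "0 \<le> e + coroot s (trace w x)"
    "op_e (low x) s e (Some (left w x)) \<noteq> None" "op_e (low x) s (- (e + coroot s (trace w x))) (Some (left w x)) \<noteq> None"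
    using eps_real[OF ch(1) s lc] unfolding trace_def by blast
  obtain f where f: "f \<ge> 0" "eps (high x) s (right w x) = ereal f"
    "phi (high x) s (right w x) = ereal (f + coroot s (wt (B \<theta>) c - trace w x))" "0 \<le> f + coroot s (wt (B \<theta>) c - trace w x)"
    "op_e (high x) s f (Some (right w x)) \<noteq> None"
    "op_e (high x) s (- (f + coroot s (wt (B \<theta>) c - trace w x))) (Some (right w x)) \<noteq> None"
    using eps_real[OF ch(2) s rc] unfolding wr by blast
  have eu: "e = up w s x" by (simp add: up_def e(2))
  have fd: "f = down w s x - coroot s (wt (B \<theta>) c - trace w x)" by (simp add: down_def f(3))
  show "0 \<le> up w s x" "0 \<le> up w s x + coroot s (trace w x)"
    "eps (low x) s (left w x) = ereal (up w s x)"
    "phi (low x) s (left w x) = ereal (up w s x + coroot s (trace w x))"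
    using e(1-4) unfolding eu by simp_all
  show "0 \<le> down w s x" "0 \<le> down w s x - coroot s (wt (B \<theta>) c - trace w x)"
    "eps (high x) s (right w x) = ereal (down w s x - coroot s (wt (B \<theta>) c - trace w x))"
    "phi (high x) s (right w x) = ereal (down w s x)"
    using f(1-4) unfolding fd by simp_all
  show "tensor_sigma (low x) (high x) s (left w x) (right w x) = up w s x - down w s x + coroot s (wt (B \<theta>) c)"
    using s by (simp add: tensor_sigma_def e(3) f(2) eu fd coroot_simps)
  show "up w s x \<le> rate \<theta> * x" "up w s x + coroot s (trace w x) \<le> rate \<theta> * x"
    using op_rate[OF theta x(1) lc s e(5)] op_rate[OF theta x(1) lc s e(6)] unfolding eu by linarith+
  show "down w s x \<le> rate \<theta> * (1 - x)" "down w s x - coroot s (wt (B \<theta>) c - trace w x) \<le> rate \<theta> * (1 - x)"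
    using op_rate[OF theta x1 rc s f(5)] op_rate[OF theta x1 rc s f(6)] unfolding fd by linarith+
qed

lemma up_0: "s \<in> S \<Longrightarrow> up w s 0 = 0" and down_1: "s \<in> S \<Longrightarrow> down w s 1 = 0"
  using data(1,10)[of 0 s] data(2,11)[of 1 s] by simp_all

text \<open>All strings of the right factor have length 0 at \<open>x = 1\<close>, and all those of
  the left factor at \<open>x = 0\<close>; so one factor alone carries the data of
  \<open>c\<close>.\<close>

lemma end_data:
  assumes s: "s \<in> S"
  shows "eps (B \<theta>) s c = ereal (up w s 1)" "phi (B \<theta>) s c = ereal (down w s 0)"
    "coroot s (wt (B \<theta>) c) = down w s 0 - up w s 1"
proof -
  note d1 = data[of 1 s, OF zero_le_one order_refl s] and d0 = data[of 0 s, OF order_refl zero_le_one s]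
  have "0 \<le> tensor_sigma (low 1) (high 1) s (left w 1) (right w 1)"
    unfolding tensor_sigma_def d1(6,7) using d1(3,13) by simp
  then have "max 0 (- tensor_sigma (low 1) (high 1) s (left w 1) (right w 1)) = 0" by simp
  moreover have "eps (B \<theta>) s c =
      eps (low 1) s (left w 1) + ereal (max 0 (- tensor_sigma (low 1) (high 1) s (left w 1) (right w 1)))"
    using left_right_data[of 1] s by (simp add: same_data_def tensor_simps del: ereal_max)
  ultimately show e: "eps (B \<theta>) s c = ereal (up w s 1)" unfolding d1(5) by simp
  have "tensor_sigma (low 0) (high 0) s (left w 0) (right w 0) \<le> 0"
    unfolding tensor_sigma_def d0(6,7) using d0(4,12) by simp
  then have "max 0 (tensor_sigma (low 0) (high 0) s (left w 0) (right w 0)) = 0" by simp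
  moreover have "phi (B \<theta>) s c =
      phi (high 0) s (right w 0) + ereal (max 0 (tensor_sigma (low 0) (high 0) s (left w 0) (right w 0)))"
    using left_right_data[of 0] s by (simp add: same_data_def tensor_simps del: ereal_max)
  ultimately show f: "phi (B \<theta>) s c = ereal (down w s 0)" unfolding d0(8) by simp
  show "coroot s (wt (B \<theta>) c) = down w s 0 - up w s 1"
    using cr_phi[OF crystal[OF theta] s c_carrier] unfolding e f by simp
qed

text \<open>The tensor rule for \<open>eps\<close> and \<open>phi\<close> in the two mergings of
  \<open>split\<close>. The middle factor enters only through its own \<open>eps\<close> or
  \<open>phi\<close>, which \<open>op_rate\<close> bounds by a multiple of
  \<open>y - x\<close>.\<close>

lemma
  assumes x: "0 \<le> x" "x \<le> y" "y \<le> 1" and s: "s \<in> S"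
  shows up_recursion: "\<exists>e. 0 \<le> e \<and> e \<le> rate \<theta> * (y - x) \<and> up w s y = max (up w s x) (e - coroot s (trace w x))"
    and down_recursion: "\<exists>e. 0 \<le> e \<and> e \<le> rate \<theta> * (y - x) \<and>
      down w s x = max (down w s y) (e + coroot s (wt (B \<theta>) c - trace w y))"
proof -
  let ?M = "B ((y - x) *\<^sub>R \<theta>)"
  have yx: "0 \<le> y - x" using x by simp
  note ch = scale_chamber[OF theta yx]
  have x01: "0 \<le> x" "x \<le> 1" and y01: "0 \<le> y" "y \<le> 1" using x by auto
  obtain d where d: "d \<in> carrier ?M"
    "same_data S (tensor (low x) ?M) (low y) (left w x, d) (left w y)"
    "same_data S (tensor ?M (high y)) (high x) (d, right w y) (right w x)"
    using split[OF x] by blast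
  obtain e where e: "e \<ge> 0" "eps ?M s d = ereal e" "phi ?M s d = ereal (e + coroot s (wt ?M d))" "0 \<le> e + coroot s (wt ?M d)"
    "op_e ?M s e (Some d) \<noteq> None" "op_e ?M s (- (e + coroot s (wt ?M d))) (Some d) \<noteq> None"
    using eps_real[OF ch s d(1)] by blast
  have er: "e \<le> rate \<theta> * (y - x)" "e + coroot s (wt ?M d) \<le> rate \<theta> * (y - x)"
    using op_rate[OF theta yx d(1) s e(5)] op_rate[OF theta yx d(1) s e(6)] by linarith+
  note dx = data[OF x01 s] and dy = data[OF y01 s]
  have "eps (low y) s (left w y) = eps (low x) s (left w x) + ereal (max 0 (- tensor_sigma (low x) ?M s (left w x) d))"
    using d(2) s by (simp add: same_data_def tensor_simps)
  then have "up w s y = up w s x + max 0 (- (up w s x + coroot s (trace w x) - e))"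
    unfolding dx dy tensor_sigma_def e by (simp del: ereal_max)
  also have "\<dots> = max (up w s x) (e - coroot s (trace w x))" by (simp add: max_def)
  finally show "\<exists>e. 0 \<le> e \<and> e \<le> rate \<theta> * (y - x) \<and> up w s y = max (up w s x) (e - coroot s (trace w x))"
    using e(1) er(1) by blast
  have "phi (high x) s (right w x) = phi (high y) s (right w y) + ereal (max 0 (tensor_sigma ?M (high y) s d (right w y)))"
    using d(3) s by (simp add: same_data_def tensor_simps)
  then have "down w s x = down w s y + max 0 (e + coroot s (wt ?M d) - (down w s y - coroot s (wt (B \<theta>) c - trace w y)))"
    unfolding dx dy tensor_sigma_def e by (simp del: ereal_max)
  also have "\<dots> = max (down w s y) (e + coroot s (wt ?M d) + coroot s (wt (B \<theta>) c - trace w y))" by (simp add: max_def)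
  finally show "\<exists>e. 0 \<le> e \<and> e \<le> rate \<theta> * (y - x) \<and>
      down w s x = max (down w s y) (e + coroot s (wt (B \<theta>) c - trace w y))"
    using e(4) er(2) by blast
qed

lemma sigma_eq:
  assumes "0 \<le> x" "x \<le> 1" "s \<in> S"
  shows "tensor_sigma (low x) (high x) s (left w x) (right w x) = (down w s 0 - down w s x) - (up w s 1 - up w s x)"
  using data(9)[OF assms] end_data(3)[OF assms(3)] by simp

text \<open>The two recursions make \<open>\<sigma>\<close> Lipschitz in \<open>x\<close>. It runs
  from \<open>- up w s 1\<close> at 0 to \<open>down w s 0\<close> at 1, so the intermediate value
  theorem applies.\<close>

lemma sigma_surj:
  assumes s: "s \<in> S" and r: "- down w s 0 \<le> r" "r \<le> up w s 1"
  shows "\<exists>x. 0 \<le> x \<and> x \<le> 1 \<and> tensor_sigma (low x) (high x) s (left w x) (right w x) = - r"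
proof -
  define g where "g x = (down w s 0 - down w s x) - (up w s 1 - up w s x)" for x
  have inc: "\<bar>g y - g x\<bar> \<le> 2 * rate \<theta> * (y - x)" if x: "0 \<le> x" "x \<le> y" "y \<le> 1" for x y
  proof -
    obtain e where e: "0 \<le> e" "e \<le> rate \<theta> * (y - x)" "up w s y = max (up w s x) (e - coroot s (trace w x))"
      using up_recursion[OF x s] by blast
    obtain f where f: "0 \<le> f" "f \<le> rate \<theta> * (y - x)" "down w s x = max (down w s y) (f + coroot s (wt (B \<theta>) c - trace w y))"
      using down_recursion[OF x s] by blast
    \<comment> \<open>These are \<open>phi\<close> of the left and \<open>eps\<close> of the right
      factor; their nonnegativity limits the growth of the maxima to
      \<open>rate \<theta> * (y - x)\<close>.\<close>
    have "0 \<le> up w s x + coroot s (trace w x)" "0 \<le> down w s y - coroot s (wt (B \<theta>) c - trace w y)"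
      using data(3)[of x s] data(4)[of y s] x s by auto
    then have "up w s x \<le> up w s y" "up w s y \<le> up w s x + rate \<theta> * (y - x)"
      "down w s y \<le> down w s x" "down w s x \<le> down w s y + rate \<theta> * (y - x)" using e f by linarith+
    moreover have "2 * rate \<theta> * (y - x) = rate \<theta> * (y - x) + rate \<theta> * (y - x)" by simp
    ultimately show ?thesis unfolding g_def by linarith
  qed
  have "(2 * rate \<theta>)-lipschitz_on {0..1} g"
  proof (rule lipschitz_onI)
    fix x y :: real assume "x \<in> {0..1}" "y \<in> {0..1}"
    then show "dist (g x) (g y) \<le> 2 * rate \<theta> * dist x y"
      using inc[of x y] inc[of y x] by (cases "x \<le> y") (auto simp: dist_real_def abs_minus_commute)
  qed (use rate_nonneg[OF theta] in simp)
  then have "continuous_on {0..1} g" by (rule lipschitz_on_continuous_on)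
  moreover have "g 0 \<le> - r" "- r \<le> g 1" using r up_0[OF s] down_1[OF s] by (auto simp: g_def)
  ultimately obtain x where "0 \<le> x" "x \<le> 1" "g x = - r" using IVT'[of g 0 "- r" 1] by auto
  then show ?thesis using sigma_eq[OF _ _ s] unfolding g_def by auto
qed

lemma op_tensor_iff:
  assumes "0 \<le> x" "x \<le> 1" "s \<in> S"
  shows "op_e (tensor (low x) (high x)) s r (Some (left w x, right w x)) = None \<longleftrightarrow> op_e (B \<theta>) s r (Some c) = None"
proof -
  have w': "fst ` set ((s, r) # w) \<subseteq> S" using w assms(3) by auto
  show ?thesis
    using low_high_sim[OF assms(1,2), unfolded crystal_sim_def, rule_format, OF w']
      opw_left_right[OF assms(1,2)] c option.rel_distinct
    by (cases "op_e (tensor (low x) (high x)) s r (Some (left w x, right w x))"; cases "op_e (B \<theta>) s r (Some c)") auto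
qed

text \<open>Strings have no gaps: for suitable \<open>x\<close> the operator \<open>e\<^sub>s\<^sup>r\<close> moves only one tensor factor, by an amount
  by which that factor is also moved when the whole string is run through.\<close>

lemma op_None_iff:
  assumes s: "s \<in> S"
  shows "op_e (B \<theta>) s r (Some c) \<noteq> None \<longleftrightarrow> - down w s 0 \<le> r \<and> r \<le> up w s 1"
proof -
  obtain e where e: "eps (B \<theta>) s c = ereal e" "phi (B \<theta>) s c = ereal (e + coroot s (wt (B \<theta>) c))"
    "op_e (B \<theta>) s e (Some c) \<noteq> None" "op_e (B \<theta>) s (- (e + coroot s (wt (B \<theta>) c))) (Some c) \<noteq> None"
    and mx: "\<And>r. op_e (B \<theta>) s r (Some c) \<noteq> None \<Longrightarrow> - (e + coroot s (wt (B \<theta>) c)) \<le> r \<and> r \<le> e"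
    using eps_real[OF theta s c_carrier] by blast
  have eu: "e = up w s 1" using e(1) end_data(1)[OF s] by simp
  have fd: "e + coroot s (wt (B \<theta>) c) = down w s 0" using e(2) end_data(2)[OF s] by simp
  have "op_e (B \<theta>) s r (Some c) \<noteq> None" if r: "- down w s 0 \<le> r" "r \<le> up w s 1"
  proof -
    obtain x where x: "0 \<le> x" "x \<le> 1" and sg: "tensor_sigma (low x) (high x) s (left w x) (right w x) = - r"
      using sigma_surj[OF s r] by blast
    have ch: "x *\<^sub>R \<theta> \<in> chamber" "(1 - x) *\<^sub>R \<theta> \<in> chamber" using x theta by (auto intro: scale_chamber)
    note op = op_tensor_iff[OF x s, unfolded tensor_simps sg]
    have z: "op_e (low x) s 0 (Some (left w x)) \<noteq> None" "op_e (high x) s 0 (Some (right w x)) \<noteq> None"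
      using cr_zero[OF crystal[OF ch(1)] s left_carrier[OF x]] cr_zero[OF crystal[OF ch(2)] s right_carrier[OF x]] by auto
    have n: "tensor_opt a b \<noteq> None \<longleftrightarrow> a \<noteq> None \<and> b \<noteq> None" for a :: "'b option" and b :: "'b option"
      by (cases a; cases b) auto
    show ?thesis
    proof (cases "0 \<le> r")
      case True
      \<comment> \<open>Here \<open>\<sigma>\<close> is \<open>- r\<close>: the full raise by
        \<open>up w s 1\<close> already moves the right factor by \<open>r\<close>, and the raise by
        \<open>r\<close> leaves the left factor in place.\<close>
      have am: "min (up w s 1) (- (- r)) + max 0 (- r) = r" using r True by simp
      have "op_e (high x) s r (Some (right w x)) \<noteq> None"
        using e(3) op[of e] n unfolding eu am by metis
      then have "tensor_opt (op_e (low x) s 0 (Some (left w x))) (op_e (high x) s r (Some (right w x))) \<noteq> None"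
        using z n by blast
      moreover have "max r (- (- r)) - max 0 (- (- r)) = 0" "min r (- (- r)) + max 0 (- r) = r" using True by simp_all
      ultimately show ?thesis using op[of r] by metis
    next
      case False
      have am: "max (- down w s 0) (- (- r)) - max 0 (- (- r)) = r" using r False by simp
      have "op_e (low x) s r (Some (left w x)) \<noteq> None"
        using e(4) op[of "- down w s 0"] n unfolding fd am by metis
      then have "tensor_opt (op_e (low x) s r (Some (left w x))) (op_e (high x) s 0 (Some (right w x))) \<noteq> None"
        using z n by blast
      moreover have "max r (- (- r)) - max 0 (- (- r)) = r" "min r (- (- r)) + max 0 (- r) = 0" using False by simp_all
      ultimately show ?thesis using op[of r] by metis
    qed
  qed
  then show ?thesis using mx unfolding eu[symmetric] fd[symmetric] by blast
qed

text \<open>The left factor moves by an amount that depends only on \<open>r\<close> and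
  \<open>\<sigma>\<close>, and \<open>sigma_eq\<close> expresses \<open>\<sigma>\<close> by
  \<open>up\<close> and \<open>down\<close>. So the new trace is computed from quantities that the
  old one determines.\<close>

lemma trace_Cons:
  assumes x: "0 \<le> x" "x \<le> 1" and s: "s \<in> S" and r: "op_e (B \<theta>) s r (Some c) \<noteq> None"
  defines "q \<equiv> (down w s 0 - down w s x) - (up w s 1 - up w s x)"
  shows "trace ((s, r) # w) x = trace w x + (max r (- q) - max 0 (- q)) *\<^sub>R root s"
proof -
  have sg: "tensor_sigma (low x) (high x) s (left w x) (right w x) = q" unfolding q_def by (rule sigma_eq[OF x s])
  have ch: "x *\<^sub>R \<theta> \<in> chamber" using x theta by (auto intro: scale_chamber)
  have "op_e (tensor (low x) (high x)) s r (Some (left w x, right w x)) \<noteq> None" unfolding op_tensor_iff[OF x s] by (rule r)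
  then obtain d where d: "op_e (tensor (low x) (high x)) s r (Some (left w x, right w x)) = Some d" by auto
  then have "op_e (low x) s (max r (- q) - max 0 (- q)) (Some (left w x)) = Some (fst d)"
    by (simp add: tensor_simps sg tensor_opt_eq_Some)
  moreover have "left ((s, r) # w) x = fst d" unfolding left_def[of "(s, r) # w"] opw_simps opw_left_right[OF x] d by simp
  ultimately show ?thesis using cr_wt[OF crystal[OF ch] s left_carrier[OF x]] by (simp add: trace_def)
qed

end

end

end

context coxeter_realization
begin

text \<open>Induction on words with a double invariant: both families vanish together, and their
  traces agree. Equal traces give equal \<open>up\<close> and \<open>down\<close> by
  \<open>recursion_determines\<close>, hence the same vanishing and equal traces after one more
  letter.\<close>

theorem closed_family_unique:
  assumes P: "highest_weight_normal_family S root coroot B" "closed_family S root coroot B"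
    and Q: "highest_weight_normal_family S root coroot B'" "closed_family S root coroot B'"
    and mu: "\<mu> \<in> closed_chamber S coroot"
  shows "crystal_iso S (B \<mu>) (B' \<mu>)"
proof -
  interpret P: closed_crystal_family W S act root coroot B by unfold_locales (fact P)+
  interpret Q: closed_crystal_family W S act root coroot B' by unfold_locales (fact Q)+
  define K where "K = max (P.rate \<mu>) (Q.rate \<mu>)"
  have K: "P.rate \<mu> * z \<le> K * z" "Q.rate \<mu> * z \<le> K * z" if "0 \<le> z" for z
    unfolding K_def using that by (intro mult_right_mono; simp)+
  have main: "(opw (B \<mu>) w (P.top \<mu>) = None \<longleftrightarrow> opw (B' \<mu>) w (Q.top \<mu>) = None) \<and>
      (opw (B \<mu>) w (P.top \<mu>) \<noteq> None \<longrightarrow> (\<forall>x. 0 \<le> x \<longrightarrow> x \<le> 1 \<longrightarrow> P.trace \<mu> w x = Q.trace \<mu> w x))"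
    if "fst ` set w \<subseteq> S" for w
    using that
  proof (induction w)
    case Nil
    show ?case by (simp add: P.top_trace Q.top_trace mu)
  next
    case (Cons a w)
    obtain s r where a: "a = (s, r)" by (cases a)
    have s: "s \<in> S" and w: "fst ` set w \<subseteq> S" using Cons.prems a by auto
    note IH = Cons.IH[OF w]
    show ?case
    proof (cases "opw (B \<mu>) w (P.top \<mu>)")
      case None
      then show ?thesis using IH cr_None[OF P.crystal[OF mu] s] cr_None[OF Q.crystal[OF mu] s] by (simp add: a)
    next
      case c: (Some c)
      then obtain c' where c': "opw (B' \<mu>) w (Q.top \<mu>) = Some c'" using IH by auto
      have tr: "P.trace \<mu> w x = Q.trace \<mu> w x" if "0 \<le> x" "x \<le> 1" for x using IH c that by simp
      have wt: "wt (B \<mu>) c = wt (B' \<mu>) c'"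
        using opw_wt[OF P.crystal[OF mu] P.top_carrier[OF mu] finite_S w c]
          opw_wt[OF Q.crystal[OF mu] Q.top_carrier[OF mu] finite_S w c'] P.top_wt[OF mu] Q.top_wt[OF mu] by simp
      note up0 = P.up_0[OF mu w c s] Q.up_0[OF mu w c' s]
      note down1 = P.down_1[OF mu w c s] Q.down_1[OF mu w c' s]
      have up: "P.up \<mu> w s x = Q.up \<mu> w s x" if x: "0 \<le> x" "x \<le> 1" for x
      proof (rule recursion_determines[where K = K and a = "\<lambda>x. coroot s (P.trace \<mu> w x)", OF _ _ _ x])
        fix x y :: real assume xy: "0 \<le> x" "x \<le> y" "y \<le> 1"
        have yx: "0 \<le> y - x" using xy by simp
        show "\<exists>e\<ge>0. e \<le> K * (y - x) \<and> P.up \<mu> w s y = max (P.up \<mu> w s x) (e - coroot s (P.trace \<mu> w x))"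
          using P.up_recursion[OF mu w c xy s] K(1)[OF yx] by (meson order_trans)
        have "P.trace \<mu> w x = Q.trace \<mu> w x" using tr xy by simp
        then show "\<exists>e\<ge>0. e \<le> K * (y - x) \<and> Q.up \<mu> w s y = max (Q.up \<mu> w s x) (e - coroot s (P.trace \<mu> w x))"
          using Q.up_recursion[OF mu w c' xy s] K(2)[OF yx] by (metis order_trans)
      qed (simp add: up0)
      \<comment> \<open>The value of \<open>down\<close> is known at 1 and is determined from there
        backwards, hence the substitution of \<open>1 - x\<close>.\<close>
      have down: "P.down \<mu> w s (1 - x) = Q.down \<mu> w s (1 - x)" if x: "0 \<le> x" "x \<le> 1" for x
      proof (rule recursion_determines[where K = K and a = "\<lambda>x. - coroot s (wt (B \<mu>) c - P.trace \<mu> w (1 - x))"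
            and h = "\<lambda>x. P.down \<mu> w s (1 - x)" and h' = "\<lambda>x. Q.down \<mu> w s (1 - x)", OF _ _ _ x])
        fix x y :: real assume xy: "0 \<le> x" "x \<le> y" "y \<le> 1"
        have yx: "0 \<le> y - x" and xy': "0 \<le> 1 - y" "1 - y \<le> 1 - x" "1 - x \<le> 1" using xy by auto
        have eq: "(1 - x) - (1 - y) = y - x" by simp
        have m: "z - - u = z + u" for z u :: real by simp
        show "\<exists>e\<ge>0. e \<le> K * (y - x) \<and>
            P.down \<mu> w s (1 - y) = max (P.down \<mu> w s (1 - x)) (e - - coroot s (wt (B \<mu>) c - P.trace \<mu> w (1 - x)))"
          using P.down_recursion[OF mu w c xy' s] K(1)[OF yx] unfolding m eq by (meson order_trans)
        have "P.trace \<mu> w (1 - x) = Q.trace \<mu> w (1 - x)" using tr xy by simp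
        then show "\<exists>e\<ge>0. e \<le> K * (y - x) \<and>
            Q.down \<mu> w s (1 - y) = max (Q.down \<mu> w s (1 - x)) (e - - coroot s (wt (B \<mu>) c - P.trace \<mu> w (1 - x)))"
          using Q.down_recursion[OF mu w c' xy' s] K(2)[OF yx] unfolding m eq wt by (metis order_trans)
      qed (simp add: down1)
      have up1: "P.up \<mu> w s 1 = Q.up \<mu> w s 1" and down0: "P.down \<mu> w s 0 = Q.down \<mu> w s 0"
        using up[of 1] down[of 1] by simp_all
      have N: "op_e (B \<mu>) s r (Some c) = None \<longleftrightarrow> op_e (B' \<mu>) s r (Some c') = None"
        using P.op_None_iff[OF mu w c s, of r] Q.op_None_iff[OF mu w c' s, of r] unfolding up1 down0 by metis
      have "P.trace \<mu> ((s, r) # w) x = Q.trace \<mu> ((s, r) # w) x"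
        if ne: "op_e (B \<mu>) s r (Some c) \<noteq> None" and x: "0 \<le> x" "x \<le> 1" for x
      proof -
        have ne': "op_e (B' \<mu>) s r (Some c') \<noteq> None" using ne N by simp
        have "P.down \<mu> w s x = Q.down \<mu> w s x" using down[of "1 - x"] x by simp
        then show ?thesis
          unfolding P.trace_Cons[OF mu w c x s ne] Q.trace_Cons[OF mu w c' x s ne'] tr[OF x] up[OF x] up1 down0 by simp
      qed
      then show ?thesis using N by (simp add: a c c')
    qed
  qed
  note P' = P.crystal[OF mu] P.top_carrier[OF mu] and Q' = Q.crystal[OF mu] Q.top_carrier[OF mu]
  have sim: "crystal_sim S (B \<mu>) (P.top \<mu>) (B' \<mu>) (Q.top \<mu>)"
    by (rule crystal_simI_normal[OF P'(1) Q'(1) P.normal[OF mu] Q.normal[OF mu] finite_S P'(2) Q'(2)])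
      (use main P.top_wt[OF mu] Q.top_wt[OF mu] in auto)
  show ?thesis
  proof (rule sim_iso[OF P'(1) Q'(1) P'(2) Q'(2) P.carrier_eq[OF mu] Q.carrier_eq[OF mu] _ _ sim])
    show "c = P.top \<mu>" if "c \<in> carrier (B \<mu>)" "wt (B \<mu>) c = wt (B \<mu>) (P.top \<mu>)" for c
      using f_orbit_top[OF P' _ that(2)] that(1) P.carrier_eq[OF mu] by simp
    show "c = Q.top \<mu>" if "c \<in> carrier (B' \<mu>)" "wt (B' \<mu>) c = wt (B' \<mu>) (Q.top \<mu>)" for c
      using f_orbit_top[OF Q' _ that(2)] that(1) Q.carrier_eq[OF mu] by simp
  qed
qed

end

theorem theorem4p14:
  fixes W :: "('w, 'x) monoid_scheme" and S :: "'w set"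
    and act :: "'w \<Rightarrow> 'v::real_vector \<Rightarrow> 'v"
    and simple_root :: "'w \<Rightarrow> 'v::real_vector" and coroot :: "'w \<Rightarrow> 'v::real_vector \<Rightarrow> real"
  assumes "coxeter_system W S" and "finite (carrier W)"
    and "realization W S act simple_root coroot"
  shows "(\<exists>B :: 'v \<Rightarrow> (real \<Rightarrow> 'v, 'w, 'v) crystal.
            highest_weight_normal_family S simple_root coroot B \<and> closed_family S simple_root coroot B) \<and>
         (\<forall>(B :: 'v \<Rightarrow> ('b, 'w, 'v) crystal)
            (B' :: 'v \<Rightarrow> ('c, 'w, 'v) crystal).
            highest_weight_normal_family S simple_root coroot B \<and> closed_family S simple_root coroot B \<and>
            highest_weight_normal_family S simple_root coroot B' \<and> closed_family S simple_root coroot B' \<longrightarrow>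
            (\<forall>\<mu>\<in>closed_chamber S coroot. crystal_iso S (B \<mu>) (B' \<mu>)))"
proof -
  interpret group W using assms(1) by (simp add: coxeter_system_def)
  interpret coxeter_realization W S act simple_root coroot by unfold_locales (fact assms)+
  show ?thesis
    using path_family_highest_weight_normal path_family_closed closed_family_unique by blast
qed

end
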